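(* There is an algorithm that, given a set $\mathcal{R}$ of rules on a finite ground set $Q$, computes the set of all critical rules of the antimatroid $\mathcal{A}(\mathcal{R})$ in time $O(l(\mathcal{R})^2)$.
   Context: A rule on $Q$ is a pair $(A,q)$ with $A\subseteq Q$, $q\in Q$; it accepts $X\subseteq Q$ if $q\in X$ implies $X\cap A\neq\emptyset$. For a set $\mathcal{R}$ of rules, $\mathcal{K}(\mathcal{R})$ is the family of subsets of $Q$ accepted by all rules in $\mathcal{R}$. A tight path from $\emptyset$ to $X$ in a family $\mathcal{K}$ is a sequence $\emptyset=Y_0\subseteq\dots\subseteq Y_k=X$ of members of $\mathcal{K}$ with $|Y_{i+1}\setminus Y_i|=1$. $\mathcal{A}(\mathcal{R})$ is the family of $K\in\mathcal{K}(\mathcal{R})$ such that there is a tight path from $\emptyset$ to $K$ in $\mathcal{K}(\mathcal{R})$; it is an antimatroid (union-closed, and every nonempty member $X$ has $x\in X$ with $X\setminus\{x\}$ a member). For an antimatroid $\mathcal{A}$ on $Q$, let $\mathcal{A}^*=\{Q\setminus X: X\in\mathcal{A}\}$ and let $\tau(X)=\bigcap\{Y\in\mathcal{A}^*: X\subseteq Y\}$ be its closure operator. A rule $(A,q)$ with $q\notin A$ is critical for $\mathcal{A}$ if, writing $C=A\cup\{q\}$, one has $\tau(C)\setminus\{q\}\notin\mathcal{A}^*$ and $\tau(C)\setminus\{q,s\}\in\mathcal{A}^*$ for every $s\in A$. The input size is $l(\mathcal{R})=\sum_{(A,q)\in\mathcal{R}}(|A|+1)$. *)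

theory Defs
  imports Main
begin

type_synonym 'a rule = "'a set \<times> 'a"

definition accepts :: "'a rule \<Rightarrow> 'a set \<Rightarrow> bool" where
  "accepts r X \<longleftrightarrow> (snd r \<in> X \<longrightarrow> X \<inter> fst r \<noteq> {})"

definition rule_on :: "'a set \<Rightarrow> 'a rule \<Rightarrow> bool" where
  "rule_on Q r \<longleftrightarrow> fst r \<subseteq> Q \<and> snd r \<in> Q"

definition KR :: "'a set \<Rightarrow> 'a rule set \<Rightarrow> 'a set set" where
  "KR Q R = {X. X \<subseteq> Q \<and> (\<forall>r\<in>R. accepts r X)}"

definition tight_path :: "'a set set \<Rightarrow> 'a set \<Rightarrow> bool" where
  "tight_path K X \<longleftrightarrow> (\<exists>Ys. Ys \<noteq> [] \<and> hd Ys = {} \<and> last Ys = X \<and> set Ys \<subseteq> K \<and>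
      (\<forall>i. Suc i < length Ys \<longrightarrow> Ys ! i \<subseteq> Ys ! Suc i \<and> card (Ys ! Suc i - Ys ! i) = 1))"

definition AR :: "'a set \<Rightarrow> 'a rule set \<Rightarrow> 'a set set" where
  "AR Q R = {K \<in> KR Q R. tight_path (KR Q R) K}"

definition dual_fam :: "'a set \<Rightarrow> 'a set set \<Rightarrow> 'a set set" where
  "dual_fam Q A = (\<lambda>X. Q - X) ` A"

definition tau :: "'a set \<Rightarrow> 'a set set \<Rightarrow> 'a set \<Rightarrow> 'a set" where
  "tau Q A X = \<Inter>{Y \<in> dual_fam Q A. X \<subseteq> Y}"

definition critical :: "'a set \<Rightarrow> 'a set set \<Rightarrow> 'a rule \<Rightarrow> bool" where
  "critical Q A r \<longleftrightarrow> (let B = fst r; q = snd r; C = insert q B in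
      q \<notin> B \<and> tau Q A C - {q} \<notin> dual_fam Q A \<and>
      (\<forall>s\<in>B. tau Q A C - {q, s} \<in> dual_fam Q A))"

definition critical_rules :: "'a set \<Rightarrow> 'a set set \<Rightarrow> 'a rule set" where
  "critical_rules Q A = {r. rule_on Q r \<and> critical Q A r}"

definition input_size :: "'a rule set \<Rightarrow> nat" where
  "input_size R = (\<Sum>r\<in>R. card (fst r) + 1)"

datatype instr =
    Const nat nat
  | Add nat nat nat
  | Sub nat nat nat
  | LoadI nat nat
  | StoreI nat nat
  | Jz nat nat
  | Jmp nat
  | Halt

type_synonym config = "nat \<times> (nat \<Rightarrow> nat)"

fun exec :: "instr \<Rightarrow> config \<Rightarrow> config" where
  "exec (Const r k) (pc, m) = (Suc pc, m(r := k))"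
| "exec (Add r a b) (pc, m) = (Suc pc, m(r := m a + m b))"
| "exec (Sub r a b) (pc, m) = (Suc pc, m(r := m a - m b))"
| "exec (LoadI r a) (pc, m) = (Suc pc, m(r := m (m a)))"
| "exec (StoreI a r) (pc, m) = (Suc pc, m(m a := m r))"
| "exec (Jz r t) (pc, m) = (if m r = 0 then (t, m) else (Suc pc, m))"
| "exec (Jmp t) (pc, m) = (t, m)"
| "exec Halt (pc, m) = (pc, m)"

definition halted :: "instr list \<Rightarrow> config \<Rightarrow> bool" where
  "halted P c \<longleftrightarrow> fst c \<ge> length P \<or> P ! fst c = Halt"

definition step :: "instr list \<Rightarrow> config \<Rightarrow> config" where
  "step P c = (if halted P c then c else exec (P ! fst c) c)"

definition run :: "instr list \<Rightarrow> nat \<Rightarrow> config \<Rightarrow> config" where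
  "run P t c = (step P ^^ t) c"

text \<open>A set of rules on Q = {0..<n} is given as a list of pairs (xs, q) where xs lists A.
  Encoding: n, number of rules, then for each rule: q, |A|, elements of A.\<close>

definition enc_input :: "nat \<Rightarrow> (nat list \<times> nat) list \<Rightarrow> nat list" where
  "enc_input n rs = n # length rs # concat (map (\<lambda>(xs, q). q # length xs # xs) rs)"

definition init_mem :: "nat list \<Rightarrow> nat \<Rightarrow> nat" where
  "init_mem L i = (if i < length L then L ! i else 0)"

fun dec_rules :: "(nat \<Rightarrow> nat) \<Rightarrow> nat \<Rightarrow> nat \<Rightarrow> nat rule list" where
  "dec_rules m a 0 = []"
| "dec_rules m a (Suc k) =
     (set (map m [a + 2..<a + 2 + m (a + 1)]), m a) # dec_rules m (a + 2 + m (a + 1)) k"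

definition output_rules :: "(nat \<Rightarrow> nat) \<Rightarrow> nat rule set" where
  "output_rules m = set (dec_rules m 1 (m 0))"

definition valid_input :: "nat \<Rightarrow> (nat list \<times> nat) list \<Rightarrow> bool" where
  "valid_input n rs \<longleftrightarrow> (\<forall>(xs, q)\<in>set rs. distinct xs \<and> set xs \<subseteq> {0..<n} \<and> q < n) \<and>
     distinct (map (\<lambda>(xs, q). (set xs, q)) rs)"

definition rules_of :: "(nat list \<times> nat) list \<Rightarrow> nat rule set" where
  "rules_of rs = (\<lambda>(xs, q). (set xs, q)) ` set rs"

end

theory Submission
  imports Defs
begin

text \<open>For an input rule \<open>(B, q)\<close> with \<open>q\<close> not in \<open>B\<close> let \<open>X\<close> be the largest feasible set
  avoiding \<open>B \<union> {q}\<close> and let \<open>A\<close> be the set of those \<open>s\<close> in \<open>B\<close> for which \<open>X \<union> {s}\<close> is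
  feasible.  Then \<open>(A, q)\<close> is critical iff \<open>X \<union> {s, q}\<close> is feasible for all \<open>s\<close> in \<open>A\<close>, and every
  critical rule arises in this way.  The set \<open>X\<close> is computed by propagation: every element carries
  the number of rules with that head that are still violated, and an element whose counter reaches 0
  is added and satisfies the rules in which it occurs.  As the occurrences of each element are linked,
  this takes linear time for one input rule.  Finally, \<open>A\<close> is contained in the body of another violated
  rule with head \<open>q\<close> iff that body contains exactly \<open>|A|\<close> elements that can be added to \<open>X\<close>, so the
  test for criticality amounts to comparing counters.\<close>

section \<open>Structured programs for the random access machine\<close>

text \<open>With \<open>K\<close> rules and \<open>M\<close> occurrences of elements in their bodies
  the input size is \<open>K + M\<close>; testing one input rule costs O(\<open>K + M\<close>), and
  there are \<open>K\<close> tests. Two obstacles shape the program. The size \<open>n\<close> of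
  the ground set is not bounded by the input size, so no array indexed by elements may be cleared as
  a whole: every round resets only the cells of elements that occur in some rule, and an element
  that lies in no body can never satisfy a rule, so propagation may miss it without falsifying any
  counter. Moreover the input starts at cell 0 and leaves no working registers, so it has to be
  moved away before ordinary code can run, and the result has to be moved back over the registers at
  the end. In between, the program works on sixteen interleaved arrays. Time is counted on a clock
  that ticks once per loop iteration; for one fixed program this is machine time up to a constant
  factor, so all running time arguments reduce to counting iterations.\<close>

type_synonym mem = "nat \<Rightarrow> nat"

datatype com0 = Block "instr list" | Seq0 com0 com0 | If0 nat com0 com0 | While0 nat com0

definition ins :: "instr \<Rightarrow> mem \<Rightarrow> mem" where
  "ins i m = snd (exec i (0, m))"

fun straight :: "instr \<Rightarrow> bool" where
  "straight (Jz r t) = False"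
| "straight (Jmp t) = False"
| "straight Halt = False"
| "straight _ = True"

lemma ins_simps [simp]:
  "ins (Const r k) m = m(r := k)"
  "ins (Add r a b) m = m(r := m a + m b)"
  "ins (Sub r a b) m = m(r := m a - m b)"
  "ins (LoadI r a) m = m(r := m (m a))"
  "ins (StoreI a r) m = m(m a := m r)"
  by (simp_all add: ins_def)

fun ok0 :: "com0 \<Rightarrow> bool" where
  "ok0 (Block is) \<longleftrightarrow> list_all straight is"
| "ok0 (Seq0 c d) \<longleftrightarrow> ok0 c \<and> ok0 d"
| "ok0 (If0 r c d) \<longleftrightarrow> ok0 c \<and> ok0 d"
| "ok0 (While0 r c) \<longleftrightarrow> ok0 c"

text \<open>The two numbers are clock values. Only \<open>WhileT0\<close> advances the clock, once
  per completed iteration; everything between two ticks is bounded by the code size.\<close>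

inductive ex0 :: "com0 \<Rightarrow> nat \<Rightarrow> mem \<Rightarrow> nat \<Rightarrow> mem \<Rightarrow> bool" where
  Block0: "ex0 (Block is) t m t (fold ins is m)"
| Seq0: "ex0 c t m t' m' \<Longrightarrow> ex0 d t' m' t'' m'' \<Longrightarrow> ex0 (Seq0 c d) t m t'' m''"
| IfT0: "m r \<noteq> 0 \<Longrightarrow> ex0 c t m t' m' \<Longrightarrow> ex0 (If0 r c d) t m t' m'"
| IfF0: "m r = 0 \<Longrightarrow> ex0 d t m t' m' \<Longrightarrow> ex0 (If0 r c d) t m t' m'"
| WhileF0: "m r = 0 \<Longrightarrow> ex0 (While0 r c) t m t m"
| WhileT0: "m r \<noteq> 0 \<Longrightarrow> ex0 c t m t' m' \<Longrightarrow> ex0 (While0 r c) (Suc t') m' t'' m'' \<Longrightarrow>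
    ex0 (While0 r c) t m t'' m''"

fun size0 :: "com0 \<Rightarrow> nat" where
  "size0 (Block is) = length is"
| "size0 (Seq0 c d) = size0 c + size0 d"
| "size0 (If0 r c d) = size0 c + size0 d + 2"
| "size0 (While0 r c) = size0 c + 2"

text \<open>Jump targets of the machine are absolute, hence the parameter \<open>p\<close>, the
  address at which the code is placed.\<close>

fun comp0 :: "nat \<Rightarrow> com0 \<Rightarrow> instr list" where
  "comp0 p (Block is) = is"
| "comp0 p (Seq0 c d) = comp0 p c @ comp0 (p + size0 c) d"
| "comp0 p (If0 r c d) = Jz r (p + size0 c + 2) # comp0 (Suc p) c @
     Jmp (p + size0 c + size0 d + 2) # comp0 (p + size0 c + 2) d"
| "comp0 p (While0 r c) = Jz r (p + size0 c + 2) # comp0 (Suc p) c @ [Jmp p]"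

lemma length_comp0 [simp]: "length (comp0 p c) = size0 c"
  by (induction c arbitrary: p) auto

lemma run_add: "run P (a + b) c = run P b (run P a c)"
  by (simp add: run_def funpow_add add.commute[of a b])

lemma run_1: "pc < length P \<Longrightarrow> P ! pc \<noteq> Halt \<Longrightarrow> run P (Suc 0) (pc, m) = exec (P ! pc) (pc, m)"
  by (simp add: run_def step_def halted_def)

lemma run_block:
  assumes "list_all straight is"
  shows "run (A @ is @ B) (length is) (length A, m) = (length A + length is, fold ins is m)"
  using assms
proof (induction "is" arbitrary: A m)
  case Nil
  then show ?case by (simp add: run_def)
next
  case (Cons i js)
  have e: "exec i (length A, m) = (Suc (length A), ins i m)"
    using Cons.prems by (cases i) auto
  have "run (A @ (i # js) @ B) (Suc 0) (length A, m) = (Suc (length A), ins i m)"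
    using Cons.prems e by (subst run_1) (auto simp: nth_append)
  moreover have "run (A @ (i # js) @ B) (length js) (Suc (length A), ins i m)
      = (Suc (length A) + length js, fold ins js (ins i m))"
    using Cons.IH[of "A @ [i]" "ins i m"] Cons.prems by simp
  ultimately show ?case
    using run_add[of "A @ (i # js) @ B" "Suc 0" "length js"] by simp
qed

lemma ex0_mono: "ex0 c t m t' m' \<Longrightarrow> t \<le> t'"
  by (induction rule: ex0.induct) auto

text \<open>Between two loop iterations control only moves forward, so every instruction is executed
  at most once per iteration.\<close>

lemma run_comp0:
  assumes "ex0 c t m t' m'" "ok0 c"
  shows "\<exists>k. k \<le> size0 c * (t' - t + 1) \<and>
    run (A @ comp0 (length A) c @ B) k (length A, m) = (length A + size0 c, m')"
  using assms
proof (induction arbitrary: A B rule: ex0.induct)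
  case (Block0 "is" t m)
  then show ?case using run_block[of "is" A B m] by (intro exI[of _ "length is"]) auto
next
  case (Seq0 c t m t' m' d t'' m'')
  obtain k where k: "k \<le> size0 c * (t' - t + 1)"
    "run (A @ comp0 (length A) c @ (comp0 (length A + size0 c) d @ B)) k (length A, m)
      = (length A + size0 c, m')"
    using Seq0.IH(1) Seq0.prems by fastforce
  obtain l where l: "l \<le> size0 d * (t'' - t' + 1)"
    "run ((A @ comp0 (length A) c) @ comp0 (length (A @ comp0 (length A) c)) d @ B) l
      (length (A @ comp0 (length A) c), m') = (length (A @ comp0 (length A) c) + size0 d, m'')"
    using Seq0.IH(2)[of "A @ comp0 (length A) c" B] Seq0.prems by fastforce
  have "t \<le> t'" "t' \<le> t''" using Seq0.hyps ex0_mono by blast+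
  then have "size0 c * (t' - t + 1) \<le> size0 c * (t'' - t + 1)"
    "size0 d * (t'' - t' + 1) \<le> size0 d * (t'' - t + 1)" by auto
  then have "k + l \<le> size0 (Seq0 c d) * (t'' - t + 1)"
    using k(1) l(1) by (simp add: algebra_simps)
  then show ?case using k(2) l(2) by (intro exI[of _ "k + l"]) (simp add: run_add add.assoc)
next
  case (IfT0 m r c t t' m' d)
  let ?P = "A @ comp0 (length A) (If0 r c d) @ B"
  let ?J = "Jz r (length A + size0 c + 2)"
  obtain k where k: "k \<le> size0 c * (t' - t + 1)"
    "run ((A @ [?J]) @ comp0 (length (A @ [?J])) c @
       (Jmp (length A + size0 c + size0 d + 2) # comp0 (length A + size0 c + 2) d @ B)) k
       (length (A @ [?J]), m) = (length (A @ [?J]) + size0 c, m')"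
    using IfT0.IH IfT0.prems by fastforce
  have 1: "run ?P (Suc 0) (length A, m) = (Suc (length A), m)"
    using IfT0.hyps by (subst run_1) (auto simp: nth_append)
  have 2: "run ?P (Suc 0) (Suc (length A) + size0 c, m') = (length A + size0 c + size0 d + 2, m')"
    by (subst run_1) (auto simp: nth_append)
  have "run ?P (Suc 0 + (k + Suc 0)) (length A, m) = (length A + size0 c + size0 d + 2, m')"
    using 1 2 k(2) unfolding run_add by simp
  moreover have "Suc 0 + (k + Suc 0) \<le> size0 (If0 r c d) * (t' - t + 1)"
    using k(1) by (simp add: algebra_simps)
  ultimately show ?case by (intro exI[of _ "Suc 0 + (k + Suc 0)"]) simp
next
  case (IfF0 m r d t t' m' c)
  let ?P = "A @ comp0 (length A) (If0 r c d) @ B"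
  let ?C = "A @ Jz r (length A + size0 c + 2) # comp0 (Suc (length A)) c @
     [Jmp (length A + size0 c + size0 d + 2)]"
  obtain k where k: "k \<le> size0 d * (t' - t + 1)"
    "run (?C @ comp0 (length ?C) d @ B) k (length ?C, m) = (length ?C + size0 d, m')"
    using IfF0.IH[of ?C B] IfF0.prems by fastforce
  have P: "?C @ comp0 (length ?C) d @ B = ?P" by simp
  have 1: "run ?P (Suc 0) (length A, m) = (length ?C, m)"
    using IfF0.hyps by (subst run_1) (auto simp: nth_append)
  have "run ?P (Suc 0 + k) (length A, m) = (length A + size0 c + size0 d + 2, m')"
    using 1 k(2) unfolding run_add P by simp
  moreover have "Suc 0 + k \<le> size0 (If0 r c d) * (t' - t + 1)"
    using k(1) by (simp add: algebra_simps)
  ultimately show ?case by (intro exI[of _ "Suc 0 + k"]) simp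
next
  case (WhileF0 m r c t)
  let ?P = "A @ comp0 (length A) (While0 r c) @ B"
  have 1: "run ?P (Suc 0) (length A, m) = (length A + size0 c + 2, m)"
    using WhileF0.hyps by (subst run_1) (auto simp: nth_append)
  then show ?case by (intro exI[of _ "Suc 0"]) simp
next
  case (WhileT0 m r c t t' m' t'' m'')
  let ?P = "A @ comp0 (length A) (While0 r c) @ B"
  let ?J = "Jz r (length A + size0 c + 2)"
  obtain k where k: "k \<le> size0 c * (t' - t + 1)"
    "run ((A @ [?J]) @ comp0 (length (A @ [?J])) c @ (Jmp (length A) # B)) k
       (length (A @ [?J]), m) = (length (A @ [?J]) + size0 c, m')"
    using WhileT0.IH(1) WhileT0.prems by fastforce
  obtain l where l: "l \<le> size0 (While0 r c) * (t'' - Suc t' + 1)"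
    "run ?P l (length A, m') = (length A + size0 (While0 r c), m'')"
    using WhileT0.IH(2)[of A B] WhileT0.prems by blast
  have 1: "run ?P (Suc 0) (length A, m) = (Suc (length A), m)"
    using WhileT0.hyps by (subst run_1) (auto simp: nth_append)
  have 2: "run ?P (Suc 0) (Suc (length A) + size0 c, m') = (length A, m')"
    by (subst run_1) (auto simp: nth_append)
  have r: "run ?P (Suc 0 + (k + (Suc 0 + l))) (length A, m) = (length A + size0 (While0 r c), m'')"
    using 1 2 k(2) l(2) unfolding run_add by simp
  have tt: "t \<le> t'" "Suc t' \<le> t''" using WhileT0.hyps ex0_mono by blast+
  then obtain a b where ab: "t' = t + a" "t'' = Suc t' + b" by (metis le_iff_add)
  \<comment> \<open>The tick of this iteration splits the time span: \<open>a + 1\<close> for the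
    body and \<open>b + 1\<close> for the rest add up to \<open>t'' - t + 1\<close>. The two jumps
    are paid by the summand 2 in the size of the loop.\<close>
  have "Suc 0 + (k + (Suc 0 + l)) \<le> size0 (While0 r c) * (t'' - t + 1)"
    using k(1) l(1) by (simp add: ab algebra_simps)
  then show ?case using r by blast
qed

definition wp0 :: "com0 \<Rightarrow> (nat \<Rightarrow> mem \<Rightarrow> bool) \<Rightarrow> nat \<Rightarrow> mem \<Rightarrow> bool" where
  "wp0 c Q t m \<longleftrightarrow> (\<exists>t' m'. ex0 c t m t' m' \<and> Q t' m')"

lemma wp0_Block: "Q t (fold ins is m) \<Longrightarrow> wp0 (Block is) Q t m"
  unfolding wp0_def by (blast intro: ex0.intros)

lemma wp0_Seq: "wp0 c (wp0 d Q) t m \<Longrightarrow> wp0 (Seq0 c d) Q t m"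
  unfolding wp0_def by (blast intro: ex0.intros)

lemma wp0_If: "(m r \<noteq> 0 \<Longrightarrow> wp0 c Q t m) \<Longrightarrow> (m r = 0 \<Longrightarrow> wp0 d Q t m) \<Longrightarrow> wp0 (If0 r c d) Q t m"
  unfolding wp0_def by (cases "m r = 0") (blast intro: ex0.intros)+

lemma wp0_mono: "wp0 c Q t m \<Longrightarrow> (\<And>t m. Q t m \<Longrightarrow> Q' t m) \<Longrightarrow> wp0 c Q' t m"
  unfolding wp0_def by blast

lemma wp0_While:
  assumes "I t m"
    and "\<And>t m. I t m \<Longrightarrow> m r \<noteq> 0 \<Longrightarrow> wp0 c (\<lambda>t' m'. I (Suc t') m' \<and> f m' < (f m :: nat)) t m"
    and "\<And>t m. I t m \<Longrightarrow> m r = 0 \<Longrightarrow> Q t m"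
  shows "wp0 (While0 r c) Q t m"
  using assms(1)
proof (induction "f m" arbitrary: t m rule: less_induct)
  case less
  show ?case
  proof (cases "m r = 0")
    case True
    then show ?thesis using assms(3) less.prems unfolding wp0_def by (blast intro: ex0.intros)
  next
    case False
    then obtain t' m' where "ex0 c t m t' m'" "I (Suc t') m'" "f m' < f m"
      using assms(2) less.prems unfolding wp0_def by blast
    then show ?thesis using less.hyps False unfolding wp0_def by (blast intro: ex0.intros)
  qed
qed

section \<open>Expressions and interleaved arrays on top of the machine\<close>

datatype expr = N nat | V nat | Plus expr expr | Minus expr expr | Rd nat expr

datatype com = Skip | Assign nat expr | Write nat expr expr | Seq com com
  | If expr com com | While expr com

type_synonym arrs = "nat \<Rightarrow> nat \<Rightarrow> nat"

fun ev :: "expr \<Rightarrow> mem \<Rightarrow> arrs \<Rightarrow> nat" where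
  "ev (N k) v A = k"
| "ev (V r) v A = v r"
| "ev (Plus a b) v A = ev a v A + ev b v A"
| "ev (Minus a b) v A = ev a v A - ev b v A"
| "ev (Rd j e) v A = A j (ev e v A)"

inductive ex :: "com \<Rightarrow> nat \<Rightarrow> mem \<Rightarrow> arrs \<Rightarrow> nat \<Rightarrow> mem \<Rightarrow> arrs \<Rightarrow> bool" where
  Skip: "ex Skip t v A t v A"
| Assign: "ex (Assign r e) t v A t (v(r := ev e v A)) A"
| Write: "ex (Write j a e) t v A t v (A(j := (A j)(ev a v A := ev e v A)))"
| Seq: "ex c t v A t' v' A' \<Longrightarrow> ex d t' v' A' t'' v'' A'' \<Longrightarrow> ex (Seq c d) t v A t'' v'' A''"
| IfT: "ev e v A \<noteq> 0 \<Longrightarrow> ex c t v A t' v' A' \<Longrightarrow> ex (If e c d) t v A t' v' A'"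
| IfF: "ev e v A = 0 \<Longrightarrow> ex d t v A t' v' A' \<Longrightarrow> ex (If e c d) t v A t' v' A'"
| WhileF: "ev e v A = 0 \<Longrightarrow> ex (While e c) t v A t v A"
| WhileT: "ev e v A \<noteq> 0 \<Longrightarrow> ex c t v A t' v' A' \<Longrightarrow> ex (While e c) (Suc t') v' A' t'' v'' A'' \<Longrightarrow>
    ex (While e c) t v A t'' v'' A''"

text \<open>Depth below 10 keeps the evaluation register \<open>21 + d\<close> and the scratch
  register \<open>22 + d\<close> of \<open>addr_code\<close> below 32, where the arrays may
  begin.\<close>

fun oke :: "nat \<Rightarrow> expr \<Rightarrow> bool" where
  "oke d (N k) \<longleftrightarrow> d < 10"
| "oke d (V r) \<longleftrightarrow> r < 21 \<and> d < 10"
| "oke d (Plus a b) \<longleftrightarrow> oke d a \<and> oke (Suc d) b"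
| "oke d (Minus a b) \<longleftrightarrow> oke d a \<and> oke (Suc d) b"
| "oke d (Rd j e) \<longleftrightarrow> j < 16 \<and> oke d e"

text \<open>Turns an index \<open>i\<close> into the address \<open>b + 16 * i + j\<close>; four
  doublings replace the missing multiplication. Interleaving the arrays makes each of them
  unbounded, so no length has to be known when memory is laid out.\<close>

definition addr_code :: "nat \<Rightarrow> nat \<Rightarrow> instr list" where
  "addr_code d j = [Add (21 + d) (21 + d) (21 + d), Add (21 + d) (21 + d) (21 + d),
     Add (21 + d) (21 + d) (21 + d), Add (21 + d) (21 + d) (21 + d), Add (21 + d) (21 + d) 0, Const (22 + d) j, Add (21 + d) (21 + d) (22 + d)]"

text \<open>Register 0 holds the base address; an expression at depth \<open>d\<close> is evaluated into register
  \<open>21 + d\<close>.  In \<open>V r\<close> the constant 0 is loaded first because the machine has no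
  register copy.\<close>

fun tre :: "nat \<Rightarrow> expr \<Rightarrow> instr list" where
  "tre d (N k) = [Const (21 + d) k]"
| "tre d (V r) = [Const (21 + d) 0, Add (21 + d) (21 + d) r]"
| "tre d (Plus a b) = tre d a @ tre (Suc d) b @ [Add (21 + d) (21 + d) (22 + d)]"
| "tre d (Minus a b) = tre d a @ tre (Suc d) b @ [Sub (21 + d) (21 + d) (22 + d)]"
| "tre d (Rd j e) = tre d e @ addr_code d j @ [LoadI (21 + d) (21 + d)]"

fun ok :: "com \<Rightarrow> bool" where
  "ok Skip \<longleftrightarrow> True"
| "ok (Assign r e) \<longleftrightarrow> 0 < r \<and> r < 21 \<and> oke 0 e"
| "ok (Write j a e) \<longleftrightarrow> j < 16 \<and> oke 0 a \<and> oke 1 e"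
| "ok (Seq c d) \<longleftrightarrow> ok c \<and> ok d"
| "ok (If e c d) \<longleftrightarrow> oke 0 e \<and> ok c \<and> ok d"
| "ok (While e c) \<longleftrightarrow> oke 0 e \<and> ok c"

fun tr :: "com \<Rightarrow> com0" where
  "tr Skip = Block []"
| "tr (Assign r e) = Block (tre 0 e @ [Const r 0, Add r r 21])"
| "tr (Write j a e) = Block (tre 0 a @ addr_code 0 j @ tre 1 e @ [StoreI 21 22])"
| "tr (Seq c d) = Seq0 (tr c) (tr d)"
| "tr (If e c d) = Seq0 (Block (tre 0 e)) (If0 21 (tr c) (tr d))"
| "tr (While e c) = Seq0 (Block (tre 0 e)) (While0 21 (Seq0 (tr c) (Block (tre 0 e))))"

text \<open>Registers 21 to 31 are left open as scratch for expressions. Register 0 is also variable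
  0, so the base address is visible as \<open>v 0\<close>, and \<open>ok\<close> forbids assigning
  to it.\<close>

definition rel :: "nat \<Rightarrow> mem \<Rightarrow> arrs \<Rightarrow> mem \<Rightarrow> bool" where
  "rel b v A m \<longleftrightarrow> (\<forall>r<21. m r = v r) \<and> m 0 = b \<and> 32 \<le> b \<and>
     (\<forall>j<16. \<forall>i. m (b + 16 * i + j) = A j i)"

lemma straight_tre: "list_all straight (tre d e)"
  by (induction e arbitrary: d) (auto simp: addr_code_def)

lemma ok0_tr: "ok0 (tr c)"
  by (induction c) (auto simp: straight_tre addr_code_def)

lemma rel_upd: "rel b v A m \<Longrightarrow> 21 \<le> r \<Longrightarrow> r < 32 \<Longrightarrow> rel b v A (m(r := x))"
  unfolding rel_def by auto

lemma fold_addr_code: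
  fixes m :: mem and b d j :: nat
  assumes "m 0 = b" "d < 10"
  defines "m' \<equiv> fold ins (addr_code d j) m"
  shows "m' (21 + d) = b + 16 * m (21 + d) + j" "\<And>r. r < 21 + d \<or> 23 + d \<le> r \<Longrightarrow> m' r = m r"
  using assms(1,2) unfolding m'_def addr_code_def by (auto simp: eval_nat_numeral)

lemma rel_addr_code:
  assumes "rel b v A m" "d < 10"
  shows "rel b v A (fold ins (addr_code d j) m)"
proof -
  have *: "m 0 = b" "32 \<le> b" using assms(1) unfolding rel_def by auto
  show ?thesis
    using assms fold_addr_code[where m=m and b=b and d=d and j=j, OF *(1) assms(2)] * unfolding rel_def by auto
qed

lemma fold_tre:
  assumes "rel b v A m" "oke d e"
  shows "rel b v A (fold ins (tre d e) m) \<and> fold ins (tre d e) m (21 + d) = ev e v A \<and>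
    (\<forall>r<21 + d. fold ins (tre d e) m r = m r) \<and> d < 10"
  using assms
proof (induction e arbitrary: d m)
  case (N k)
  have eq: "fold ins (tre d (N k)) m = m(21 + d := k)" by (rule ext) simp
  have "rel b v A (m(21 + d := k))" using N by (intro rel_upd) auto
  then show ?case using N unfolding eq by (intro conjI) (assumption | simp)+
next
  case (V r)
  have "m r = v r" using V unfolding rel_def by auto
  then have eq: "fold ins (tre d (V r)) m = m(21 + d := v r)" using V by (intro ext) auto
  have "rel b v A (m(21 + d := v r))" using V by (intro rel_upd) auto
  then show ?case using V unfolding eq by (intro conjI) (assumption | simp)+
next
  case (Plus a b')
  let ?m1 = "fold ins (tre d a) m" let ?m2 = "fold ins (tre (Suc d) b') ?m1"
  have 1: "rel b v A ?m1" "?m1 (21 + d) = ev a v A" "\<forall>r<21 + d. ?m1 r = m r" "d < 10"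
    using Plus.IH(1)[of m d] Plus.prems by auto
  have 2: "rel b v A ?m2" "?m2 (21 + Suc d) = ev b' v A" "\<forall>r<21 + Suc d. ?m2 r = ?m1 r"
    using Plus.IH(2)[of ?m1 "Suc d"] Plus.prems 1(1) by auto
  have eq: "fold ins (tre d (Plus a b')) m = ?m2(21 + d := ev a v A + ev b' v A)"
    using 1 2 by (intro ext) simp
  have "rel b v A (?m2(21 + d := ev a v A + ev b' v A))" using 1 2 by (intro rel_upd) auto
  then show ?case using 1 2 unfolding eq by (intro conjI) (assumption | simp)+
next
  case (Minus a b')
  let ?m1 = "fold ins (tre d a) m" let ?m2 = "fold ins (tre (Suc d) b') ?m1"
  have 1: "rel b v A ?m1" "?m1 (21 + d) = ev a v A" "\<forall>r<21 + d. ?m1 r = m r" "d < 10"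
    using Minus.IH(1)[of m d] Minus.prems by auto
  have 2: "rel b v A ?m2" "?m2 (21 + Suc d) = ev b' v A" "\<forall>r<21 + Suc d. ?m2 r = ?m1 r"
    using Minus.IH(2)[of ?m1 "Suc d"] Minus.prems 1(1) by auto
  have eq: "fold ins (tre d (Minus a b')) m = ?m2(21 + d := ev a v A - ev b' v A)"
    using 1 2 by (intro ext) simp
  have "rel b v A (?m2(21 + d := ev a v A - ev b' v A))" using 1 2 by (intro rel_upd) auto
  then show ?case using 1 2 unfolding eq by (intro conjI) (assumption | simp)+
next
  case (Rd j e)
  let ?m1 = "fold ins (tre d e) m" let ?m2 = "fold ins (addr_code d j) ?m1"
  have 1: "rel b v A ?m1" "?m1 (21 + d) = ev e v A" "\<forall>r<21 + d. ?m1 r = m r" "d < 10"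
    using Rd.IH[of m d] Rd.prems by auto
  have "?m1 0 = b" using 1 unfolding rel_def by auto
  note ac = fold_addr_code[where m="?m1" and b=b and d=d and j=j, OF this 1(4)]
  have r: "rel b v A ?m2" using rel_addr_code 1 by blast
  have "?m2 (?m2 (21 + d)) = A j (ev e v A)"
    using ac(1) 1 r Rd.prems unfolding rel_def by auto
  then have eq: "fold ins (tre d (Rd j e)) m = ?m2(21 + d := A j (ev e v A))"
    by (intro ext) simp
  have "rel b v A (?m2(21 + d := A j (ev e v A)))" using 1 r by (intro rel_upd) auto
  then show ?case using 1 ac(2) unfolding eq by (intro conjI) (assumption | simp)+
qed

text \<open>An address determines its array, since \<open>j\<close> is the residue of the offset
  from \<open>b\<close> modulo 16, and hence also the index; and no array cell is a register because
  \<open>b\<close> is at least 32.\<close>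

lemma rel_write:
  assumes "rel b v A m" "j < 16"
  shows "rel b v (A(j := (A j)(i := x))) (m(b + 16 * i + j := x))"
proof -
  have inj: "b + 16 * i' + j' = b + 16 * i + j \<longleftrightarrow> i' = i \<and> j' = j" if "j' < 16" for i' j'
  proof
    assume "b + 16 * i' + j' = b + 16 * i + j"
    then have e: "16 * i' + j' = 16 * i + j" by linarith
    have "j' = (16 * i' + j') mod 16" "j = (16 * i + j) mod 16" using that assms(2) by simp_all
    then have "j' = j" using e by metis
    then show "i' = i \<and> j' = j" using e by simp
  qed simp
  have r: "\<forall>r<21. m r = v r" "m 0 = b" "32 \<le> b" "\<forall>j<16. \<forall>i. m (b + 16 * i + j) = A j i"
    using assms(1) unfolding rel_def by blast+
  have a: "(m(b + 16 * i + j := x)) (b + 16 * i' + j') = (A(j := (A j)(i := x))) j' i'"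
    if "j' < 16" for i' j'
  proof (cases "i' = i \<and> j' = j")
    case True
    then show ?thesis by simp
  next
    case False
    then have "(m(b + 16 * i + j := x)) (b + 16 * i' + j') = m (b + 16 * i' + j')"
      using inj[OF that, of i'] by (simp only: fun_upd_apply if_False)
    moreover have "(A(j := (A j)(i := x))) j' i' = A j' i'" using False by auto
    ultimately show ?thesis using r(4) that by metis
  qed
  have s: "(m(b + 16 * i + j := x)) r = m r" if "r < 21" for r
  proof -
    have "r \<noteq> b + 16 * i + j" using that r(3) by linarith
    then show ?thesis by (simp only: fun_upd_apply if_False)
  qed
  show ?thesis unfolding rel_def
    using a s r by (intro conjI allI impI) (metis zero_less_numeral)+
qed

lemma rel_assign:
  assumes "rel b v A m" "0 < r" "r < 21"
  shows "rel b (v(r := x)) A (m(r := x))"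
proof -
  have r: "\<forall>r<21. m r = v r" "m 0 = b" "32 \<le> b" "\<forall>j<16. \<forall>i. m (b + 16 * i + j) = A j i"
    using assms(1) unfolding rel_def by blast+
  then have "\<And>j i. b + 16 * i + j \<noteq> r" using assms by linarith
  then show ?thesis unfolding rel_def using r assms(2,3) by (intro conjI allI impI) simp_all
qed

inductive_cases ex0_elims: "ex0 (Seq0 c d) t m t' m'" "ex0 (Block is) t m t' m'"

text \<open>Code for expressions is loop free and does not tick, so source and target have the same
  clock and iteration bounds carry over unchanged.\<close>

lemma ex_tr:
  assumes "ex c t v A t' v' A'" "ok c" "rel b v A m"
  shows "\<exists>m'. ex0 (tr c) t m t' m' \<and> rel b v' A' m'"
  using assms
proof (induction arbitrary: m rule: ex.induct)
  case (Skip t v A)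
  then show ?case using Block0[of "[]" t m] by (intro exI[of _ m]) simp
next
  case (Assign r e t v A)
  let ?m = "fold ins (tre 0 e) m"
  have "rel b v A ?m" "?m 21 = ev e v A" using fold_tre[of b v A m 0 e] Assign by auto
  then have "rel b (v(r := ev e v A)) A (fold ins (tre 0 e @ [Const r 0, Add r r 21]) m)"
    using Assign rel_assign[of b v A ?m r] by (auto)
  then show ?case unfolding tr.simps by (blast intro: ex0.Block0)
next
  case (Write j a e t v A)
  let ?m1 = "fold ins (tre 0 a) m" let ?m2 = "fold ins (addr_code 0 j) ?m1"
  let ?m3 = "fold ins (tre 1 e) ?m2"
  have 1: "rel b v A ?m1" "?m1 21 = ev a v A" using fold_tre[of b v A m 0 a] Write by auto
  have "?m1 0 = b" using 1 unfolding rel_def by auto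
  note ac = fold_addr_code[where m="?m1" and b=b and d=0 and j=j, OF this]
  have 2: "rel b v A ?m2" "?m2 21 = b + 16 * ev a v A + j" using rel_addr_code[of b v A ?m1 0 j] 1 ac(1) by auto
  have 3: "rel b v A ?m3" "?m3 22 = ev e v A" "?m3 21 = b + 16 * ev a v A + j"
    using fold_tre[of b v A ?m2 1 e] Write 2 by auto
  have "rel b v (A(j := (A j)(ev a v A := ev e v A)))
     (fold ins (tre 0 a @ addr_code 0 j @ tre 1 e @ [StoreI 21 22]) m)"
    using 3 rel_write[OF 3(1)] Write by simp
  then show ?case unfolding tr.simps by (blast intro: ex0.Block0)
next
  case (Seq c t v A t' v' A' d t'' v'' A'')
  then show ?case by (simp, meson ex0.Seq0)
next
  case (IfT e v A c t t' v' A' d)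
  let ?m = "fold ins (tre 0 e) m"
  have "rel b v A ?m" "?m 21 = ev e v A" using fold_tre[of b v A m 0 e] IfT by auto
  then obtain m' where "ex0 (tr c) t ?m t' m'" "rel b v' A' m'" "?m 21 = ev e v A"
    using IfT by auto
  then show ?case using IfT.hyps by (auto intro!: ex0.Seq0 ex0.Block0 ex0.IfT0 exI[of _ m'])
next
  case (IfF e v A d t t' v' A' c)
  let ?m = "fold ins (tre 0 e) m"
  have "rel b v A ?m" "?m 21 = ev e v A" using fold_tre[of b v A m 0 e] IfF by auto
  then obtain m' where "ex0 (tr d) t ?m t' m'" "rel b v' A' m'" "?m 21 = ev e v A"
    using IfF by auto
  then show ?case using IfF.hyps by (auto intro!: ex0.Seq0 ex0.Block0 ex0.IfF0 exI[of _ m'])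
next
  case (WhileF e v A c t)
  let ?m = "fold ins (tre 0 e) m"
  have "rel b v A ?m" "?m 21 = 0" using fold_tre[of b v A m 0 e] WhileF by auto
  then show ?case unfolding tr.simps by (blast intro: ex0.Seq0 ex0.Block0 ex0.WhileF0)
next
  case (WhileT e v A c t t' v' A' t'' v'' A'')
  let ?m = "fold ins (tre 0 e) m"
  have 1: "rel b v A ?m" "?m 21 \<noteq> 0"
    using fold_tre[of b v A m 0 e] WhileT.hyps(1) WhileT.prems by auto
  have "ok c" using WhileT.prems by simp
  then obtain m1 where m1: "ex0 (tr c) t ?m t' m1" "rel b v' A' m1"
    using WhileT.IH(1) 1(1) by blast
  obtain m2 where m2: "ex0 (tr (While e c)) (Suc t') m1 t'' m2" "rel b v'' A'' m2"
    using WhileT.IH(2) WhileT.prems m1 by blast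
  let ?m1 = "fold ins (tre 0 e) m1" let ?W = "While0 21 (Seq0 (tr c) (Block (tre 0 e)))"
  \<comment> \<open>The translated loop begins by evaluating its condition. Cutting this block off
    the remaining run lets it serve as the re-evaluation at the end of the current
    iteration.\<close>
  have w: "ex0 ?W (Suc t') ?m1 t'' m2"
    using m2(1) unfolding tr.simps by (metis ex0_elims)
  have s: "ex0 (Seq0 (tr c) (Block (tre 0 e))) t ?m t' ?m1"
    using m1(1) ex0.Block0 by (rule ex0.Seq0)
  have "ex0 ?W t ?m t'' m2" by (rule ex0.WhileT0[OF 1(2) s w])
  then have "ex0 (tr (While e c)) t m t'' m2"
    unfolding tr.simps by (rule ex0.Seq0[OF ex0.Block0])
  then show ?case using m2(2) by blast
qed

section \<open>Weakest preconditions with a clock\<close>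

definition wp :: "com \<Rightarrow> (nat \<Rightarrow> mem \<Rightarrow> arrs \<Rightarrow> bool) \<Rightarrow> nat \<Rightarrow> mem \<Rightarrow> arrs \<Rightarrow> bool" where
  "wp c Q t v A \<longleftrightarrow> (\<exists>t' v' A'. ex c t v A t' v' A' \<and> Q t' v' A')"

inductive_cases ex_elims: "ex Skip t v A t' v' A'" "ex (Assign r e) t v A t' v' A'"
  "ex (Write j a e) t v A t' v' A'" "ex (Seq c d) t v A t' v' A'" "ex (If e c d) t v A t' v' A'"

lemma wp_Skip [simp]: "wp Skip Q t v A \<longleftrightarrow> Q t v A"
  unfolding wp_def by (auto intro: ex.intros elim: ex_elims)

lemma wp_Assign [simp]: "wp (Assign r e) Q t v A \<longleftrightarrow> Q t (v(r := ev e v A)) A"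
  unfolding wp_def by (auto intro: ex.intros elim: ex_elims)

lemma wp_Write [simp]:
  "wp (Write j a e) Q t v A \<longleftrightarrow> Q t v (A(j := (A j)(ev a v A := ev e v A)))"
  unfolding wp_def by (auto intro: ex.intros elim: ex_elims)

lemma wp_Seq [simp]: "wp (Seq c d) Q t v A \<longleftrightarrow> wp c (wp d Q) t v A"
  unfolding wp_def by (blast intro: ex.Seq elim: ex_elims(4))

lemma wp_If [simp]: "wp (If e c d) Q t v A \<longleftrightarrow>
    (ev e v A \<noteq> 0 \<longrightarrow> wp c Q t v A) \<and> (ev e v A = 0 \<longrightarrow> wp d Q t v A)"
  unfolding wp_def by (cases "ev e v A = 0") (auto intro: ex.IfT ex.IfF elim!: ex_elims(5))

lemma ex_mono: "ex c t v A t' v' A' \<Longrightarrow> t \<le> t'"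
  by (induction rule: ex.induct) auto

text \<open>A bound on the clock also proves termination.\<close>

lemma wp_While:
  assumes "I t v A"
    and "\<And>t v A. I t v A \<Longrightarrow> t \<le> (T :: nat)"
    and "\<And>t v A. I t v A \<Longrightarrow> ev e v A \<noteq> 0 \<Longrightarrow> wp c (\<lambda>t' v' A'. I (Suc t') v' A') t v A"
    and "\<And>t v A. I t v A \<Longrightarrow> ev e v A = 0 \<Longrightarrow> Q t v A"
  shows "wp (While e c) Q t v A"
  using assms(1)
proof (induction "T - t" arbitrary: t v A rule: less_induct)
  case less
  show ?case
  proof (cases "ev e v A = 0")
    case True
    then show ?thesis using assms(4) less.prems unfolding wp_def by (blast intro: ex.intros)
  next
    case False
    then obtain t' v' A' where x: "ex c t v A t' v' A'" "I (Suc t') v' A'"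
      using assms(3) less.prems unfolding wp_def by blast
    have "T - Suc t' < T - t" using ex_mono[OF x(1)] assms(2)[OF x(2)] by linarith
    then show ?thesis using less.hyps x False unfolding wp_def by (blast intro: ex.intros)
  qed
qed

definition For :: "nat \<Rightarrow> expr \<Rightarrow> com \<Rightarrow> com" where
  "For r e c = While (Minus e (V r)) (Seq c (Assign r (Plus (V r) (N 1))))"

text \<open>The premise \<open>lim\<close> makes the invariant fix the value \<open>hi\<close> of
  the upper bound, so \<open>hi - v r\<close> decreases and termination needs no bound on the
  clock.\<close>

lemma wp_For:
  assumes "I (v r) t v A" "v r \<le> hi"
    and lim: "\<And>i t v A. I i t v A \<Longrightarrow> v r = i \<and> ev e v A = hi"
    and "\<And>i t v A. I i t v A \<Longrightarrow> i < hi \<Longrightarrow>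
       wp c (\<lambda>t' v' A'. I (Suc i) (Suc t') (v'(r := Suc (v' r))) A') t v A"
    and "\<And>t v A. I hi t v A \<Longrightarrow> Q t v A"
  shows "wp (For r e c) Q t v A"
  using assms(1,2)
proof (induction "hi - v r" arbitrary: t v A rule: less_induct)
  case less
  have e: "ev e v A = hi" using lim less.prems by blast
  show ?case
  proof (cases "v r < hi")
    case False
    then have "ex (For r e c) t v A t v A"
      using e unfolding For_def by (intro ex.WhileF) simp
    moreover have "v r = hi" using False less.prems(2) by simp
    ultimately show ?thesis using assms(5)[of t v A] less.prems(1) unfolding wp_def by auto
  next
    case True
    then obtain t' v' A' where x: "ex c t v A t' v' A'" "I (Suc (v r)) (Suc t') (v'(r := Suc (v' r))) A'"
      using assms(4)[OF less.prems(1)] unfolding wp_def by blast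
    let ?v = "v'(r := Suc (v' r))"
    have r: "?v r = Suc (v r)" using lim[OF x(2)] by simp
    have "wp (For r e c) Q (Suc t') ?v A'"
      using less.hyps[of ?v] x(2) r True by auto
    moreover have "ex (Seq c (Assign r (Plus (V r) (N 1)))) t v A t' ?v A'"
      using x(1) ex.Assign[of r "Plus (V r) (N 1)" t' v' A'] by (auto intro: ex.Seq)
    moreover have "ev (Minus e (V r)) v A \<noteq> 0" using e True by simp
    ultimately show ?thesis unfolding wp_def For_def by (blast intro: ex.WhileT)
  qed
qed

section \<open>Critical rules of the antimatroid of a rule set\<close>

text \<open>No rule with head \<open>x\<close> blocks the step from \<open>Y\<close> to
  \<open>insert x Y\<close>. The disjunct \<open>x \<in> D\<close> is there because a rule whose
  body contains its head is accepted by every set.\<close>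

definition enabled :: "'a rule set \<Rightarrow> 'a set \<Rightarrow> 'a \<Rightarrow> bool" where
  "enabled R Y x \<longleftrightarrow> (\<forall>D. (D, x) \<in> R \<longrightarrow> x \<in> D \<or> D \<inter> Y \<noteq> {})"

lemma enabled_mono: "enabled R Y x \<Longrightarrow> Y \<subseteq> Z \<Longrightarrow> enabled R Z x"
  unfolding enabled_def by blast

lemma AR_empty: "{} \<in> AR Q R"
proof -
  have "{} \<in> KR Q R" by (auto simp: KR_def accepts_def)
  then show ?thesis unfolding AR_def tight_path_def by (auto intro!: exI[of _ "[{}]"])
qed

lemma AR_subset: "X \<in> AR Q R \<Longrightarrow> X \<subseteq> Q"
  by (auto simp: AR_def KR_def)

lemma KR_insert_enabled:
  assumes "insert x Y \<in> KR Q R"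
  shows "enabled R Y x"
  using assms unfolding KR_def accepts_def enabled_def by fastforce

lemma AR_insert:
  assumes "Y \<in> AR Q R" "x \<in> Q" "enabled R Y x"
  shows "insert x Y \<in> AR Q R"
proof (cases "x \<in> Y")
  case True
  then show ?thesis using assms by (simp add: insert_absorb)
next
  case False
  have Y: "Y \<in> KR Q R" using assms by (auto simp: AR_def)
  have K: "insert x Y \<in> KR Q R"
    using Y assms(2,3) unfolding KR_def accepts_def enabled_def by fastforce
  obtain Ys where Ys: "Ys \<noteq> []" "hd Ys = {}" "last Ys = Y" "set Ys \<subseteq> KR Q R"
    "\<forall>i. Suc i < length Ys \<longrightarrow> Ys ! i \<subseteq> Ys ! Suc i \<and> card (Ys ! Suc i - Ys ! i) = 1"
    using assms(1) unfolding AR_def tight_path_def by auto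
  let ?Z = "Ys @ [insert x Y]"
  have "?Z ! i \<subseteq> ?Z ! Suc i \<and> card (?Z ! Suc i - ?Z ! i) = 1" if i: "Suc i < length ?Z" for i
  proof (cases "Suc i < length Ys")
    case True
    then show ?thesis using Ys(5) by (auto simp: nth_append)
  next
    case F: False
    then have "Suc i = length Ys" using i by simp
    then have "?Z ! i = Y" "?Z ! Suc i = insert x Y"
      using Ys(1,3) by (auto simp: nth_append last_conv_nth simp flip: \<open>Suc i = length Ys\<close>)
    moreover have "insert x Y - Y = {x}" using False by auto
    ultimately show ?thesis by auto
  qed
  then have "tight_path (KR Q R) (insert x Y)"
    unfolding tight_path_def using Ys K by (intro exI[of _ ?Z]) auto
  then show ?thesis using K by (simp add: AR_def)
qed

text \<open>Every prefix of a tight path is a tight path to its own last member, so feasible sets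
  are generated from the empty set by enabled insertions. This replaces paths in all later
  arguments.\<close>

lemma AR_induct [consumes 1, case_names empty insert]:
  assumes "X \<in> AR Q R" "P {}"
    and "\<And>x Y. Y \<in> AR Q R \<Longrightarrow> P Y \<Longrightarrow> x \<in> Q \<Longrightarrow> x \<notin> Y \<Longrightarrow> enabled R Y x \<Longrightarrow> P (insert x Y)"
  shows "P X"
proof -
  obtain Ys where Ys: "Ys \<noteq> []" "hd Ys = {}" "last Ys = X" "set Ys \<subseteq> KR Q R"
    "\<forall>i. Suc i < length Ys \<longrightarrow> Ys ! i \<subseteq> Ys ! Suc i \<and> card (Ys ! Suc i - Ys ! i) = 1"
    using assms(1) unfolding AR_def tight_path_def by auto
  have "i < length Ys \<Longrightarrow> Ys ! i \<in> AR Q R \<and> P (Ys ! i)" for i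
  proof (induction i)
    case 0
    then show ?case using Ys(1,2) assms(2) AR_empty by (metis hd_conv_nth)
  next
    case (Suc i)
    have "Ys ! i \<subseteq> Ys ! Suc i" "card (Ys ! Suc i - Ys ! i) = 1" using Ys(5) Suc.prems by blast+
    then obtain x where x: "Ys ! Suc i - Ys ! i = {x}" by (auto simp: card_1_singleton_iff)
    then have i: "Ys ! Suc i = insert x (Ys ! i)" "x \<notin> Ys ! i" using \<open>Ys ! i \<subseteq> Ys ! Suc i\<close> by auto
    have "insert x (Ys ! i) \<in> KR Q R" using Ys(4) Suc.prems i(1) by (metis nth_mem subsetD)
    then have "enabled R (Ys ! i) x" by (rule KR_insert_enabled)
    moreover have "x \<in> Q" using \<open>insert x (Ys ! i) \<in> KR Q R\<close> by (auto simp: KR_def)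
    ultimately show ?case using Suc i assms(3) by (simp add: AR_insert)
  qed
  moreover have "X = Ys ! (length Ys - 1)" "length Ys - 1 < length Ys"
    using Ys(1,3) by (auto simp: last_conv_nth)
  ultimately show ?thesis by metis
qed

section \<open>The largest feasible set avoiding a given set\<close>

definition maxf :: "'a set \<Rightarrow> 'a rule set \<Rightarrow> 'a set \<Rightarrow> 'a set" where
  "maxf Q R F = \<Union>{X \<in> AR Q R. X \<inter> F = {}}"

text \<open>The path to \<open>X\<close> can be replayed on top of \<open>Y\<close>, because
  enabledness is monotone.\<close>

lemma AR_Un: "X \<in> AR Q R \<Longrightarrow> Y \<in> AR Q R \<Longrightarrow> X \<union> Y \<in> AR Q R"
proof (induction rule: AR_induct)
  case (insert x Z)
  then show ?case using AR_insert[of "Z \<union> Y" Q R x] enabled_mono[of R Z x "Z \<union> Y"] by auto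
qed simp

lemma maxf_AR:
  assumes "finite Q"
  shows "maxf Q R F \<in> AR Q R"
proof -
  have u: "\<Union>\<X> \<in> AR Q R" if "finite \<X>" "\<X> \<subseteq> AR Q R" for \<X>
    using that by (induction rule: finite_induct) (simp_all add: AR_empty AR_Un)
  have "finite {X \<in> AR Q R. X \<inter> F = {}}"
    by (rule finite_subset[of _ "Pow Q"]) (use assms in \<open>auto dest: AR_subset\<close>)
  then show ?thesis unfolding maxf_def by (intro u) auto
qed

lemma maxf_disj: "maxf Q R F \<inter> F = {}"
  unfolding maxf_def by auto

lemma maxf_upper: "X \<in> AR Q R \<Longrightarrow> X \<inter> F = {} \<Longrightarrow> X \<subseteq> maxf Q R F"
  unfolding maxf_def by auto

lemma maxf_enabled:
  assumes "finite Q" "x \<in> Q" "x \<notin> F" "enabled R (maxf Q R F) x"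
  shows "x \<in> maxf Q R F"
proof -
  have "insert x (maxf Q R F) \<in> AR Q R" using assms by (intro AR_insert maxf_AR)
  moreover have "insert x (maxf Q R F) \<inter> F = {}" using assms(3) maxf_disj[of Q R F] by auto
  ultimately show ?thesis using maxf_upper[of "insert x (maxf Q R F)" Q R F] by auto
qed

text \<open>A path to a feasible set avoiding \<open>F\<close> cannot leave \<open>X\<close>: the
  element by which it leaves would be enabled at \<open>X\<close> by monotonicity, and so lie in
  \<open>X\<close>.\<close>

lemma maxf_unique:
  assumes "X \<in> AR Q R" "X \<inter> F = {}" "\<And>x. x \<in> Q \<Longrightarrow> x \<notin> F \<Longrightarrow> enabled R X x \<Longrightarrow> x \<in> X"
  shows "maxf Q R F = X"
proof -
  have "Z \<subseteq> X" if "Z \<in> AR Q R" "Z \<inter> F = {}" for Z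
    using that
  proof (induction rule: AR_induct)
    case (insert x Y)
    then have "enabled R X x" by (intro enabled_mono[of R Y x X]) auto
    then show ?case using insert assms(3)[of x] by auto
  qed simp
  then show ?thesis using assms(1,2) unfolding maxf_def by blast
qed

lemma dual_fam_iff:
  assumes "Y \<subseteq> Q"
  shows "Y \<in> dual_fam Q (AR Q R) \<longleftrightarrow> Q - Y \<in> AR Q R"
proof
  assume "Y \<in> dual_fam Q (AR Q R)"
  then obtain X where "X \<in> AR Q R" "Y = Q - X" unfolding dual_fam_def by auto
  then show "Q - Y \<in> AR Q R" using AR_subset by (metis double_diff order_refl)
next
  assume "Q - Y \<in> AR Q R"
  moreover have "Y = Q - (Q - Y)" using assms by auto
  ultimately show "Y \<in> dual_fam Q (AR Q R)" unfolding dual_fam_def by (metis image_eqI)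
qed

text \<open>Complementation exchanges the intersection of the closed supersets of \<open>C\<close>
  with the union of the feasible sets avoiding \<open>C\<close>.\<close>

lemma tau_AR:
  assumes "finite Q" "C \<subseteq> Q"
  shows "tau Q (AR Q R) C = Q - maxf Q R C"
proof -
  have "{Y \<in> dual_fam Q (AR Q R). C \<subseteq> Y} = (\<lambda>X. Q - X) ` {X \<in> AR Q R. X \<inter> C = {}}"
    unfolding dual_fam_def using assms(2) by auto
  \<comment> \<open>An intersection over an empty family would be the whole type.\<close>
  moreover have "{X \<in> AR Q R. X \<inter> C = {}} \<noteq> {}" using AR_empty by auto
  ultimately show ?thesis unfolding tau_def maxf_def by auto
qed

text \<open>Deleting elements from the closure is inserting them into its complement
  \<open>X\<close>, so criticality becomes a statement about one or two insertions into
  \<open>X\<close>.\<close>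

lemma critical_AR:
  fixes R :: "'a rule set"
  assumes "finite Q" "rule_on Q (A, q)"
  defines "X \<equiv> maxf Q R (insert q A)"
  shows "critical Q (AR Q R) (A, q) \<longleftrightarrow>
    q \<notin> A \<and> insert q X \<notin> AR Q R \<and> (\<forall>s\<in>A. insert q (insert s X) \<in> AR Q R)"
proof -
  have A: "A \<subseteq> Q" "q \<in> Q" using assms(2) by (auto simp: rule_on_def)
  have X: "X \<subseteq> Q" unfolding X_def using maxf_AR[OF assms(1)] by (rule AR_subset)
  have t: "tau Q (AR Q R) (insert q A) = Q - X"
    unfolding X_def using A by (intro tau_AR assms(1)) simp
  have c: "Q - X - S \<in> dual_fam Q (AR Q R) \<longleftrightarrow> S \<union> X \<in> AR Q R" if "S \<subseteq> Q" for S
  proof -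
    have "Q - (Q - X - S) = S \<union> X" using that X by blast
    moreover have "Q - X - S \<subseteq> Q" by blast
    ultimately show ?thesis using dual_fam_iff[of "Q - X - S" Q R] by simp
  qed
  have "Q - X - {q} \<in> dual_fam Q (AR Q R) \<longleftrightarrow> insert q X \<in> AR Q R"
    using c[of "{q}"] A by simp
  moreover have "Q - X - {q, s} \<in> dual_fam Q (AR Q R) \<longleftrightarrow> insert q (insert s X) \<in> AR Q R"
    if "s \<in> A" for s
    using c[of "{q, s}"] A that by (simp add: subset_iff)
  ultimately show ?thesis unfolding critical_def by (simp only: Let_def fst_conv snd_conv t) blast
qed

lemma AR_insert_iff:
  assumes "Y \<in> AR Q R" "x \<in> Q"
  shows "insert x Y \<in> AR Q R \<longleftrightarrow> x \<in> Y \<or> enabled R Y x"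
proof
  assume "insert x Y \<in> AR Q R"
  then have "insert x Y \<in> KR Q R" by (simp add: AR_def)
  then have "enabled R Y x" by (rule KR_insert_enabled)
  then show "x \<in> Y \<or> enabled R Y x" ..
next
  assume "x \<in> Y \<or> enabled R Y x"
  then show "insert x Y \<in> AR Q R" using assms by (auto simp: insert_absorb intro: AR_insert)
qed

text \<open>A critical rule \<open>(A, q)\<close> is determined by any input rule \<open>(B, q)\<close> that is violated by
  adding \<open>q\<close> to the largest feasible set \<open>X\<close> avoiding \<open>A \<union> {q}\<close>: then \<open>A \<subseteq> B\<close>, the set \<open>X\<close> is
  also the largest one avoiding \<open>B \<union> {q}\<close>, and \<open>A\<close> consists of the elements of \<open>B\<close> that can be
  added to \<open>X\<close>.\<close>

definition reduct :: "'a set \<Rightarrow> 'a rule set \<Rightarrow> 'a rule \<Rightarrow> 'a rule" where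
  "reduct Q R r = ({s \<in> fst r. enabled R (maxf Q R (insert (snd r) (fst r))) s}, snd r)"

text \<open>That each \<open>s\<close> can be added is built into \<open>reduct\<close>, and the
  input rule itself blocks its head at the largest set avoiding it. What remains of criticality is
  that the head can be added after any such \<open>s\<close>.\<close>

definition good :: "'a set \<Rightarrow> 'a rule set \<Rightarrow> 'a rule \<Rightarrow> bool" where
  "good Q R r \<longleftrightarrow> snd r \<notin> fst r \<and> (\<forall>s \<in> fst (reduct Q R r).
      enabled R (insert s (maxf Q R (insert (snd r) (fst r)))) (snd r))"

lemma critical_rules_AR:
  assumes "finite Q" "\<forall>r\<in>R. rule_on Q r"
  shows "critical_rules Q (AR Q R) = reduct Q R ` {r \<in> R. good Q R r}"
proof (intro equalityI subsetI)
  fix r assume "r \<in> critical_rules Q (AR Q R)"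
  then obtain A q where r: "r = (A, q)" "rule_on Q (A, q)" "critical Q (AR Q R) (A, q)"
    unfolding critical_rules_def by (cases r) auto
  define X where "X = maxf Q R (insert q A)"
  have c: "q \<notin> A" "insert q X \<notin> AR Q R" "\<And>s. s \<in> A \<Longrightarrow> insert q (insert s X) \<in> AR Q R"
    using critical_AR[OF assms(1) r(2), of R] r(3) unfolding X_def by blast+
  have A: "A \<subseteq> Q" "q \<in> Q" using r(2) by (auto simp: rule_on_def)
  have X: "X \<in> AR Q R" "q \<notin> X" "A \<inter> X = {}"
    using maxf_AR[OF assms(1), of R "insert q A"] maxf_disj[of Q R "insert q A"]
    unfolding X_def by auto
  have "\<not> enabled R X q" using AR_insert_iff[OF X(1) A(2)] c(2) by simp
  then obtain B where B: "(B, q) \<in> R" "q \<notin> B" "B \<inter> X = {}" unfolding enabled_def by auto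
  have BQ: "B \<subseteq> Q" using assms(2) B(1) by (fastforce simp: rule_on_def)
  \<comment> \<open>If \<open>s\<close> were outside \<open>B\<close>, the rule
    \<open>(B, q)\<close> would still block \<open>q\<close> after adding \<open>s\<close>.\<close>
  have AB: "A \<subseteq> B"
  proof
    fix s assume "s \<in> A"
    then have "insert q (insert s X) \<in> KR Q R" using c(3) by (auto simp: AR_def)
    then have "enabled R (insert s X) q" by (rule KR_insert_enabled)
    then show "s \<in> B" using B unfolding enabled_def by blast
  qed
  have XB: "maxf Q R (insert q B) = X"
  proof (rule maxf_unique)
    show "x \<in> X" if "x \<in> Q" "x \<notin> insert q B" "enabled R X x" for x
      using maxf_enabled[OF assms(1), of x "insert q A" R] that AB X_def by auto
  qed (use X B in auto)
  have en: "enabled R X s \<and> enabled R (insert s X) q" if s: "s \<in> A" for s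
  proof -
    have K: "insert q (insert s X) \<in> KR Q R" using c(3) s by (auto simp: AR_def)
    have "insert s (insert q X) \<in> KR Q R" using K by (simp add: insert_commute)
    then have 1: "enabled R (insert q X) s" by (rule KR_insert_enabled)
    have 2: "enabled R (insert s X) q" using K by (rule KR_insert_enabled)
    \<comment> \<open>The set \<open>X\<close> together with \<open>q\<close> and \<open>s\<close>
      is feasible, and a path to it can leave \<open>X\<close> only through \<open>q\<close> or
      \<open>s\<close>. If both were blocked at \<open>X\<close>, every feasible subset of it would
      stay inside \<open>X\<close>.\<close>
    have "enabled R X s"
    proof (rule ccontr)
      assume ns: "\<not> enabled R X s"
      have "insert q (insert s X) \<in> AR Q R" using c(3) s .
      moreover have "Z \<in> AR Q R \<Longrightarrow> Z \<subseteq> insert q (insert s X) \<Longrightarrow> Z \<subseteq> X" for Z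
      proof (induction rule: AR_induct)
        case (insert x Y)
        then have "enabled R X x" by (meson enabled_mono subset_insertI subset_trans insert_subset)
        then show ?case using insert ns \<open>\<not> enabled R X q\<close> by auto
      qed simp
      ultimately show False using X(2) by blast
    qed
    then show ?thesis using 2 by blast
  qed
  have "{s \<in> B. enabled R X s} = A"
  proof (intro equalityI subsetI)
    fix s assume "s \<in> {s \<in> B. enabled R X s}"
    then show "s \<in> A"
      using maxf_enabled[OF assms(1), of s "insert q A" R] B BQ unfolding X_def[symmetric] by auto
  qed (use AB en in auto)
  then have "reduct Q R (B, q) = (A, q)" unfolding reduct_def XB by (simp add: XB)
  moreover from this have "good Q R (B, q)" unfolding good_def using en B(2) by (simp add: XB)
  ultimately show "r \<in> reduct Q R ` {r \<in> R. good Q R r}" using r(1) B(1) by (metis (mono_tags) imageI mem_Collect_eq)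
next
  fix r assume "r \<in> reduct Q R ` {r \<in> R. good Q R r}"
  then obtain B q where r: "(B, q) \<in> R" "r = reduct Q R (B, q)" "good Q R (B, q)" by auto
  define X where "X = maxf Q R (insert q B)"
  define A where "A = {s \<in> B. enabled R X s}"
  have rA: "r = (A, q)" using r(2) unfolding reduct_def A_def X_def by simp
  have g: "q \<notin> B" "\<And>s. s \<in> A \<Longrightarrow> enabled R (insert s X) q"
    using r(3) rA unfolding good_def X_def r(2)[symmetric] by auto
  have BQ: "B \<subseteq> Q" "q \<in> Q" using assms(2) r(1) by (fastforce simp: rule_on_def)+
  have AB: "A \<subseteq> B" unfolding A_def by auto
  have X: "X \<in> AR Q R" "q \<notin> X" "B \<inter> X = {}"
    using maxf_AR[OF assms(1), of R "insert q B"] maxf_disj[of Q R "insert q B"]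
    unfolding X_def by auto
  \<comment> \<open>Elements of \<open>B\<close> outside \<open>A\<close> are not enabled at
    \<open>X\<close>, so no longer forbidding them lets nothing in.\<close>
  have XA: "maxf Q R (insert q A) = X"
  proof (rule maxf_unique)
    show "x \<in> X" if "x \<in> Q" "x \<notin> insert q A" "enabled R X x" for x
      using maxf_enabled[OF assms(1), of x "insert q B" R] that A_def X_def by auto
  qed (use X AB in auto)
  have "\<not> enabled R X q" using r(1) g(1) X(3) unfolding enabled_def by blast
  then have "insert q X \<notin> AR Q R" using AR_insert_iff[OF X(1) BQ(2)] X(2) by simp
  moreover have "insert q (insert s X) \<in> AR Q R" if "s \<in> A" for s
  proof -
    have "s \<in> Q" "enabled R X s" using that BQ AB by (auto simp: A_def)
    then have "insert s X \<in> AR Q R" using X(1) by (intro AR_insert)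
    then show ?thesis using BQ(2) g(2)[OF that] by (rule AR_insert)
  qed
  moreover have "rule_on Q (A, q)" using AB BQ by (auto simp: rule_on_def)
  ultimately show "r \<in> critical_rules Q (AR Q R)"
    using critical_AR[OF assms(1), of A q R] g(1) AB unfolding critical_rules_def rA XA by auto
qed

section \<open>One round: testing an input rule\<close>

definition same :: "nat set \<Rightarrow> nat set \<Rightarrow> mem \<Rightarrow> arrs \<Rightarrow> mem \<Rightarrow> arrs \<Rightarrow> bool" where
  "same rs js v A v' A' \<longleftrightarrow> (\<forall>r. r \<notin> rs \<longrightarrow> v' r = v r) \<and> (\<forall>j. j \<notin> js \<longrightarrow> A' j = A j)"

lemma same_refl [simp]: "same rs js v A v A"
  by (simp add: same_def)

lemma same_upd_reg [simp]: "r \<in> rs \<Longrightarrow> same rs js v A v' A' \<Longrightarrow> same rs js v A (v'(r := x)) A'"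
  by (auto simp: same_def)

lemma same_upd_arr [simp]: "j \<in> js \<Longrightarrow> same rs js v A v' A' \<Longrightarrow> same rs js v A v' (A'(j := f))"
  by (auto simp: same_def)

lemma same_trans:
  "same rs js v A v' A' \<Longrightarrow> same rs' js' v' A' v'' A'' \<Longrightarrow> rs \<subseteq> rs'' \<Longrightarrow> rs' \<subseteq> rs'' \<Longrightarrow>
   js \<subseteq> js'' \<Longrightarrow> js' \<subseteq> js'' \<Longrightarrow> same rs'' js'' v A v'' A''"
  unfolding same_def by (metis subsetD)

text \<open>Subtraction truncates at 0, so this is the distance of the two values.\<close>

definition neq :: "expr \<Rightarrow> expr \<Rightarrow> expr" where
  "neq a b = Plus (Minus a b) (Minus b a)"

lemma ev_neq [simp]: "ev (neq a b) v A = 0 \<longleftrightarrow> ev a v A = ev b v A"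
  by (auto simp: neq_def)

text \<open>Registers: 1 number of rules, 2 number of element occurrences plus one, 3 current rule, 4 next
  output cell, 5 number of output rules, 9 stack size, 10 result of the test; the others are
  temporary.  Arrays: 0 output, 1 input, 2 heads, 3 first occurrence of a rule, 4 element of an
  occurrence, 5 rule of an occurrence, 6 previous occurrence of the same element, 7 last occurrence of
  an element, 8 whether the head of a rule lies in its body, 9 number of violated rules with a given
  head, 10 whether a rule is satisfied, 11 elements that are forbidden or were pushed on the stack,
  12 stack, 13 number of elements of a rule that can be added.\<close>

definition reset_elems :: com where
  "reset_elems = Seq (Assign 6 (N 1)) (For 6 (V 2)
     (Seq (Write 11 (Rd 4 (V 6)) (N 0)) (Write 9 (Rd 4 (V 6)) (N 0))))"

definition reset_rules :: com where
  "reset_rules = Seq (Assign 7 (N 0)) (For 7 (V 1)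
     (Seq (Write 11 (Rd 2 (V 7)) (N 0)) (Seq (Write 9 (Rd 2 (V 7)) (N 0))
       (Seq (Write 10 (V 7) (Rd 8 (V 7))) (Write 13 (V 7) (N 0))))))"

definition count_rules :: com where
  "count_rules = Seq (Assign 7 (N 0)) (For 7 (V 1)
     (If (Rd 8 (V 7)) Skip (Write 9 (Rd 2 (V 7)) (Plus (Rd 9 (Rd 2 (V 7))) (N 1)))))"

definition forbid :: com where
  "forbid = Seq (Assign 6 (Rd 3 (V 3))) (Seq (For 6 (Rd 3 (Plus (V 3) (N 1)))
     (Write 11 (Rd 4 (V 6)) (N 1))) (Write 11 (Rd 2 (V 3)) (N 1)))"

definition push :: "nat \<Rightarrow> com" where
  "push r = If (Plus (Rd 9 (V r)) (Rd 11 (V r))) Skip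
     (Seq (Write 11 (V r) (N 1)) (Seq (Write 12 (V 9) (V r)) (Assign 9 (Plus (V 9) (N 1)))))"

text \<open>Only elements of bodies are seeded, since adding any other element satisfies no rule. A
  head outside all bodies may still be pushed by \<open>visit\<close>; its list of occurrences is
  empty.\<close>

definition fill_stack :: com where
  "fill_stack = Seq (Assign 9 (N 0)) (Seq (Assign 6 (N 1)) (For 6 (V 2)
     (Seq (Assign 12 (Rd 4 (V 6))) (push 12))))"

definition visit :: com where
  "visit = While (V 11) (Seq
     (If (Rd 10 (Rd 5 (V 11))) Skip
       (Seq (Write 10 (Rd 5 (V 11)) (N 1)) (Seq (Assign 12 (Rd 2 (Rd 5 (V 11))))
         (Seq (Write 9 (V 12) (Minus (Rd 9 (V 12)) (N 1))) (push 12)))))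
     (Assign 11 (Rd 6 (V 11))))"

definition propagate :: com where
  "propagate = While (V 9) (Seq (Assign 9 (Minus (V 9) (N 1)))
     (Seq (Assign 8 (Rd 12 (V 9))) (Seq (Assign 11 (Rd 7 (V 8))) visit)))"

definition count_enabled :: com where
  "count_enabled = Seq (Assign 6 (N 1)) (For 6 (V 2)
     (If (Rd 9 (Rd 4 (V 6))) Skip
       (Write 13 (Rd 5 (V 6)) (Plus (Rd 13 (Rd 5 (V 6))) (N 1)))))"

text \<open>The start value rejects an input rule whose head lies in its own body: since the body is
  forbidden, these are the only input rules already satisfied when they are tested. The loop
  compares only violated rules with the same head.\<close>

definition test_good :: com where
  "test_good = Seq (Assign 10 (Minus (N 1) (Rd 10 (V 3)))) (Seq (Assign 7 (N 0)) (For 7 (V 1)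
     (If (Plus (Rd 10 (V 7)) (neq (Rd 2 (V 7)) (Rd 2 (V 3)))) Skip
       (If (neq (Rd 13 (V 7)) (Rd 13 (V 3))) (Assign 10 (N 0)) Skip))))"

definition emit :: com where
  "emit = If (V 10)
     (Seq (Assign 5 (Plus (V 5) (N 1))) (Seq (Write 0 (V 4) (Rd 2 (V 3)))
     (Seq (Write 0 (Plus (V 4) (N 1)) (Rd 13 (V 3))) (Seq (Assign 4 (Plus (V 4) (N 2)))
     (Seq (Assign 6 (Rd 3 (V 3))) (For 6 (Rd 3 (Plus (V 3) (N 1)))
        (If (Rd 9 (Rd 4 (V 6))) Skip
          (Seq (Write 0 (V 4) (Rd 4 (V 6))) (Assign 4 (Plus (V 4) (N 1))))))))))) Skip"

definition round :: com where
  "round = Seq reset_elems (Seq reset_rules (Seq count_rules (Seq forbid (Seq fill_stack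
     (Seq propagate (Seq count_enabled (Seq test_good emit)))))))"

definition enc_out :: "(nat list \<times> nat) list \<Rightarrow> nat list" where
  "enc_out ys = concat (map (\<lambda>(xs, q). q # length xs # xs) ys)"

text \<open>Output cell 0 is kept free for the number of rules, which is known only at the end;
  hence the shift by one.\<close>

definition outrel :: "(nat list \<times> nat) list \<Rightarrow> mem \<Rightarrow> arrs \<Rightarrow> bool" where
  "outrel ys v A \<longleftrightarrow> v 5 = length ys \<and> v 4 = Suc (length (enc_out ys)) \<and>
     (\<forall>i < length (enc_out ys). A 0 (Suc i) = enc_out ys ! i)"

definition rounds :: com where
  "rounds = Seq (Assign 3 (N 0)) (Seq (Assign 4 (N 1)) (Seq (Assign 5 (N 0)) (For 3 (V 1) round)))"

lemma enc_out_snoc: "enc_out (ys @ [(xs, q)]) = enc_out ys @ q # length xs # xs"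
  by (simp add: enc_out_def)

lemma extend_word:
  "\<forall>j<length w. a (Suc j) = w ! j \<Longrightarrow>
   \<forall>j<length (w @ [x]). (a(Suc (length w) := x)) (Suc j) = (w @ [x]) ! j"
  by (auto simp: nth_append less_Suc_eq)

text \<open>The interface between parser and main loop. Occurrences are numbered rule by rule, rule
  \<open>r\<close> owning those from \<open>B r\<close> up to \<open>B (Suc r)\<close>. The list
  starting at \<open>HO x\<close> and continued by \<open>NX\<close> runs through the occurrences of
  \<open>x\<close> in decreasing order, so the part already visited is described by a
  threshold.\<close>

locale inst =
  fixes K M :: nat and Q :: "nat set" and H B OE RU NX HO TR :: "nat \<Rightarrow> nat"
  assumes finQ: "finite Q"
    and RU: "\<And>k. k \<in> {1..M} \<Longrightarrow> RU k < K"
    and B: "\<And>r. r < K \<Longrightarrow> {k \<in> {1..M}. RU k = r} = {B r..<B (Suc r)}"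
    and B_le: "\<And>r. r < K \<Longrightarrow> B r \<le> B (Suc r)"
    and inj: "\<And>r. r < K \<Longrightarrow> inj_on OE {B r..<B (Suc r)}"
    and OE_Q: "OE ` {1..M} \<subseteq> Q" and H_Q: "H ` {..<K} \<subseteq> Q"
    and NX: "\<And>k. k \<in> {1..M} \<Longrightarrow> (NX k = 0 \<or> NX k \<in> {1..M} \<and> OE (NX k) = OE k) \<and> NX k < k \<and>
       (\<forall>i. NX k < i \<and> i < k \<longrightarrow> OE i \<noteq> OE k)"
    and HO: "\<And>x. x \<in> OE ` {1..M} \<union> H ` {..<K} \<Longrightarrow> (HO x = 0 \<or> HO x \<in> {1..M} \<and> OE (HO x) = x) \<and>
       (\<forall>i. HO x < i \<and> i \<le> M \<longrightarrow> OE i \<noteq> x)"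
    and TR: "\<And>r. r < K \<Longrightarrow> TR r = of_bool (H r \<in> OE ` {B r..<B (Suc r)})"
begin

definition ES :: "nat \<Rightarrow> nat set" where "ES r = OE ` {B r..<B (Suc r)}"

definition R :: "nat rule set" where "R = (\<lambda>r. (ES r, H r)) ` {..<K}"

text \<open>The elements whose array cells are reset and maintained. Its size is at most
  \<open>M + K\<close>, whereas \<open>Q\<close> may be arbitrarily large.\<close>

definition W :: "nat set" where "W = OE ` {1..M} \<union> H ` {..<K}"

definition static :: "mem \<Rightarrow> arrs \<Rightarrow> bool" where
  "static v A \<longleftrightarrow> v 1 = K \<and> v 2 = Suc M \<and> A 2 = H \<and> A 3 = B \<and> A 4 = OE \<and> A 5 = RU \<and>
     A 6 = NX \<and> A 7 = HO \<and> A 8 = TR"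

lemma static_same: "static v A \<Longrightarrow> same rs js v A v' A' \<Longrightarrow> rs \<inter> {1, 2} = {} \<Longrightarrow>
    js \<inter> {2, 3, 4, 5, 6, 7, 8} = {} \<Longrightarrow> static v' A'"
  unfolding static_def same_def by (simp add: Int_insert_right split: if_splits)

lemma B_sub: "r < K \<Longrightarrow> {B r..<B (Suc r)} \<subseteq> {1..M}"
  by (drule B) (auto simp del: atLeastAtMost_iff)

lemma ES_sub: "r < K \<Longrightarrow> ES r \<subseteq> OE ` {1..M}"
  unfolding ES_def by (intro image_mono B_sub)

lemma ES_iff: "r < K \<Longrightarrow> x \<in> ES r \<longleftrightarrow> (\<exists>k\<in>{1..M}. RU k = r \<and> OE k = x)"
  unfolding ES_def by (simp only: B[symmetric]) auto

lemma finite_W: "finite W"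
  by (simp add: W_def)

lemma card_W: "card W \<le> M + K"
proof -
  have "card W \<le> card (OE ` {1..M}) + card (H ` {..<K})" unfolding W_def by (rule card_Un_le)
  also have "\<dots> \<le> M + K" using card_image_le[of "{1..M}" OE] card_image_le[of "{..<K}" H] by simp
  finally show ?thesis .
qed

lemma W_Q: "W \<subseteq> Q"
  using OE_Q H_Q by (simp add: W_def)

lemma wp_reset_elems:
  assumes "static v A"
    and "\<And>v' A'. same {6} {9, 11} v A v' A' \<Longrightarrow>
      \<forall>x\<in>OE ` {1..M}. A' 9 x = 0 \<and> A' 11 x = 0 \<Longrightarrow> Q' (t + M) v' A'"
  shows "wp reset_elems Q' t v A"
  unfolding reset_elems_def wp_Seq wp_Assign
  \<comment> \<open>Numbering starts at 1, so \<open>i - 1\<close> iterations have passed; the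
    additive form avoids truncated subtraction.\<close>
  apply (rule wp_For[where hi = "Suc M" and I = "\<lambda>i t' v' A'. t' + 1 = t + i \<and> 1 \<le> i \<and> v' 6 = i \<and>
      same {6} {9, 11} v A v' A' \<and> (\<forall>x\<in>OE ` {1..<i}. A' 9 x = 0 \<and> A' 11 x = 0)"])
  subgoal by simp
  subgoal by simp
  subgoal using assms(1) by (auto simp: static_def same_def)
  subgoal premises p for i t' v' A'
  proof -
    have "A' 4 = OE" using p assms(1) by (auto simp: static_def same_def)
    moreover have "{1..<Suc i} = insert i {1..<i}" using p by auto
    ultimately show ?thesis using p by (auto simp: less_Suc_eq_le)
  qed
  subgoal premises p for t' v' A'
  proof -
    have "t' = t + M" "{1..<Suc M} = {1..M}" using p by auto
    then show ?thesis using assms(2)[of v' A'] p by simp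
  qed
  done

lemma wp_reset_rules:
  assumes "static v A" "\<forall>x\<in>OE ` {1..M}. A 9 x = 0 \<and> A 11 x = 0"
    and "\<And>v' A'. same {7} {9, 10, 11, 13} v A v' A' \<Longrightarrow>
      \<forall>x\<in>W. A' 9 x = 0 \<and> A' 11 x = 0 \<Longrightarrow> \<forall>r<K. A' 10 r = TR r \<and> A' 13 r = 0 \<Longrightarrow> Q' (t + K) v' A'"
  shows "wp reset_rules Q' t v A"
  unfolding reset_rules_def wp_Seq wp_Assign
  apply (rule wp_For[where hi = "K" and I = "\<lambda>i t' v' A'. t' = t + i \<and> v' 7 = i \<and>
      same {7} {9, 10, 11, 13} v A v' A' \<and> (\<forall>x\<in>OE ` {1..M} \<union> H ` {..<i}. A' 9 x = 0 \<and> A' 11 x = 0) \<and>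
      (\<forall>r<i. A' 10 r = TR r \<and> A' 13 r = 0)"])
  subgoal using assms(2) by simp
  subgoal by simp
  subgoal using assms(1) by (auto simp: static_def same_def)
  subgoal premises p for i t' v' A'
  proof -
    have "A' 2 = H" "A' 8 = TR" using p assms(1) by (auto simp: static_def same_def)
    then show ?thesis using p by (auto simp: lessThan_Suc less_Suc_eq)
  qed
  subgoal premises p for t' v' A'
    using assms(3)[of v' A'] p by (simp add: W_def)
  done

lemma wp_count_rules:
  assumes "static v A" "\<forall>x\<in>W. A 9 x = 0"
    and "\<And>v' A'. same {7} {9} v A v' A' \<Longrightarrow>
      \<forall>x\<in>W. A' 9 x = card {r. r < K \<and> TR r = 0 \<and> H r = x} \<Longrightarrow> Q' (t + K) v' A'"
  shows "wp count_rules Q' t v A"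
  unfolding count_rules_def wp_Seq wp_Assign
  apply (rule wp_For[where hi = "K" and I = "\<lambda>i t' v' A'. t' = t + i \<and> v' 7 = i \<and>
      same {7} {9} v A v' A' \<and> (\<forall>x\<in>W. A' 9 x = card {r. r < i \<and> TR r = 0 \<and> H r = x})"])
  subgoal using assms(2) by simp
  subgoal by simp
  subgoal using assms(1) by (auto simp: static_def same_def)
  subgoal premises p for i t' v' A'
  proof -
    have a: "A' 2 = H" "A' 8 = TR" "v' 7 = i" using p assms(1) by (auto simp: static_def same_def)
    have "{r. r < Suc i \<and> TR r = 0 \<and> H r = x} =
        (if TR i = 0 \<and> H i = x then insert i {r. r < i \<and> TR r = 0 \<and> H r = x}
         else {r. r < i \<and> TR r = 0 \<and> H r = x})" for x
      by (auto simp: less_Suc_eq)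
    then have "card {r. r < Suc i \<and> TR r = 0 \<and> H r = x} =
        card {r. r < i \<and> TR r = 0 \<and> H r = x} + of_bool (TR i = 0 \<and> H i = x)" for x
      by simp
    moreover have "H i \<in> W" using p by (simp add: W_def)
    ultimately show ?thesis using p a by auto
  qed
  subgoal premises p for t' v' A'
    using assms(3)[of v' A'] p by simp
  done

lemma wp_forbid:
  assumes "static v A" "v 3 = r0" "r0 < K"
    and "\<And>t' v' A'. same {6} {11} v A v' A' \<Longrightarrow> t' \<le> t + M \<Longrightarrow>
      \<forall>x. A' 11 x = (if x \<in> insert (H r0) (ES r0) then 1 else A 11 x) \<Longrightarrow> Q' t' v' A'"
  shows "wp forbid Q' t v A"
proof -
  have le: "B (Suc r0) - B r0 \<le> M"
    using card_mono[OF _ B_sub[OF assms(3)]] by simp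
  have A: "A 2 = H" "A 3 = B" "A 4 = OE" using assms(1) by (auto simp: static_def)
  show ?thesis
  unfolding forbid_def wp_Seq wp_Assign
  apply (rule wp_For[where hi = "B (Suc r0)" and I = "\<lambda>i t' v' A'. t' + B r0 = t + i \<and> B r0 \<le> i \<and>
      v' 6 = i \<and> same {6} {11} v A v' A' \<and>
      (\<forall>x. A' 11 x = (if x \<in> OE ` {B r0..<i} then 1 else A 11 x))"])
  subgoal using assms A by simp
  subgoal using assms A B_le by simp
  subgoal using assms A by (auto simp: same_def)
  subgoal premises p for i t' v' A'
  proof -
    have "A' 4 = OE" using p A by (auto simp: same_def)
    moreover have "{B r0..<Suc i} = insert i {B r0..<i}" using p by auto
    ultimately show ?thesis using p by auto
  qed
  subgoal premises p for t' v' A'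
  proof -
    have "A' 2 = H" "v' 3 = r0" using p A assms(2) by (auto simp: same_def)
    moreover have "t' \<le> t + M" using p le by auto
    ultimately show ?thesis using assms(4)[of v' "A'(11 := (A' 11)(H r0 := 1))" t'] p
      by (auto simp: ES_def)
  qed
  done
qed

text \<open>The core invariant of the propagation: \<open>D\<close> is the set of satisfied rules, \<open>P\<close> the set of
  processed elements, \<open>xs\<close> the stack and \<open>F\<close> the set of forbidden elements.\<close>

definition core :: "nat set \<Rightarrow> nat set \<Rightarrow> nat set \<Rightarrow> nat list \<Rightarrow> mem \<Rightarrow> arrs \<Rightarrow> bool" where
  "core F D P xs v A \<longleftrightarrow> (\<forall>r<K. A 10 r = of_bool (r \<in> D)) \<and>
     (\<forall>x\<in>W. A 9 x = card {r. r < K \<and> r \<notin> D \<and> H r = x}) \<and>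
     (\<forall>x\<in>W. A 11 x = of_bool (x \<in> F \<union> P \<union> set xs)) \<and>
     v 9 = length xs \<and> (\<forall>i<length xs. A 12 i = xs ! i) \<and> distinct xs \<and>
     set xs \<subseteq> W \<and> set xs \<inter> (F \<union> P) = {} \<and> (\<forall>x\<in>set xs. A 9 x = 0)"

text \<open>Pushing is skipped only if the counter is positive or the element is flagged. Either way
  an element with counter 0 ends up forbidden, processed or stacked, which is the completeness half
  of the propagation invariant.\<close>

lemma core_push:
  assumes "core F D P xs v A" "v r = x" "x \<in> W" "r \<noteq> 9"
    and "\<And>v' A' xs'. core F D P xs' v' A' \<Longrightarrow> same {9} {11, 12} v A v' A' \<Longrightarrow> set xs \<subseteq> set xs' \<Longrightarrow>
      (A 9 x = 0 \<Longrightarrow> x \<in> F \<union> P \<union> set xs') \<Longrightarrow> Q' t v' A'"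
  shows "wp (push r) Q' t v A"
proof (cases "A 9 x = 0 \<and> A 11 x = 0")
  case False
  then have "wp (push r) Q' t v A \<longleftrightarrow> Q' t v A" using assms(2) by (auto simp: push_def)
  moreover have "A 9 x = 0 \<Longrightarrow> x \<in> F \<union> P \<union> set xs"
    using False assms(1,3) unfolding core_def by auto
  ultimately show ?thesis using assms(5)[OF assms(1)] by simp
next
  case True
  let ?v = "v(9 := Suc (v 9))" and ?A = "A(11 := (A 11)(x := 1), 12 := (A 12)(v 9 := x))"
  have x: "x \<notin> F \<union> P \<union> set xs" using True assms(1,3) unfolding core_def by auto
  have "core F D P (xs @ [x]) ?v ?A"
    using assms(1,3) x True unfolding core_def by (auto simp: nth_append less_Suc_eq)
  then have "Q' t ?v ?A" by (rule assms(5)) auto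
  then show ?thesis using True assms(2,4) by (simp add: push_def)
qed

lemma core_regs: "core F D P xs v A \<Longrightarrow> v' 9 = v 9 \<Longrightarrow> core F D P xs v' A"
  by (simp add: core_def)

lemma wp_fill_stack:
  assumes "static v A" "\<forall>r<K. A 10 r = of_bool (r \<in> D)"
     "\<forall>x\<in>W. A 9 x = card {r. r < K \<and> r \<notin> D \<and> H r = x}"
     "\<forall>x\<in>W. A 11 x = of_bool (x \<in> F)"
    and "\<And>v' A' xs. core F D {} xs v' A' \<Longrightarrow> same {6, 9, 12} {11, 12} v A v' A' \<Longrightarrow>
       \<forall>x\<in>OE ` {1..M}. A' 9 x = 0 \<longrightarrow> x \<in> F \<union> set xs \<Longrightarrow> Q' (t + M) v' A'"
  shows "wp fill_stack Q' t v A"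
  unfolding fill_stack_def wp_Seq wp_Assign
  apply (rule wp_For[where hi = "Suc M" and I = "\<lambda>i t' v' A'. t' + 1 = t + i \<and> 1 \<le> i \<and> v' 6 = i \<and>
      same {6, 9, 12} {11, 12} v A v' A' \<and> (\<exists>xs. core F D {} xs v' A' \<and>
       (\<forall>x\<in>OE ` {1..<i}. A' 9 x = 0 \<longrightarrow> x \<in> F \<union> set xs))"])
  subgoal using assms(2-4) by (auto simp: core_def)
  subgoal by simp
  subgoal using assms(1) by (auto simp: static_def same_def)
  subgoal premises p for i t' v' A'
  proof -
    obtain xs where xs: "core F D {} xs v' A'" "\<forall>x\<in>OE ` {1..<i}. A' 9 x = 0 \<longrightarrow> x \<in> F \<union> set xs"
      and i: "t' + 1 = t + i" "1 \<le> i" "v' 6 = i" "same {6, 9, 12} {11, 12} v A v' A'"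
      using p by blast
    have 4: "A' 4 = OE" using i assms(1) by (auto simp: static_def same_def)
    have W: "OE i \<in> W" using p by (auto simp: W_def)
    have ivl: "{1..<Suc i} = insert i {1..<i}" using i by auto
    show ?thesis unfolding wp_Seq wp_Assign
    proof (rule core_push[where xs = xs and x = "OE i" and F = F and D = D and P = "{}"])
      show "core F D {} xs (v'(12 := ev (Rd 4 (V 6)) v' A')) A'" using xs(1) by (rule core_regs) simp
      fix v2 A2 xs'
      assume c: "core F D {} xs' v2 A2" "same {9} {11, 12} (v'(12 := ev (Rd 4 (V 6)) v' A')) A' v2 A2"
        "set xs \<subseteq> set xs'" "A' 9 (OE i) = 0 \<Longrightarrow> OE i \<in> F \<union> {} \<union> set xs'"
      have s: "same {6, 9, 12} {11, 12} v A v2 A2"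
        using i(4) c(2) by (intro same_trans[OF _ c(2), of "{6, 9, 12}" "{11, 12}"]) auto
      have "v2 6 = i" using c(2) i(3) by (simp add: same_def)
      moreover have "A2 9 = A' 9" using c(2) by (simp add: same_def)
      moreover have "core F D {} xs' (v2(6 := Suc (v2 6))) A2" using c(1) by (rule core_regs) simp
      ultimately show "Suc t' + 1 = t + Suc i \<and> 1 \<le> Suc i \<and> (v2(6 := Suc (v2 6))) 6 = Suc i \<and>
        same {6, 9, 12} {11, 12} v A (v2(6 := Suc (v2 6))) A2 \<and>
        (\<exists>xs. core F D {} xs (v2(6 := Suc (v2 6))) A2 \<and>
          (\<forall>x\<in>OE ` {1..<Suc i}. A2 9 x = 0 \<longrightarrow> x \<in> F \<union> set xs))"
        using xs(2) c(3,4) i s unfolding ivl by (intro conjI exI[of _ xs']) auto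
    qed (use 4 i W in auto)
  qed
  subgoal premises p for t' v' A'
  proof -
    have "t' = t + M" "{1..<Suc M} = {1..M}" using p by auto
    then show ?thesis using assms(5) p by auto
  qed
  done

section \<open>Propagation and its amortised cost\<close>

definition Dof :: "nat set \<Rightarrow> nat set" where
  "Dof P = {r. r < K \<and> (TR r \<noteq> 0 \<or> ES r \<inter> P \<noteq> {})}"

lemma enabled_R: "enabled R P x \<longleftrightarrow> {r. r < K \<and> r \<notin> Dof P \<and> H r = x} = {}"
proof -
  have "TR r \<noteq> 0 \<longleftrightarrow> H r \<in> ES r" if "r < K" for r using TR[OF that] by (simp add: ES_def)
  then show ?thesis unfolding enabled_def R_def Dof_def by auto
qed

text \<open>The potential that pays for \<open>visit\<close>: each occurrence of a processed element
  is visited once.\<close>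

definition occs :: "nat set \<Rightarrow> nat" where
  "occs P = card {k \<in> {1..M}. OE k \<in> P}"

lemma occs_le: "occs P \<le> M"
proof -
  have "occs P \<le> card {1..M}" unfolding occs_def by (rule card_mono) auto
  then show ?thesis by simp
qed

lemma occs_insert:
  assumes "x \<notin> P"
  shows "occs (insert x P) = occs P + card {k \<in> {1..M}. OE k = x}"
proof -
  have "{k \<in> {1..M}. OE k \<in> insert x P} = {k \<in> {1..M}. OE k \<in> P} \<union> {k \<in> {1..M}. OE k = x}"
    by auto
  then show ?thesis unfolding occs_def using assms by (simp, subst card_Un_disjoint) auto
qed

lemma wp_visit:
  assumes "static v A" "core F (Dof P) (insert x P) xs v A" "x \<in> W" "v 11 = HO x"
    and enq: "\<forall>y\<in>OE ` {1..M}. A 9 y = 0 \<longrightarrow> y \<in> F \<union> insert x P \<union> set xs"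
    and "\<And>t' v' A' xs'. core F (Dof (insert x P)) (insert x P) xs' v' A' \<Longrightarrow>
       same {9, 11, 12} {9, 10, 11, 12} v A v' A' \<Longrightarrow>
       \<forall>y\<in>OE ` {1..M}. A' 9 y = 0 \<longrightarrow> y \<in> F \<union> insert x P \<union> set xs' \<Longrightarrow>
       t' \<le> t + card {k \<in> {1..M}. OE k = x} \<Longrightarrow> Q' t' v' A'"
  shows "wp visit Q' t v A"
proof -
  \<comment> \<open>The rules satisfied once the occurrences of \<open>x\<close> above
    \<open>p\<close> have been visited. As the list is decreasing, this leads from
    \<open>Dof P\<close> at \<open>HO x\<close> to \<open>Dof (insert x P)\<close> at the terminator
    0.\<close>
  define DD where "DD p = Dof P \<union> RU ` {k \<in> {1..M}. p < k \<and> OE k = x}" for p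
  have DDN: "DD (HO x) = Dof P" using HO[of x] assms(3) unfolding DD_def W_def by auto
  have DD0: "DD 0 = Dof (insert x P)"
  proof -
    have "{r. r < K \<and> x \<in> ES r} = RU ` {k \<in> {1..M}. 0 < k \<and> OE k = x}"
      using ES_iff RU by fastforce
    then show ?thesis unfolding DD_def Dof_def by auto
  qed
  define I where "I t' v' A' \<longleftrightarrow> (v' 11 = 0 \<or> v' 11 \<in> {1..M} \<and> OE (v' 11) = x) \<and>
     same {9, 11, 12} {9, 10, 11, 12} v A v' A' \<and>
     t' \<le> t + card {k \<in> {1..M}. v' 11 < k \<and> OE k = x} \<and>
     (\<exists>xs. core F (DD (v' 11)) (insert x P) xs v' A' \<and>
        (\<forall>y\<in>OE ` {1..M}. A' 9 y = 0 \<longrightarrow> y \<in> F \<union> insert x P \<union> set xs))" for t' :: nat and v' A'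
  show ?thesis unfolding visit_def
  proof (rule wp_While[where I = I and T = "t + M"])
    have "HO x = 0 \<or> HO x \<in> {1..M} \<and> OE (HO x) = x" using HO[of x] assms(3) by (auto simp: W_def)
    then show "I t v A" unfolding I_def assms(4) DDN using assms(2) enq by auto
  next
    fix t' v' A' assume "I t' v' A'"
    moreover have "card {k \<in> {1..M}. v' 11 < k \<and> OE k = x} \<le> card {1..M}" by (rule card_mono) auto
    ultimately show "t' \<le> t + M" unfolding I_def by simp
  next
    fix t' v' A' assume I: "I t' v' A'" and nz: "ev (V 11) v' A' \<noteq> 0"
    define p where "p = v' 11"
    have p: "p \<in> {1..M}" "OE p = x" using I nz unfolding I_def p_def by auto
    have sm: "same {9, 11, 12} {9, 10, 11, 12} v A v' A'"
      and tm: "t' \<le> t + card {k \<in> {1..M}. p < k \<and> OE k = x}"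
      using I unfolding I_def p_def by auto
    obtain xs where c: "core F (DD p) (insert x P) xs v' A'"
      "\<forall>y\<in>OE ` {1..M}. A' 9 y = 0 \<longrightarrow> y \<in> F \<union> insert x P \<union> set xs"
      using I unfolding I_def p_def by blast
    have st: "A' 2 = H" "A' 5 = RU" "A' 6 = NX" using sm assms(1) by (auto simp: static_def same_def)
    define r where "r = RU p"
    have rK: "r < K" using RU p r_def by auto
    \<comment> \<open>No occurrence of \<open>x\<close> lies strictly between \<open>NX p\<close>
      and \<open>p\<close>, so one step of the list adds exactly \<open>p\<close>.\<close>
    have nx: "{k \<in> {1..M}. NX p < k \<and> OE k = x} = insert p {k \<in> {1..M}. p < k \<and> OE k = x}"
      using NX[OF p(1)] p by (auto simp: not_less)
    have DDs: "DD (NX p) = insert r (DD p)" unfolding DD_def nx r_def by auto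
    have tm': "Suc t' \<le> t + card {k \<in> {1..M}. NX p < k \<and> OE k = x}" using tm unfolding nx by simp
    have fin: "I (Suc t') (v2(11 := NX p)) A2"
      if "core F (DD (NX p)) (insert x P) xs2 v2 A2" "same {9, 11, 12} {9, 10, 11, 12} v A v2 A2"
        "\<forall>y\<in>OE ` {1..M}. A2 9 y = 0 \<longrightarrow> y \<in> F \<union> insert x P \<union> set xs2" for v2 A2 xs2
      unfolding I_def using that NX[OF p(1)] p(2) tm' core_regs[OF that(1), of "v2(11 := NX p)"] by auto
    show "wp (Seq (If (Rd 10 (Rd 5 (V 11))) Skip
       (Seq (Write 10 (Rd 5 (V 11)) (N 1)) (Seq (Assign 12 (Rd 2 (Rd 5 (V 11))))
         (Seq (Write 9 (V 12) (Minus (Rd 9 (V 12)) (N 1))) (push 12)))))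
       (Assign 11 (Rd 6 (V 11)))) (\<lambda>t'. I (Suc t')) t' v' A'"
    proof (cases "r \<in> DD p")
      case True
      then have "A' 10 r = 1" using c(1) rK unfolding core_def by simp
      moreover have "DD (NX p) = DD p" using DDs True by auto
      ultimately show ?thesis using fin[of xs v' A'] c sm st by (simp add: p_def[symmetric] r_def)
    next
      case False
      then have r10: "A' 10 r = 0" using c(1) rK unfolding core_def by simp
      let ?h = "H r"
      have hW: "?h \<in> W" using rK by (simp add: W_def)
      let ?A = "A'(10 := (A' 10)(r := 1), 9 := (A' 9)(?h := A' 9 ?h - 1))"
      let ?v = "v'(12 := ?h)"
      have set: "{s. s < K \<and> s \<notin> DD p \<and> H s = y} =
          (if y = ?h then insert r {s. s < K \<and> s \<notin> DD (NX p) \<and> H s = y}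
           else {s. s < K \<and> s \<notin> DD (NX p) \<and> H s = y})" for y
        using False rK unfolding DDs by auto
      have cd: "card {s. s < K \<and> s \<notin> DD p \<and> H s = y} =
          card {s. s < K \<and> s \<notin> DD (NX p) \<and> H s = y} + of_bool (y = ?h)" for y
        unfolding set using DDs by auto
      have c': "core F (DD (NX p)) (insert x P) xs ?v ?A"
        using c(1) unfolding core_def cd by (auto simp: DDs)
      have "wp (push 12) (wp (Assign 11 (Rd 6 (V 11))) (\<lambda>t'. I (Suc t'))) t' ?v ?A"
      proof (rule core_push[OF c'])
        fix v2 A2 xs'
        assume d: "core F (DD (NX p)) (insert x P) xs' v2 A2" "same {9} {11, 12} ?v ?A v2 A2"
          "set xs \<subseteq> set xs'" "?A 9 ?h = 0 \<Longrightarrow> ?h \<in> F \<union> insert x P \<union> set xs'"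
        have "same {9, 11, 12} {9, 10, 11, 12} v A ?v ?A" using sm by simp
        then have "same {9, 11, 12} {9, 10, 11, 12} v A v2 A2"
          using d(2) by (rule same_trans) auto
        moreover have e: "A2 9 = ?A 9" "A2 6 = NX" "v2 11 = p"
          using d(2) st by (auto simp: same_def p_def)
        moreover have "\<forall>y\<in>OE ` {1..M}. A2 9 y = 0 \<longrightarrow> y \<in> F \<union> insert x P \<union> set xs'"
          using c(2) d(3,4) unfolding e(1) by (auto split: if_splits)
        ultimately show "wp (Assign 11 (Rd 6 (V 11))) (\<lambda>t'. I (Suc t')) t' v2 A2"
          using fin d(1) by simp
      qed (use hW in auto)
      then show ?thesis using r10 st by (simp add: p_def[symmetric] r_def)
    qed
  next
    fix t' v' A' assume "I t' v' A'" "ev (V 11) v' A' = 0"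
    moreover have "{k \<in> {1..M}. 0 < k \<and> OE k = x} = {k \<in> {1..M}. OE k = x}" by auto
    ultimately show "Q' t' v' A'" unfolding I_def using assms(6)[of _ v' A' t'] DD0 by auto
  qed
qed

lemma core_pop:
  assumes "core F D P xs v A" "xs \<noteq> []"
  shows "core F D (insert (last xs) P) (butlast xs) (v(9 := v 9 - 1)) A" "A 12 (v 9 - 1) = last xs"
proof -
  obtain y ys where xs: "xs = ys @ [y]" using assms(2) by (metis append_butlast_last_id)
  show "core F D (insert (last xs) P) (butlast xs) (v(9 := v 9 - 1)) A" "A 12 (v 9 - 1) = last xs"
    using assms(1) unfolding core_def xs by (auto simp: nth_append less_Suc_eq)
qed

text \<open>A stacked element has counter 0 and is therefore enabled at \<open>P\<close>, so
  \<open>P\<close> stays feasible. Pops are counted by \<open>card P\<close>, at most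
  \<open>M + K\<close>, and visits by \<open>occs P\<close>, at most \<open>M\<close>.\<close>

lemma wp_propagate:
  assumes "static v A" "core F (Dof {}) {} xs v A"
    and "\<forall>x\<in>OE ` {1..M}. A 9 x = 0 \<longrightarrow> x \<in> F \<union> set xs"
    and "\<And>t' v' A' P. core F (Dof P) P [] v' A' \<Longrightarrow> same {8, 9, 11, 12} {9, 10, 11, 12} v A v' A' \<Longrightarrow>
       P \<in> AR Q R \<Longrightarrow> P \<inter> F = {} \<Longrightarrow>
       \<forall>x\<in>OE ` {1..M}. A' 9 x = 0 \<longrightarrow> x \<in> F \<union> P \<Longrightarrow>
       t' \<le> t + (2 * M + K) \<Longrightarrow> Q' t' v' A'"
  shows "wp propagate Q' t v A"
proof -
  define I where "I t' v' A' \<longleftrightarrow> same {8, 9, 11, 12} {9, 10, 11, 12} v A v' A' \<and>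
    (\<exists>P xs. core F (Dof P) P xs v' A' \<and> P \<in> AR Q R \<and> P \<inter> F = {} \<and> P \<subseteq> W \<and>
      (\<forall>x\<in>OE ` {1..M}. A' 9 x = 0 \<longrightarrow> x \<in> F \<union> P \<union> set xs) \<and> t' \<le> t + card P + occs P)"
    for t' :: nat and v' A'
  have le: "card P + occs P \<le> 2 * M + K" if "P \<subseteq> W" for P
    using card_mono[OF finite_W that] card_W occs_le[of P] by linarith
  show ?thesis unfolding propagate_def
  proof (rule wp_While[where I = I and T = "t + (2 * M + K)"])
    show "I t v A" unfolding I_def using assms(2,3) by (auto intro!: exI[of _ "{}"] AR_empty)
  next
    fix t' v' A' assume "I t' v' A'"
    then obtain P where "P \<subseteq> W" "t' \<le> t + card P + occs P" unfolding I_def by blast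
    then show "t' \<le> t + (2 * M + K)" using le[of P] by linarith
  next
    fix t' v' A' assume I: "I t' v' A'" and nz: "ev (V 9) v' A' \<noteq> 0"
    then have sm: "same {8, 9, 11, 12} {9, 10, 11, 12} v A v' A'" unfolding I_def by blast
    obtain P xs where c: "core F (Dof P) P xs v' A'" and P: "P \<in> AR Q R" "P \<inter> F = {}" "P \<subseteq> W"
      and enq: "\<forall>x\<in>OE ` {1..M}. A' 9 x = 0 \<longrightarrow> x \<in> F \<union> P \<union> set xs"
      and tm: "t' \<le> t + card P + occs P" using I unfolding I_def by blast
    have ne: "xs \<noteq> []" using c nz unfolding core_def by auto
    define x where "x = last xs"
    define xs1 where "xs1 = butlast xs"
    have xs: "set xs = insert x (set xs1)" unfolding x_def xs1_def using ne
      by (metis append_butlast_last_id list.set(2) rotate1.simps(2) set_rotate1)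
    have x: "x \<in> W" "x \<notin> P" "x \<notin> F" "A' 9 x = 0" using c xs unfolding core_def by auto
    then have "{r. r < K \<and> r \<notin> Dof P \<and> H r = x} = {}" using c unfolding core_def by auto
    then have "enabled R P x" by (simp add: enabled_R)
    then have P': "insert x P \<in> AR Q R" using P(1) x(1) W_Q by (intro AR_insert) auto
    note pop = core_pop[OF c ne, folded x_def xs1_def]
    let ?v = "v'(9 := v' 9 - 1, 8 := x, 11 := HO x)"
    have stat: "static v' A'" using assms(1) sm by (rule static_same) auto
    then have 7: "A' 7 = HO" by (auto simp: static_def)
    have sm': "same {8, 9, 11, 12} {9, 10, 11, 12} v A ?v A'" using sm by simp
    have "wp visit (\<lambda>t'. I (Suc t')) t' ?v A'"
    proof (rule wp_visit[where F = F and P = P and x = x and xs = xs1])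
      show "static ?v A'" using stat by (simp add: static_def)
      show "core F (Dof P) (insert x P) xs1 ?v A'" using pop(1) by (rule core_regs) simp
      show "\<forall>y\<in>OE ` {1..M}. A' 9 y = 0 \<longrightarrow> y \<in> F \<union> insert x P \<union> set xs1"
        using enq unfolding xs by auto
    next
      fix t2 v2 A2 xs2
      assume d: "core F (Dof (insert x P)) (insert x P) xs2 v2 A2"
        "same {9, 11, 12} {9, 10, 11, 12} ?v A' v2 A2"
        "\<forall>y\<in>OE ` {1..M}. A2 9 y = 0 \<longrightarrow> y \<in> F \<union> insert x P \<union> set xs2"
        "t2 \<le> t' + card {k \<in> {1..M}. OE k = x}"
      have "finite P" using finite_subset[OF P(3) finite_W] .
      then have "Suc t2 \<le> t + card (insert x P) + occs (insert x P)"
        using d(4) tm x(2) occs_insert[OF x(2)] by simp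
      moreover have "same {8, 9, 11, 12} {9, 10, 11, 12} v A v2 A2"
        using sm' d(2) by (rule same_trans) auto
      ultimately show "I (Suc t2) v2 A2" unfolding I_def using d P' P x by blast
    qed (use x in auto)
    then show "wp (Seq (Assign 9 (Minus (V 9) (N 1))) (Seq (Assign 8 (Rd 12 (V 9)))
       (Seq (Assign 11 (Rd 7 (V 8))) visit))) (\<lambda>t'. I (Suc t')) t' v' A'"
      using pop(2) 7 by simp
  next
    fix t' v' A' assume I: "I t' v' A'" and z: "ev (V 9) v' A' = 0"
    then obtain P xs where c: "core F (Dof P) P xs v' A'" and P: "P \<in> AR Q R" "P \<inter> F = {}" "P \<subseteq> W"
      and enq: "\<forall>x\<in>OE ` {1..M}. A' 9 x = 0 \<longrightarrow> x \<in> F \<union> P \<union> set xs"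
      and tm: "t' \<le> t + card P + occs P" unfolding I_def by blast
    have "xs = []" using c z unfolding core_def by simp
    then show "Q' t' v' A'" using assms(4)[of P v' A' t'] c P enq tm le[OF P(3)] I
      unfolding I_def by auto
  qed
qed


text \<open>The processed set \<open>P\<close> can be smaller than \<open>X\<close>, since elements
  of no body may be missing. Both agree on the elements of bodies, hence satisfy the same rules, and
  so flags and counters are correct for \<open>X\<close>.\<close>

lemma propagated:
  assumes "core F (Dof P) P [] v A" "P \<in> AR Q R" "P \<inter> F = {}"
    and enq: "\<forall>x\<in>OE ` {1..M}. A 9 x = 0 \<longrightarrow> x \<in> F \<union> P"
  defines "X \<equiv> maxf Q R F"
  shows "\<forall>r<K. A 10 r = of_bool (r \<in> Dof X)" "\<forall>x\<in>W. A 9 x = 0 \<longleftrightarrow> enabled R X x"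
proof -
  have c: "\<forall>r<K. A 10 r = of_bool (r \<in> Dof P)"
      "\<forall>x\<in>W. A 9 x = card {r. r < K \<and> r \<notin> Dof P \<and> H r = x}"
    using assms(1) unfolding core_def by blast+
  then have e: "A 9 x = 0 \<longleftrightarrow> enabled R P x" if "x \<in> W" for x
    using that by (simp add: enabled_R)
  \<comment> \<open>Follow a path to \<open>Z\<close>. Its next element is enabled at
    \<open>P\<close>, because \<open>P\<close> already satisfies every rule that the path has
    satisfied; if it lies in a body, its counter is 0 and \<open>enq\<close> puts it into
    \<open>P\<close>.\<close>
  have Z: "Z \<inter> OE ` {1..M} \<subseteq> P" if "Z \<in> AR Q R" "Z \<inter> F = {}" for Z
    using that
  proof (induction rule: AR_induct)
    case (insert x Y)
    have sub: "Y \<inter> OE ` {1..M} \<subseteq> P" and xF: "x \<notin> F" using insert by auto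
    have "r \<in> Dof P" if "r \<in> Dof Y" for r
    proof -
      have "ES r \<subseteq> OE ` {1..M}" using that by (intro ES_sub) (simp add: Dof_def)
      then show ?thesis using that sub unfolding Dof_def by blast
    qed
    then have "enabled R P x" using insert.hyps by (auto simp: enabled_R)
    then have "x \<in> P" if "x \<in> OE ` {1..M}"
      using e[of x] enq that xF by (auto simp: W_def)
    then show ?case using sub by auto
  qed simp
  have X: "X \<in> AR Q R" "X \<inter> F = {}" unfolding X_def by (rule maxf_AR[OF finQ], rule maxf_disj)
  have PX: "P \<subseteq> X" unfolding X_def using assms(2,3) by (rule maxf_upper)
  have D: "Dof X = Dof P"
  proof -
    have "ES r \<inter> X \<noteq> {} \<longleftrightarrow> ES r \<inter> P \<noteq> {}" if "r < K" for r
      using ES_sub[OF that] Z[OF X] PX by blast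
    then show ?thesis unfolding Dof_def by blast
  qed
  show "\<forall>r<K. A 10 r = of_bool (r \<in> Dof X)" using c(1) D by simp
  show "\<forall>x\<in>W. A 9 x = 0 \<longleftrightarrow> enabled R X x" using e D by (simp add: enabled_R)
qed

section \<open>Deciding criticality by counting\<close>

definition avoid :: "nat \<Rightarrow> nat set" where
  "avoid r = maxf Q R (insert (H r) (ES r))"

definition addable :: "nat \<Rightarrow> nat \<Rightarrow> nat set" where
  "addable r0 r = {x \<in> ES r. enabled R (avoid r0) x}"

lemma TR0: "r < K \<Longrightarrow> TR r = 0 \<longleftrightarrow> H r \<notin> ES r"
  using TR[of r] by (simp add: ES_def)

lemma Dof_avoid: "r < K \<Longrightarrow> r \<in> Dof (avoid r) \<longleftrightarrow> TR r \<noteq> 0"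
  using maxf_disj[of Q R "insert (H r) (ES r)"] unfolding Dof_def avoid_def by auto

lemma reduct_eq: "reduct Q R (ES r, H r) = (addable r r, H r)"
  by (simp add: reduct_def addable_def avoid_def)

lemma finite_addable: "finite (addable r0 r)"
  unfolding addable_def ES_def by simp

text \<open>If an element of another violated body with head \<open>H r0\<close> can be added to the
  largest set avoiding rule \<open>r0\<close>, maximality forces it into \<open>ES r0\<close>. So
  the addable part of that body is contained in that of \<open>r0\<close>, and for finite sets
  equality is equality of cardinalities.\<close>

lemma good_iff:
  assumes "r0 < K"
  shows "good Q R (ES r0, H r0) \<longleftrightarrow> r0 \<notin> Dof (avoid r0) \<and>
    (\<forall>r<K. r \<notin> Dof (avoid r0) \<and> H r = H r0 \<longrightarrow> card (addable r0 r) = card (addable r0 r0))"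
proof -
  let ?X = "avoid r0"
  have sub: "addable r0 r \<subseteq> addable r0 r0" if "r < K" "r \<notin> Dof ?X" "H r = H r0" for r
  proof
    fix x assume x: "x \<in> addable r0 r"
    then have "x \<in> ES r" "enabled R ?X x" by (auto simp: addable_def)
    moreover have "x \<notin> ?X" "x \<noteq> H r0" using that \<open>x \<in> ES r\<close> TR0[OF that(1)] by (auto simp: Dof_def)
    moreover have "x \<in> Q" using \<open>x \<in> ES r\<close> ES_sub[OF that(1)] OE_Q by blast
    ultimately have "x \<in> ES r0"
      using maxf_enabled[OF finQ, of x "insert (H r0) (ES r0)" R] unfolding avoid_def by blast
    then show "x \<in> addable r0 r0" using \<open>enabled R ?X x\<close> by (simp add: addable_def)
  qed
  have en: "enabled R (insert s ?X) (H r0) \<longleftrightarrow>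
      (\<forall>r<K. r \<notin> Dof ?X \<and> H r = H r0 \<longrightarrow> s \<in> ES r)" for s
    unfolding enabled_R Dof_def by auto
  have "(\<forall>s\<in>addable r0 r0. s \<in> ES r) \<longleftrightarrow> card (addable r0 r) = card (addable r0 r0)"
    if "r < K" "r \<notin> Dof ?X" "H r = H r0" for r
  proof -
    have "(\<forall>s\<in>addable r0 r0. s \<in> ES r) \<longleftrightarrow> addable r0 r0 \<subseteq> addable r0 r"
      by (auto simp: addable_def)
    also have "\<dots> \<longleftrightarrow> addable r0 r = addable r0 r0" using sub[OF that] by blast
    also have "\<dots> \<longleftrightarrow> card (addable r0 r) = card (addable r0 r0)"
      using card_subset_eq[OF finite_addable sub[OF that]] by auto
    finally show ?thesis .
  qed
  then have "(\<forall>s\<in>addable r0 r0. enabled R (insert s ?X) (H r0)) \<longleftrightarrow>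
    (\<forall>r<K. r \<notin> Dof ?X \<and> H r = H r0 \<longrightarrow> card (addable r0 r) = card (addable r0 r0))"
    unfolding en by blast
  then show ?thesis unfolding good_def reduct_eq Dof_avoid[OF assms]
    using TR0[OF assms] by (simp add: avoid_def)
qed

text \<open>The program counts occurrences, not elements; within one body these agree because
  \<open>OE\<close> is injective there.\<close>

lemma card_addable:
  assumes "r < K" "\<forall>x\<in>W. a x = 0 \<longleftrightarrow> enabled R (avoid r0) x"
  shows "card {k \<in> {1..M}. RU k = r \<and> a (OE k) = (0 :: nat)} = card (addable r0 r)"
    "OE ` {k \<in> {B r..<B (Suc r)}. a (OE k) = 0} = addable r0 r"
    "card {k \<in> {B r..<B (Suc r)}. a (OE k) = 0} = card (addable r0 r)"
proof -
  have "{k \<in> {1..M}. RU k = r \<and> a (OE k) = 0} = {k \<in> {k \<in> {1..M}. RU k = r}. a (OE k) = 0}" by blast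
  also have "\<dots> = {k \<in> {B r..<B (Suc r)}. a (OE k) = 0}" unfolding B[OF assms(1)] ..
  finally have 1: "{k \<in> {1..M}. RU k = r \<and> a (OE k) = 0} = {k \<in> {B r..<B (Suc r)}. a (OE k) = 0}" .
  have "OE k \<in> W" if "k \<in> {B r..<B (Suc r)}" for k
    using that B_sub[OF assms(1)] unfolding W_def by blast
  then show 2: "OE ` {k \<in> {B r..<B (Suc r)}. a (OE k) = 0} = addable r0 r"
    using assms(2) unfolding addable_def ES_def by auto
  have i: "inj_on OE {k \<in> {B r..<B (Suc r)}. a (OE k) = 0}"
    using inj[OF assms(1)] by (rule inj_on_subset) auto
  show 3: "card {k \<in> {B r..<B (Suc r)}. a (OE k) = 0} = card (addable r0 r)"
    using card_image[OF i] unfolding 2 by simp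
  show "card {k \<in> {1..M}. RU k = r \<and> a (OE k) = 0} = card (addable r0 r)" unfolding 1 3 ..
qed

lemma wp_count_enabled:
  assumes "static v A" "\<forall>r<K. A 13 r = 0"
    and "\<And>v' A'. same {6} {13} v A v' A' \<Longrightarrow>
      \<forall>r<K. A' 13 r = card {k \<in> {1..M}. RU k = r \<and> A 9 (OE k) = 0} \<Longrightarrow> Q' (t + M) v' A'"
  shows "wp count_enabled Q' t v A"
  unfolding count_enabled_def wp_Seq wp_Assign
  apply (rule wp_For[where hi = "Suc M" and I = "\<lambda>i t' v' A'. t' + 1 = t + i \<and> 1 \<le> i \<and> v' 6 = i \<and>
      same {6} {13} v A v' A' \<and> (\<forall>r<K. A' 13 r = card {k \<in> {1..<i}. RU k = r \<and> A 9 (OE k) = 0})"])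
  subgoal using assms(2) by simp
  subgoal by simp
  subgoal using assms(1) by (auto simp: static_def same_def)
  subgoal premises p for i t' v' A'
  proof -
    have a: "A' 4 = OE" "A' 5 = RU" "A' 9 = A 9" "v' 6 = i"
      using p assms(1) by (auto simp: static_def same_def)
    have "{k \<in> {1..<Suc i}. RU k = r \<and> A 9 (OE k) = 0} =
       (if RU i = r \<and> A 9 (OE i) = 0 then insert i {k \<in> {1..<i}. RU k = r \<and> A 9 (OE k) = 0}
        else {k \<in> {1..<i}. RU k = r \<and> A 9 (OE k) = 0})" for r
      using p by (auto simp: less_Suc_eq)
    then have "card {k \<in> {1..<Suc i}. RU k = r \<and> A 9 (OE k) = 0} =
        card {k \<in> {1..<i}. RU k = r \<and> A 9 (OE k) = 0} + of_bool (RU i = r \<and> A 9 (OE i) = 0)" for r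
      by simp
    then show ?thesis using p a by auto
  qed
  subgoal premises p for t' v' A'
  proof -
    have "t' = t + M" "{1..<Suc M} = {1..M}" using p by auto
    then show ?thesis using assms(3)[of v' A'] p by simp
  qed
  done

lemma wp_test_good:
  assumes "static v A" "v 3 = r0" "r0 < K" "\<forall>r<K. A 10 r = of_bool (r \<in> D)"
    and "\<And>v'. same {7, 10} {} v A v' A \<Longrightarrow> v' 10 = of_bool (r0 \<notin> D \<and>
      (\<forall>r<K. r \<notin> D \<and> H r = H r0 \<longrightarrow> A 13 r = A 13 r0)) \<Longrightarrow> Q' (t + K) v' A"
  shows "wp test_good Q' t v A"
  unfolding test_good_def wp_Seq wp_Assign
  apply (rule wp_For[where hi = "K" and I = "\<lambda>i t' v' A'. t' = t + i \<and> v' 7 = i \<and> A' = A \<and>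
      same {7, 10} {} v A v' A \<and> v' 10 = of_bool (r0 \<notin> D \<and>
      (\<forall>r<i. r \<notin> D \<and> H r = H r0 \<longrightarrow> A 13 r = A 13 r0))"])
  subgoal using assms(2-4) by simp
  subgoal by simp
  subgoal using assms(1) by (auto simp: static_def same_def)
  subgoal premises p for i t' v' A'
  proof -
    have a: "A 2 = H" "v' 7 = i" "v' 3 = r0" "A 10 i = of_bool (i \<in> D)"
      using p assms(1,2,4) by (auto simp: static_def same_def)
    show ?thesis using p a by (auto simp: less_Suc_eq)
  qed
  subgoal premises p for t' v' A'
    using assms(5)[of v'] p by simp
  done

lemma wp_emit:
  assumes "static v A" "v 3 = r0" "r0 < K" "outrel ys v A"
    and c: "\<forall>x\<in>W. A 9 x = 0 \<longleftrightarrow> enabled R (avoid r0) x" "A 13 r0 = card (addable r0 r0)"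
    and "\<And>v' A' ys' t'. same {4, 5, 6} {0} v A v' A' \<Longrightarrow> outrel ys' v' A' \<Longrightarrow>
      (if v 10 = 0 then ys' = ys else \<exists>zs. ys' = ys @ [(zs, H r0)] \<and> set zs = addable r0 r0 \<and>
         length zs \<le> B (Suc r0) - B r0) \<Longrightarrow> t' \<le> t + M \<Longrightarrow> Q' t' v' A'"
  shows "wp emit Q' t v A"
proof (cases "v 10 = 0")
  case True
  then show ?thesis using assms(7)[of v A ys t] assms(4) by (simp add: emit_def)
next
  case False
  have le: "B (Suc r0) - B r0 \<le> M"
    using card_mono[OF _ B_sub[OF assms(3)]] by simp
  have A: "A 2 = H" "A 3 = B" "A 4 = OE" using assms(1) by (auto simp: static_def)
  define zs where "zs i = map OE (filter (\<lambda>k. A 9 (OE k) = 0) [B r0..<i])" for i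
  let ?Z = "zs (B (Suc r0))"
  have Z: "set ?Z = addable r0 r0" "length ?Z = card (addable r0 r0)" "length ?Z \<le> B (Suc r0) - B r0"
  proof -
    have "set ?Z = OE ` {k \<in> {B r0..<B (Suc r0)}. A 9 (OE k) = 0}" by (auto simp: zs_def)
    then show "set ?Z = addable r0 r0" using card_addable(2)[OF assms(3) c(1)] by simp
    have "length ?Z = card (set (filter (\<lambda>k. A 9 (OE k) = 0) [B r0..<B (Suc r0)]))"
      unfolding zs_def length_map by (rule distinct_card[symmetric]) simp
    also have "set (filter (\<lambda>k. A 9 (OE k) = 0) [B r0..<B (Suc r0)]) =
        {k \<in> {B r0..<B (Suc r0)}. A 9 (OE k) = 0}" by auto
    finally show "length ?Z = card (addable r0 r0)" using card_addable(3)[OF assms(3) c(1)] by simp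
    show "length ?Z \<le> B (Suc r0) - B r0"
      unfolding zs_def length_map using length_filter_le[of _ "[B r0..<B (Suc r0)]"] by simp
  qed
  \<comment> \<open>What the output must read after the occurrences below \<open>i\<close>. The
    length field already holds the final count, as it is written before the elements.\<close>
  define w where "w i = enc_out ys @ H r0 # A 13 r0 # zs i" for i
  have out: "v 4 = Suc (length (enc_out ys))" "v 5 = length ys"
    "\<forall>i < length (enc_out ys). A 0 (Suc i) = enc_out ys ! i"
    using assms(4) by (auto simp: outrel_def)
  have "wp (For 6 (Rd 3 (Plus (V 3) (N 1)))
        (If (Rd 9 (Rd 4 (V 6))) Skip (Seq (Write 0 (V 4) (Rd 4 (V 6))) (Assign 4 (Plus (V 4) (N 1)))))) Q' t
     (v(5 := Suc (v 5), 4 := Suc (Suc (v 4)), 6 := B r0))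
     (A(0 := (A 0)(v 4 := H r0, Suc (v 4) := A 13 r0)))"
  apply (rule wp_For[where hi = "B (Suc r0)" and I = "\<lambda>i t' v' A'. t' + B r0 = t + i \<and> B r0 \<le> i \<and>
      v' 6 = i \<and> same {4, 5, 6} {0} v A v' A' \<and> v' 5 = Suc (length ys) \<and>
      v' 4 = Suc (length (w i)) \<and> (\<forall>j<length (w i). A' 0 (Suc j) = w i ! j)"])
  subgoal using A out by (auto simp: w_def zs_def nth_append less_Suc_eq nth_Cons')
  subgoal using B_le[OF assms(3)] by simp
  subgoal using assms(2) A by (auto simp: same_def)
  subgoal premises p for i t' v' A'
  proof -
    have a: "A' 4 = OE" "A' 9 = A 9" "v' 6 = i" using p A by (auto simp: same_def)
    have z: "zs (Suc i) = (if A 9 (OE i) = 0 then zs i @ [OE i] else zs i)"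
      using p by (auto simp: zs_def)
    then have w: "w (Suc i) = (if A 9 (OE i) = 0 then w i @ [OE i] else w i)"
      by (simp add: w_def)
    have v4: "v' 4 = Suc (length (w i))" and eq: "\<forall>j<length (w i). A' 0 (Suc j) = w i ! j"
      using p by blast+
    show ?thesis
      using p a v4 extend_word[OF eq, of "OE i"] unfolding w by auto
  qed
  subgoal premises p for t' v' A'
  proof (rule assms(7))
    show "outrel (ys @ [(?Z, H r0)]) v' A'"
      unfolding outrel_def enc_out_snoc using p Z(2) c(2) by (auto simp: w_def)
    show "t' \<le> t + M" using p le by linarith
  qed (use p False Z in auto)
  done
  then show ?thesis using False A assms(2) by (simp add: emit_def)
qed

text \<open>In the bound, \<open>reset_elems\<close>, \<open>forbid\<close>,
  \<open>fill_stack\<close>, \<open>count_enabled\<close> and \<open>emit\<close> contribute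
  \<open>M\<close> each, \<open>reset_rules\<close>, \<open>count_rules\<close> and
  \<open>test_good\<close> contribute \<open>K\<close> each, and \<open>propagate\<close>
  contributes \<open>2 * M + K\<close>.\<close>

lemma wp_round:
  assumes "static v A" "v 3 = r0" "r0 < K" "outrel ys v A"
    and Q': "\<And>v' A' ys' t'. same {4, 5, 6, 7, 8, 9, 10, 11, 12} {0, 9, 10, 11, 12, 13} v A v' A' \<Longrightarrow>
      outrel ys' v' A' \<Longrightarrow>
      (if good Q R (ES r0, H r0) then \<exists>zs. ys' = ys @ [(zs, H r0)] \<and>
         (set zs, H r0) = reduct Q R (ES r0, H r0) \<and> length zs \<le> B (Suc r0) - B r0 else ys' = ys) \<Longrightarrow>
      t' \<le> t + (7 * M + 4 * K) \<Longrightarrow> Q' t' v' A'"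
  shows "wp round Q' t v A"
proof -
  let ?rs = "{4, 5, 6, 7, 8, 9, 10, 11, 12} :: nat set" let ?js = "{0, 9, 10, 11, 12, 13} :: nat set"
  let ?F = "insert (H r0) (ES r0)"
  have D0: "Dof {} = {r. r < K \<and> TR r \<noteq> 0}" by (simp add: Dof_def)
  have FW: "?F \<subseteq> W" using ES_sub[OF assms(3)] assms(3) by (auto simp: W_def)
  show ?thesis unfolding round_def wp_Seq
  proof (rule wp_reset_elems[OF assms(1)])
    fix v1 A1 assume s1: "same {6} {9, 11} v A v1 A1"
      and p1: "\<forall>x\<in>OE ` {1..M}. A1 9 x = 0 \<and> A1 11 x = 0"
    have st1: "static v1 A1" using assms(1) s1 by (rule static_same) auto
    show "wp reset_rules (wp count_rules (wp forbid (wp fill_stack (wp propagate (wp count_enabled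
      (wp test_good (wp emit Q'))))))) (t + M) v1 A1"
    proof (rule wp_reset_rules[OF st1 p1])
      fix v2 A2 assume s2: "same {7} {9, 10, 11, 13} v1 A1 v2 A2"
        and p2: "\<forall>x\<in>W. A2 9 x = 0 \<and> A2 11 x = 0" "\<forall>r<K. A2 10 r = TR r \<and> A2 13 r = 0"
      have st2: "static v2 A2" using st1 s2 by (rule static_same) auto
      show "wp count_rules (wp forbid (wp fill_stack (wp propagate (wp count_enabled
        (wp test_good (wp emit Q')))))) (t + M + K) v2 A2"
      proof (rule wp_count_rules[OF st2])
        show "\<forall>x\<in>W. A2 9 x = 0" using p2 by blast
        fix v3 A3 assume s3: "same {7} {9} v2 A2 v3 A3"
          and p3: "\<forall>x\<in>W. A3 9 x = card {r. r < K \<and> TR r = 0 \<and> H r = x}"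
        have st3: "static v3 A3" using st2 s3 by (rule static_same) auto
        have r3: "v3 3 = r0" using s1 s2 s3 assms(2) by (simp add: same_def)
        show "wp forbid (wp fill_stack (wp propagate (wp count_enabled
          (wp test_good (wp emit Q'))))) (t + M + K + K) v3 A3"
        proof (rule wp_forbid[OF st3 r3 assms(3)])
          fix t4 v4 A4 assume s4: "same {6} {11} v3 A3 v4 A4" and t4: "t4 \<le> t + M + K + K + M"
            and p4: "\<forall>x. A4 11 x = (if x \<in> ?F then 1 else A3 11 x)"
          have st4: "static v4 A4" using st3 s4 by (rule static_same) auto
          have c4: "A4 13 = A2 13" using s3 s4 by (simp add: same_def)
          show "wp fill_stack (wp propagate (wp count_enabled (wp test_good (wp emit Q')))) t4 v4 A4"
          proof (rule wp_fill_stack[OF st4, where D = "Dof {}" and F = ?F])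
            show "\<forall>r<K. A4 10 r = of_bool (r \<in> Dof {})"
            proof -
              have "A4 10 = A2 10" using s3 s4 by (simp add: same_def)
              moreover have "TR r = of_bool (TR r \<noteq> 0)" if "r < K" for r using TR[OF that] by simp
              ultimately show ?thesis using p2(2) unfolding D0 by auto
            qed
            have "A4 9 = A3 9" using s4 by (simp add: same_def)
            moreover have "{r. r < K \<and> r \<notin> Dof {} \<and> H r = x} = {r. r < K \<and> TR r = 0 \<and> H r = x}" for x
              unfolding D0 by auto
            ultimately show "\<forall>x\<in>W. A4 9 x = card {r. r < K \<and> r \<notin> Dof {} \<and> H r = x}"
              using p3 by simp
            have "A3 11 = A2 11" using s3 by (simp add: same_def)
            then show "\<forall>x\<in>W. A4 11 x = of_bool (x \<in> ?F)" using p4 p2(1) by simp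
            fix v5 A5 xs
            assume p5: "core ?F (Dof {}) {} xs v5 A5" "\<forall>x\<in>OE ` {1..M}. A5 9 x = 0 \<longrightarrow> x \<in> ?F \<union> set xs"
              and s5: "same {6, 9, 12} {11, 12} v4 A4 v5 A5"
            have st5: "static v5 A5" using st4 s5 by (rule static_same) auto
            show "wp propagate (wp count_enabled (wp test_good (wp emit Q'))) (t4 + M) v5 A5"
            proof (rule wp_propagate[OF st5 p5])
              fix t6 v6 A6 P
              assume p6: "core ?F (Dof P) P [] v6 A6" "P \<in> AR Q R" "P \<inter> ?F = {}"
                "\<forall>x\<in>OE ` {1..M}. A6 9 x = 0 \<longrightarrow> x \<in> ?F \<union> P"
                and t6: "t6 \<le> t4 + M + (2 * M + K)"
                and s6: "same {8, 9, 11, 12} {9, 10, 11, 12} v5 A5 v6 A6"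
              have st6: "static v6 A6" using st5 s6 by (rule static_same) auto
              note pr = propagated[OF p6, folded avoid_def]
              have c6: "\<forall>r<K. A6 13 r = 0" using p2(2) c4 s5 s6 by (simp add: same_def)
              show "wp count_enabled (wp test_good (wp emit Q')) t6 v6 A6"
              proof (rule wp_count_enabled[OF st6 c6])
                fix v7 A7 assume s7: "same {6} {13} v6 A6 v7 A7"
                  and p7: "\<forall>r<K. A7 13 r = card {k \<in> {1..M}. RU k = r \<and> A6 9 (OE k) = 0}"
                have st7: "static v7 A7" using st6 s7 by (rule static_same) auto
                have c7: "\<forall>r<K. A7 13 r = card (addable r0 r)"
                  using p7 card_addable(1)[OF _ pr(2)] by simp
                have e7: "A7 10 = A6 10" "A7 9 = A6 9" using s7 by (simp_all add: same_def)
                have r7: "v7 3 = r0" using r3 s4 s5 s6 s7 by (simp add: same_def)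
                show "wp test_good (wp emit Q') (t6 + M) v7 A7"
                proof (rule wp_test_good[OF st7 r7 assms(3) pr(1)[folded e7(1)]])
                  fix v8 assume s8: "same {7, 10} {} v7 A7 v8 A7"
                    and p8: "v8 10 = of_bool (r0 \<notin> Dof (avoid r0) \<and>
                      (\<forall>r<K. r \<notin> Dof (avoid r0) \<and> H r = H r0 \<longrightarrow> A7 13 r = A7 13 r0))"
                  have st8: "static v8 A7" using st7 s8 by (rule static_same) auto
                  have g: "v8 10 = of_bool (good Q R (ES r0, H r0))"
                    unfolding p8 good_iff[OF assms(3)] using c7 assms(3) by (auto simp: of_bool_def)
                  have sa: "same ?rs ?js v A v8 A7"
                  proof -
                    have "same ?rs ?js v A v2 A2" using s1 s2 by (rule same_trans) auto
                    then have "same ?rs ?js v A v3 A3" using s3 by (rule same_trans) auto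
                    then have "same ?rs ?js v A v4 A4" using s4 by (rule same_trans) auto
                    then have "same ?rs ?js v A v5 A5" using s5 by (rule same_trans) auto
                    then have "same ?rs ?js v A v6 A6" using s6 by (rule same_trans) auto
                    then have "same ?rs ?js v A v7 A7" using s7 by (rule same_trans) auto
                    then show ?thesis using s8 by (rule same_trans) auto
                  qed
                  have "v8 4 = v 4" "v8 5 = v 5" "A7 0 = A 0"
                    using s1 s2 s3 s4 s5 s6 s7 s8 by (simp_all add: same_def)
                  then have o8: "outrel ys v8 A7" using assms(4) by (simp add: outrel_def)
                  have r8: "v8 3 = r0" using r7 s8 by (simp add: same_def)
                  have w8: "\<forall>x\<in>W. A7 9 x = 0 \<longleftrightarrow> enabled R (avoid r0) x" using pr(2) e7 by simp
                  have d8: "A7 13 r0 = card (addable r0 r0)" using c7 assms(3) by simp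
                  show "wp emit Q' (t6 + M + K) v8 A7"
                  proof (rule wp_emit[OF st8 r8 assms(3) o8 w8 d8])
                    fix v9 A9 ys' t9
                    assume s9: "same {4, 5, 6} {0} v8 A7 v9 A9" and o9: "outrel ys' v9 A9"
                      and t9: "t9 \<le> t6 + M + K + M"
                      and p9: "if v8 10 = 0 then ys' = ys else \<exists>zs. ys' = ys @ [(zs, H r0)] \<and>
                        set zs = addable r0 r0 \<and> length zs \<le> B (Suc r0) - B r0"
                    show "Q' t9 v9 A9"
                    proof (rule Q')
                      show "same ?rs ?js v A v9 A9" using sa s9 by (rule same_trans) auto
                      show "if good Q R (ES r0, H r0) then \<exists>zs. ys' = ys @ [(zs, H r0)] \<and>
                         (set zs, H r0) = reduct Q R (ES r0, H r0) \<and> length zs \<le> B (Suc r0) - B r0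
                        else ys' = ys"
                        using p9 unfolding g reduct_eq by (auto split: if_splits)
                      show "t9 \<le> t + (7 * M + 4 * K)" using t9 t6 t4 by linarith
                    qed (rule o9)
                  qed
                qed
              qed
            qed
          qed
        qed
      qed
    qed
  qed
qed

text \<open>The same critical rule may be written several times, which leaves the set unchanged.
  Each input rule yields at most one output rule, with a body no longer than its own; the resulting
  length bound later keeps the copied output below the arrays.\<close>

lemma wp_rounds:
  assumes "static v A"
    and "\<And>v' A' ys t'. outrel ys v' A' \<Longrightarrow> v' 0 = v 0 \<Longrightarrow>
      (\<lambda>(xs, q). (set xs, q)) ` set ys = critical_rules Q (AR Q R) \<Longrightarrow>
      length (enc_out ys) \<le> M + 2 * K \<Longrightarrow> t' \<le> t + K * (7 * M + 4 * K + 1) \<Longrightarrow> Q' t' v' A'"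
  shows "wp rounds Q' t v A"
proof -
  \<comment> \<open>The intervals are disjoint fibres of \<open>RU\<close> over the
    occurrences.\<close>
  have B_mono: "(\<Sum>r<i. B (Suc r) - B r) \<le> M" if "i \<le> K" for i
  proof -
    have "(\<Sum>r<i. B (Suc r) - B r) = (\<Sum>r<i. card {k \<in> {1..M}. RU k = r})"
      using that B by (intro sum.cong) auto
    also have "\<dots> = card (\<Union>r<i. {k \<in> {1..M}. RU k = r})"
      by (rule card_UN_disjoint[symmetric]) auto
    also have "\<dots> \<le> card {1..M}" by (rule card_mono) auto
    finally show ?thesis by simp
  qed
  have RK: "R = (\<lambda>r. (ES r, H r)) ` {..<K}" by (simp add: R_def)
  have on: "\<forall>r\<in>R. rule_on Q r"
  proof
    fix r assume "r \<in> R"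
    then obtain i where i: "i < K" "r = (ES i, H i)" unfolding RK by auto
    then show "rule_on Q r" using ES_sub[OF i(1)] OE_Q H_Q by (auto simp: rule_on_def)
  qed
  let ?T = "7 * M + 4 * K + 1"
  let ?S = "\<lambda>i. reduct Q R ` {r \<in> (\<lambda>r. (ES r, H r)) ` {..<i}. good Q R r}"
  have S: "?S (Suc i) = (if good Q R (ES i, H i) then insert (reduct Q R (ES i, H i)) (?S i) else ?S i)" for i
    unfolding lessThan_Suc by auto
  show ?thesis unfolding rounds_def wp_Seq wp_Assign
  apply (rule wp_For[where hi = K and I = "\<lambda>i t' v' A'. t' \<le> t + i * ?T \<and> v' 3 = i \<and> static v' A' \<and>
     v' 0 = v 0 \<and> (\<exists>ys. outrel ys v' A' \<and> (\<lambda>(xs, q). (set xs, q)) ` set ys = ?S i \<and>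
       length (enc_out ys) \<le> (\<Sum>r<i. B (Suc r) - B r) + 2 * i)"])
  subgoal using assms(1) by (auto simp: static_def outrel_def enc_out_def intro!: exI[of _ "[]"])
  subgoal by simp
  subgoal by (auto simp: static_def)
  subgoal premises p for i t' v' A'
  proof -
    obtain ys where ys: "outrel ys v' A'" "(\<lambda>(xs, q). (set xs, q)) ` set ys = ?S i"
       "length (enc_out ys) \<le> (\<Sum>r<i. B (Suc r) - B r) + 2 * i"
      and p': "t' \<le> t + i * ?T" "v' 3 = i" "static v' A'" "v' 0 = v 0" using p by blast
    show ?thesis
    proof (rule wp_round[OF p'(3,2) p(2) ys(1)])
      fix v2 A2 ys' t2
      assume s: "same {4, 5, 6, 7, 8, 9, 10, 11, 12} {0, 9, 10, 11, 12, 13} v' A' v2 A2"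
        and ou: "outrel ys' v2 A2" and t2: "t2 \<le> t' + (7 * M + 4 * K)"
        and g: "if good Q R (ES i, H i) then \<exists>zs. ys' = ys @ [(zs, H i)] \<and>
         (set zs, H i) = reduct Q R (ES i, H i) \<and> length zs \<le> B (Suc i) - B i else ys' = ys"
      let ?v = "v2(3 := Suc (v2 3))"
      have "static v2 A2" using p'(3) s by (rule static_same) auto
      then have "static ?v A2" by (simp add: static_def)
      moreover have "?v 3 = Suc i" "?v 0 = v 0" using s p' by (auto simp: same_def)
      moreover have "Suc t2 \<le> t + Suc i * ?T" using t2 p'(1) by simp
      moreover have "outrel ys' ?v A2" using ou by (simp add: outrel_def)
      moreover have "(\<lambda>(xs, q). (set xs, q)) ` set ys' = ?S (Suc i)"
        using g ys(2) unfolding S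
        by (cases "good Q R (ES i, H i)") (clarsimp simp only: if_True set_append image_Un, simp, simp)
      moreover have "length (enc_out ys') \<le> (\<Sum>r<Suc i. B (Suc r) - B r) + 2 * Suc i"
        using g ys(3) by (auto simp: enc_out_snoc split: if_splits)
      ultimately show "Suc t2 \<le> t + Suc i * ?T \<and> ?v 3 = Suc i \<and> static ?v A2 \<and>
         ?v 0 = v 0 \<and> (\<exists>ys. outrel ys ?v A2 \<and> (\<lambda>(xs, q). (set xs, q)) ` set ys = ?S (Suc i) \<and>
         length (enc_out ys) \<le> (\<Sum>r<Suc i. B (Suc r) - B r) + 2 * Suc i)" by blast
    qed
  qed
  subgoal premises p for t' v' A'
  proof -
    obtain ys where ys: "outrel ys v' A'" "(\<lambda>(xs, q). (set xs, q)) ` set ys = ?S K"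
       "length (enc_out ys) \<le> (\<Sum>r<K. B (Suc r) - B r) + 2 * K"
      and p': "t' \<le> t + K * ?T" "v' 0 = v 0" using p by blast
    have "?S K = critical_rules Q (AR Q R)"
      unfolding critical_rules_AR[OF finQ on] unfolding RK ..
    then show ?thesis using assms(2)[OF ys(1) p'(2)] ys B_mono[of K] p' by simp
  qed
  done
qed

end

section \<open>Parsing the input\<close>

definition len :: "(nat list \<times> nat) list \<Rightarrow> nat \<Rightarrow> nat" where
  "len rs r = length (fst (rs ! r))"

text \<open>Address of rule \<open>r\<close> in the input; the 2 skips \<open>n\<close> and the
  number of rules. At \<open>length rs\<close> it is the end of the input.\<close>

definition off :: "(nat list \<times> nat) list \<Rightarrow> nat \<Rightarrow> nat" where
  "off rs r = 2 + (\<Sum>j<r. 2 + len rs j)"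

text \<open>Number of the first occurrence of rule \<open>r\<close>, counted from 1 because 0
  terminates the linked lists.\<close>

definition pre :: "(nat list \<times> nat) list \<Rightarrow> nat \<Rightarrow> nat" where
  "pre rs r = 1 + (\<Sum>j<r. len rs j)"

lemma off_0 [simp]: "off rs 0 = 2" by (simp add: off_def)

lemma off_Suc [simp]: "off rs (Suc r) = off rs r + 2 + len rs r" by (simp add: off_def)

lemma pre_0 [simp]: "pre rs 0 = 1" by (simp add: pre_def)

lemma pre_Suc [simp]: "pre rs (Suc r) = pre rs r + len rs r" by (simp add: pre_def)

lemma off_pre: "off rs r = 2 * r + 1 + pre rs r"
  by (induction r) auto

lemma pre_mono: "i \<le> j \<Longrightarrow> pre rs i \<le> pre rs j"
  unfolding pre_def by (auto intro: sum_mono2)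

lemma off_mono: "i \<le> j \<Longrightarrow> off rs i \<le> off rs j"
  using pre_mono[of i j rs] by (simp add: off_pre)

lemma pre_Suc_le: "i < j \<Longrightarrow> pre rs i + len rs i \<le> pre rs j"
  using pre_mono[of "Suc i" j rs] by simp

lemma pre_pos: "1 \<le> pre rs r" by (simp add: pre_def)

lemma pre_find: "1 \<le> k \<Longrightarrow> k < pre rs r \<Longrightarrow> \<exists>i<r. \<exists>j<len rs i. k = pre rs i + j"
proof (induction r)
  case (Suc r)
  show ?case
  proof (cases "k < pre rs r")
    case True
    then show ?thesis using Suc by (meson less_SucI)
  next
    case False
    then have "k - pre rs r < len rs r" "k = pre rs r + (k - pre rs r)" using Suc.prems by auto
    then show ?thesis by blast
  qed
qed simp

text \<open>The words of \<open>enc_out\<close> lack the two header cells, so address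
  \<open>x\<close> of the input corresponds to index \<open>x - 2\<close>.\<close>

lemma enc_out_words:
  "length (enc_out rs) + 2 = off rs (length rs) \<and> (\<forall>r<length rs.
     (2 \<le> off rs r \<and> off rs r + 2 + len rs r \<le> off rs (length rs)) \<and>
     enc_out rs ! (off rs r - 2) = snd (rs ! r) \<and> enc_out rs ! (off rs r - 1) = len rs r \<and>
     (\<forall>j<len rs r. enc_out rs ! (off rs r + j) = fst (rs ! r) ! j))"
proof (induction rs rule: rev_induct)
  case Nil
  then show ?case by (simp add: enc_out_def)
next
  case (snoc x rs)
  obtain xs q where x: "x = (xs, q)" by (cases x)
  have l: "len (rs @ [x]) r = (if r < length rs then len rs r else length xs)" if "r \<le> length rs" for r
    using that by (auto simp: len_def nth_append x)
  have o: "off (rs @ [x]) r = off rs r" if "r \<le> length rs" for r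
    unfolding off_def using that l by (auto intro!: sum.cong)
  have IH: "length (enc_out rs) + 2 = off rs (length rs)" using snoc by blast
  have L: "length (enc_out (rs @ [x])) + 2 = off (rs @ [x]) (length (rs @ [x]))"
    using IH o[of "length rs"] l[of "length rs"] by (simp add: x enc_out_snoc)
  have "(2 \<le> off (rs @ [x]) r \<and> off (rs @ [x]) r + 2 + len (rs @ [x]) r \<le> off (rs @ [x]) (length (rs @ [x]))) \<and>
     enc_out (rs @ [x]) ! (off (rs @ [x]) r - 2) = snd ((rs @ [x]) ! r) \<and>
     enc_out (rs @ [x]) ! (off (rs @ [x]) r - 1) = len (rs @ [x]) r \<and>
     (\<forall>j<len (rs @ [x]) r. enc_out (rs @ [x]) ! (off (rs @ [x]) r + j) = fst ((rs @ [x]) ! r) ! j)"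
    if r: "r < length (rs @ [x])" for r
  proof (cases "r < length rs")
    case True
    then have "off rs r + 2 + len rs r \<le> length (enc_out rs) + 2" "2 \<le> off rs r"
      using snoc IH by auto
    then show ?thesis using True snoc o[of r] l[of r] o[of "length rs"]
      by (auto simp: x enc_out_snoc nth_append IH)
  next
    case False
    then have "r = length rs" using r by simp
    moreover have "off rs (length rs) - Suc 0 = Suc (length (enc_out rs))" using IH by simp
    ultimately show ?thesis using o[of "length rs"] l[of "length rs"] L unfolding x enc_out_snoc
      by (auto simp: nth_append simp flip: IH)
  qed
  then show ?case using L by blast
qed

text \<open>Undoes the packing of cell 3: halving by repeated subtraction costs one tick per element
  of the body of rule 0 and leaves the parity in register 13. Register 15 receives the end of the
  input, since the base address lies 36 above the place where the scan stopped, and the scan may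
  stop one empty rule early.\<close>

definition decode :: com where
  "decode = Seq (Assign 13 (Rd 1 (N 3))) (Seq (Assign 14 (N 0)) (Seq
     (While (Minus (V 13) (N 1)) (Seq (Assign 13 (Minus (V 13) (N 2))) (Assign 14 (Plus (V 14) (N 1)))))
     (Seq (Write 1 (N 3) (V 14))
       (Assign 15 (Plus (Minus (V 0) (N 36)) (Plus (V 13) (V 13)))))))"

lemma wp_decode:
  assumes "A 1 3 = 2 * s + d" "d \<le> 1"
    and "\<And>t' v'. v' 15 = v 0 - 36 + 2 * d \<Longrightarrow> v' 0 = v 0 \<Longrightarrow> t' \<le> t + s \<Longrightarrow>
       Q t' v' (A(1 := (A 1)(3 := s)))"
  shows "wp decode Q t v A"
  unfolding decode_def wp_Seq wp_Assign
  apply (rule wp_While[where T = "t + s" and I = "\<lambda>t' v' A'. A' = A \<and> v' 0 = v 0 \<and> t \<le> t' \<and>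
    t' \<le> t + s \<and> v' 14 = t' - t \<and> v' 13 + 2 * v' 14 = 2 * s + d"])
  subgoal using assms by simp
  subgoal by simp
  subgoal using assms(2) by auto
  subgoal premises p for t' v' A'
  proof -
    have "v' 13 \<le> 1" "v' 13 + 2 * v' 14 = 2 * s + d" using p by simp_all
    then have "v' 14 = s \<and> v' 13 = d" using assms(2) by presburger
    then show ?thesis using p assms(3)[of _ t'] by simp
  qed
  done

definition parse_elem :: com where
  "parse_elem = Seq (Assign 8 (Rd 1 (V 16))) (Seq (Write 4 (V 6) (V 8)) (Seq (Write 5 (V 6) (V 7))
     (Seq (Write 6 (V 6) (Rd 7 (V 8))) (Seq (Write 7 (V 8) (V 6))
     (Seq (If (neq (V 8) (Rd 2 (V 7))) Skip (Write 8 (V 7) (N 1))) (Assign 6 (Plus (V 6) (N 1))))))))"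

text \<open>The number of rules in cell 1 was overwritten by the scan. The loop therefore stops at
  the end address in register 15, and the number is recovered by counting in register 7.\<close>

definition parse :: com where
  "parse = Seq (Assign 16 (N 2)) (Seq (Assign 7 (N 0)) (Seq (Assign 6 (N 1)) (Seq
     (While (Minus (V 15) (V 16))
       (Seq (Write 2 (V 7) (Rd 1 (V 16))) (Seq (Write 3 (V 7) (V 6))
       (Seq (Assign 17 (Plus (Plus (V 16) (N 2)) (Rd 1 (Plus (V 16) (N 1)))))
       (Seq (Assign 16 (Plus (V 16) (N 2))) (Seq (For 16 (V 17) parse_elem)
       (Assign 7 (Plus (V 7) (N 1)))))))))
     (Seq (Write 3 (V 7) (V 6)) (Seq (Assign 1 (V 7)) (Assign 2 (V 6)))))))"

text \<open>Occurrences are numbered from 1, and 0 stands for a missing one.\<close>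

definition links :: "nat \<Rightarrow> arrs \<Rightarrow> bool" where
  "links k A \<longleftrightarrow> (\<forall>i. 1 \<le> i \<and> i < k \<longrightarrow> (A 6 i = 0 \<or> 1 \<le> A 6 i \<and> A 4 (A 6 i) = A 4 i) \<and> A 6 i < i \<and>
       (\<forall>j. A 6 i < j \<and> j < i \<longrightarrow> A 4 j \<noteq> A 4 i)) \<and>
     (\<forall>x. (A 7 x = 0 \<or> 1 \<le> A 7 x \<and> A 7 x < k \<and> A 4 (A 7 x) = x) \<and> A 7 x < k \<and>
       (\<forall>i. A 7 x < i \<and> i < k \<longrightarrow> A 4 i \<noteq> x))"

lemma links_cong: "links k A \<Longrightarrow> A' 4 = A 4 \<Longrightarrow> A' 6 = A 6 \<Longrightarrow> A' 7 = A 7 \<Longrightarrow> links k A'"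
  unfolding links_def by metis

text \<open>The new occurrence becomes the head of the list of \<open>x\<close> and points to the
  former head. The update of array 5 is carried along to match the state reached by
  \<open>parse_elem\<close>.\<close>

lemma links_extend:
  assumes "links k A" "1 \<le> k"
  shows "links (Suc k) (A(4 := (A 4)(k := x), 5 := f, 6 := (A 6)(k := A 7 x), 7 := (A 7)(x := k)))"
proof -
  let ?A = "A(4 := (A 4)(k := x), 5 := f, 6 := (A 6)(k := A 7 x), 7 := (A 7)(x := k))"
  have a: "(A 6 i = 0 \<or> 1 \<le> A 6 i \<and> A 4 (A 6 i) = A 4 i) \<and> A 6 i < i \<and>
       (\<forall>j. A 6 i < j \<and> j < i \<longrightarrow> A 4 j \<noteq> A 4 i)" if "1 \<le> i" "i < k" for i
    using assms(1) that unfolding links_def by blast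
  have b: "(A 7 x = 0 \<or> 1 \<le> A 7 x \<and> A 7 x < k \<and> A 4 (A 7 x) = x) \<and> A 7 x < k \<and>
       (\<forall>i. A 7 x < i \<and> i < k \<longrightarrow> A 4 i \<noteq> x)" for x
    using assms(1) unfolding links_def by blast
  have "(?A 6 i = 0 \<or> 1 \<le> ?A 6 i \<and> ?A 4 (?A 6 i) = ?A 4 i) \<and> ?A 6 i < i \<and>
       (\<forall>j. ?A 6 i < j \<and> j < i \<longrightarrow> ?A 4 j \<noteq> ?A 4 i)" if "1 \<le> i" "i < Suc k" for i
  proof (cases "i = k")
    case True
    then show ?thesis using b[of x] by auto
  next
    case False
    then show ?thesis using that a[of i] by auto
  qed
  moreover have "(?A 7 y = 0 \<or> 1 \<le> ?A 7 y \<and> ?A 7 y < Suc k \<and> ?A 4 (?A 7 y) = y) \<and> ?A 7 y < Suc k \<and>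
       (\<forall>i. ?A 7 y < i \<and> i < Suc k \<longrightarrow> ?A 4 i \<noteq> y)" for y
    using b[of y] assms(2) by (cases "y = x") auto
  ultimately show ?thesis unfolding links_def by blast
qed

definition parsed :: "(nat list \<times> nat) list \<Rightarrow> nat \<Rightarrow> arrs \<Rightarrow> bool" where
  "parsed rs r A \<longleftrightarrow> (\<forall>i<r. A 2 i = snd (rs ! i) \<and> A 3 i = pre rs i \<and>
     A 8 i = of_bool (snd (rs ! i) \<in> set (fst (rs ! i))) \<and>
     (\<forall>j<len rs i. A 4 (pre rs i + j) = fst (rs ! i) ! j \<and> A 5 (pre rs i + j) = i))"

definition words :: "(nat list \<times> nat) list \<Rightarrow> (nat \<Rightarrow> nat) \<Rightarrow> bool" where
  "words rs w \<longleftrightarrow> (\<forall>r<length rs. w (off rs r) = snd (rs ! r) \<and> w (off rs r + 1) = len rs r \<and>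
     (\<forall>j<len rs r. w (off rs r + 2 + j) = fst (rs ! r) ! j))"

text \<open>Array 8 is written only when the head is met in the body, so the default 0 of fresh
  memory has to be part of the hypotheses and of the invariant.\<close>

lemma wp_parse_rule:
  assumes r: "r < length rs" and w: "words rs (A 1)" and v: "v 16 = off rs r + 2" "v 7 = r" "v 6 = pre rs r"
      "v 15 = e" "v 17 = off rs r + 2 + len rs r"
    and A: "parsed rs r A" "A 2 r = snd (rs ! r)" "A 3 r = pre rs r" "\<forall>i\<ge>r. A 8 i = 0" "links (pre rs r) A"
    and Q: "\<And>v' A'. v' 16 = off rs (Suc r) \<Longrightarrow> v' 7 = r \<Longrightarrow> v' 6 = pre rs (Suc r) \<Longrightarrow> v' 15 = e \<Longrightarrow>
      v' 0 = v 0 \<Longrightarrow> A' 1 = A 1 \<Longrightarrow>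
      parsed rs (Suc r) A' \<Longrightarrow> \<forall>i\<ge>Suc r. A' 8 i = 0 \<Longrightarrow> links (pre rs (Suc r)) A' \<Longrightarrow> Q (t + len rs r) v' A'"
  shows "wp (For 16 (V 17) parse_elem) Q t v A"
proof (rule wp_For[where hi = "off rs r + 2 + len rs r" and I = "\<lambda>i t' v' A'. off rs r + 2 \<le> i \<and>
    i \<le> off rs r + 2 + len rs r \<and>
    v' 16 = i \<and> v' 7 = r \<and> v' 6 + (off rs r + 2) = pre rs r + i \<and> v' 15 = e \<and> v' 17 = off rs r + 2 + len rs r \<and>
    v' 0 = v 0 \<and>
    t' + (off rs r + 2) = t + i \<and> A' 1 = A 1 \<and> parsed rs r A' \<and> A' 2 r = snd (rs ! r) \<and> A' 3 r = pre rs r \<and>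
    (\<forall>i\<ge>Suc r. A' 8 i = 0) \<and> links (v' 6) A' \<and>
    A' 8 r = of_bool (snd (rs ! r) \<in> set (take (i - (off rs r + 2)) (fst (rs ! r)))) \<and>
    (\<forall>j<i - (off rs r + 2). A' 4 (pre rs r + j) = fst (rs ! r) ! j \<and> A' 5 (pre rs r + j) = r)"])
  fix i t' :: nat and v' :: mem and A' :: arrs
  assume p: "off rs r + 2 \<le> i \<and> i \<le> off rs r + 2 + len rs r \<and>
    v' 16 = i \<and> v' 7 = r \<and> v' 6 + (off rs r + 2) = pre rs r + i \<and> v' 15 = e \<and> v' 17 = off rs r + 2 + len rs r \<and>
    v' 0 = v 0 \<and>
    t' + (off rs r + 2) = t + i \<and> A' 1 = A 1 \<and> parsed rs r A' \<and> A' 2 r = snd (rs ! r) \<and> A' 3 r = pre rs r \<and>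
    (\<forall>i\<ge>Suc r. A' 8 i = 0) \<and> links (v' 6) A' \<and>
    A' 8 r = of_bool (snd (rs ! r) \<in> set (take (i - (off rs r + 2)) (fst (rs ! r)))) \<and>
    (\<forall>j<i - (off rs r + 2). A' 4 (pre rs r + j) = fst (rs ! r) ! j \<and> A' 5 (pre rs r + j) = r)"
    and lt: "i < off rs r + 2 + len rs r"
  define j where "j = i - (off rs r + 2)"
  have j: "i = off rs r + 2 + j" "j < len rs r" "v' 6 = pre rs r + j" using p lt unfolding j_def by auto
  define x where "x = fst (rs ! r) ! j"
  have "A 1 (off rs r + 2 + j) = x" using w r j(2) unfolding words_def x_def by blast
  then have x: "A' 1 i = x" using p j(1) by simp
  have tk: "take (Suc j) (fst (rs ! r)) = take j (fst (rs ! r)) @ [x]"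
    using j(2) unfolding x_def len_def by (simp add: take_Suc_conv_app_nth)
  let ?k = "pre rs r + j"
  let ?A = "A'(4 := (A' 4)(?k := x), 5 := (A' 5)(?k := r), 6 := (A' 6)(?k := A' 7 x), 7 := (A' 7)(x := ?k))"
  let ?A2 = "if x = snd (rs ! r) then ?A(8 := (?A 8)(r := 1)) else ?A"
  have lk: "links (Suc ?k) ?A" using p j(3) pre_pos[of rs r] by (intro links_extend) auto
  then have lk2: "links (Suc ?k) ?A2" by (rule links_cong) simp_all
  have pa: "parsed rs r ?A2"
  proof -
    have "pre rs i + j' \<noteq> ?k" if "i < r" "j' < len rs i" for i j'
      using pre_Suc_le[OF that(1), of rs] that(2) by linarith
    then show ?thesis using p unfolding parsed_def by auto
  qed
  have ar: "?A2 8 r = of_bool (snd (rs ! r) \<in> set (take (Suc j) (fst (rs ! r))))"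
    "\<forall>j'<Suc j. ?A2 4 (pre rs r + j') = fst (rs ! r) ! j' \<and> ?A2 5 (pre rs r + j') = r"
    "\<forall>i\<ge>Suc r. ?A2 8 i = 0" "?A2 1 = A 1" "?A2 2 r = snd (rs ! r)" "?A2 3 r = pre rs r"
    using p unfolding tk j_def[symmetric] by (auto simp: x_def less_Suc_eq)
  have sj: "Suc i - (off rs r + 2) = Suc j" using j by simp
  let ?v = "v'(8 := x, 6 := Suc ?k)"
  have eq: "wp parse_elem QQ t' v' A' \<longleftrightarrow> QQ t' ?v ?A2" for QQ
    unfolding parse_elem_def using p x j(3) by auto
  show "wp parse_elem
     (\<lambda>t' v' A'. off rs r + 2 \<le> Suc i \<and> Suc i \<le> off rs r + 2 + len rs r \<and>
      (v'(16 := Suc (v' 16))) 16 = Suc i \<and> (v'(16 := Suc (v' 16))) 7 = r \<and>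
      (v'(16 := Suc (v' 16))) 6 + (off rs r + 2) = pre rs r + Suc i \<and>
      (v'(16 := Suc (v' 16))) 15 = e \<and> (v'(16 := Suc (v' 16))) 17 = off rs r + 2 + len rs r \<and>
      (v'(16 := Suc (v' 16))) 0 = v 0 \<and>
      Suc t' + (off rs r + 2) = t + Suc i \<and> A' 1 = A 1 \<and> parsed rs r A' \<and> A' 2 r = snd (rs ! r) \<and>
      A' 3 r = pre rs r \<and> (\<forall>i\<ge>Suc r. A' 8 i = 0) \<and> links ((v'(16 := Suc (v' 16))) 6) A' \<and>
      A' 8 r = of_bool (snd (rs ! r) \<in> set (take (Suc i - (off rs r + 2)) (fst (rs ! r)))) \<and>
      (\<forall>j<Suc i - (off rs r + 2). A' 4 (pre rs r + j) = fst (rs ! r) ! j \<and> A' 5 (pre rs r + j) = r))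
     t' v' A'"
    unfolding eq sj using ar pa lk2 p lt j by (intro conjI) (assumption | simp)+
next
  fix t' :: nat and v' :: mem and A' :: arrs
  assume p: "off rs r + 2 \<le> off rs r + 2 + len rs r \<and> off rs r + 2 + len rs r \<le> off rs r + 2 + len rs r \<and>
    v' 16 = off rs r + 2 + len rs r \<and> v' 7 = r \<and>
    v' 6 + (off rs r + 2) = pre rs r + (off rs r + 2 + len rs r) \<and> v' 15 = e \<and>
    v' 17 = off rs r + 2 + len rs r \<and> v' 0 = v 0 \<and>
    t' + (off rs r + 2) = t + (off rs r + 2 + len rs r) \<and> A' 1 = A 1 \<and> parsed rs r A' \<and>
    A' 2 r = snd (rs ! r) \<and> A' 3 r = pre rs r \<and> (\<forall>i\<ge>Suc r. A' 8 i = 0) \<and> links (v' 6) A' \<and>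
    A' 8 r = of_bool (snd (rs ! r) \<in> set (take (off rs r + 2 + len rs r - (off rs r + 2)) (fst (rs ! r)))) \<and>
    (\<forall>j<off rs r + 2 + len rs r - (off rs r + 2).
       A' 4 (pre rs r + j) = fst (rs ! r) ! j \<and> A' 5 (pre rs r + j) = r)"
  have "t' = t + len rs r" "v' 6 = pre rs (Suc r)" using p by auto
  moreover have "parsed rs (Suc r) A'"
    using p unfolding parsed_def by (auto simp: less_Suc_eq len_def)
  ultimately show "Q t' v' A'" using Q[of v' A'] p by auto
qed (use v A in \<open>auto\<close>)

lemma wp_parse:
  assumes w: "words rs (A 1)" and v: "v 15 = off rs (length rs)" and A: "\<forall>i. A 8 i = 0" "\<forall>x. A 7 x = 0"
    and Q: "\<And>v' A'. v' 1 = length rs \<Longrightarrow> v' 2 = pre rs (length rs) \<Longrightarrow> v' 0 = v 0 \<Longrightarrow>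
      parsed rs (length rs) A' \<Longrightarrow> A' 3 (length rs) = pre rs (length rs) \<Longrightarrow>
      links (pre rs (length rs)) A' \<Longrightarrow> Q (t + length rs + (pre rs (length rs) - 1)) v' A'"
  shows "wp parse Q t v A"
  unfolding parse_def wp_Seq wp_Assign
proof (rule wp_While[where T = "t + length rs + (pre rs (length rs) - 1)" and
    I = "\<lambda>t' v' A'. \<exists>r\<le>length rs. v' 16 = off rs r \<and> v' 7 = r \<and> v' 6 = pre rs r \<and> v' 15 = off rs (length rs) \<and>
      v' 0 = v 0 \<and> A' 1 = A 1 \<and> t' = t + r + (pre rs r - 1) \<and> parsed rs r A' \<and> (\<forall>i\<ge>r. A' 8 i = 0) \<and>
      links (pre rs r) A'"])
  fix t' :: nat and v' :: mem and A' :: arrs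
  assume "\<exists>r\<le>length rs. v' 16 = off rs r \<and> v' 7 = r \<and> v' 6 = pre rs r \<and> v' 15 = off rs (length rs) \<and>
      v' 0 = v 0 \<and> A' 1 = A 1 \<and> t' = t + r + (pre rs r - 1) \<and> parsed rs r A' \<and> (\<forall>i\<ge>r. A' 8 i = 0) \<and>
      links (pre rs r) A'"
  then obtain r where r: "r \<le> length rs" "t' = t + r + (pre rs r - 1)" by blast
  then show "t' \<le> t + length rs + (pre rs (length rs) - 1)"
    using pre_mono[OF r(1), of rs] by linarith
next
  fix t' :: nat and v' :: mem and A' :: arrs
  assume I: "\<exists>r\<le>length rs. v' 16 = off rs r \<and> v' 7 = r \<and> v' 6 = pre rs r \<and> v' 15 = off rs (length rs) \<and>
      v' 0 = v 0 \<and> A' 1 = A 1 \<and> t' = t + r + (pre rs r - 1) \<and> parsed rs r A' \<and> (\<forall>i\<ge>r. A' 8 i = 0) \<and>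
      links (pre rs r) A'" and nz: "ev (Minus (V 15) (V 16)) v' A' \<noteq> 0"
  then obtain r where r: "r \<le> length rs" "v' 16 = off rs r" "v' 7 = r" "v' 6 = pre rs r"
      "v' 15 = off rs (length rs)" "v' 0 = v 0" "A' 1 = A 1" "t' = t + r + (pre rs r - 1)" "parsed rs r A'"
      "\<forall>i\<ge>r. A' 8 i = 0" "links (pre rs r) A'" by blast
  have rl: "r < length rs" using nz r(1,2,5) by (cases "r = length rs") auto
  have w1: "A 1 (off rs r) = snd (rs ! r)" "A 1 (Suc (off rs r)) = len rs r"
    using w rl unfolding words_def by auto
  let ?A = "A'(2 := (A' 2)(r := snd (rs ! r)), 3 := (A' 3)(r := pre rs r))"
  let ?v = "v'(17 := off rs r + 2 + len rs r, 16 := off rs r + 2)"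
  have "wp (For 16 (V 17) parse_elem) (wp (Assign 7 (Plus (V 7) (N 1))) (\<lambda>t' v' A'.
     \<exists>r\<le>length rs. v' 16 = off rs r \<and> v' 7 = r \<and> v' 6 = pre rs r \<and> v' 15 = off rs (length rs) \<and>
      v' 0 = v 0 \<and> A' 1 = A 1 \<and> Suc t' = t + r + (pre rs r - 1) \<and> parsed rs r A' \<and> (\<forall>i\<ge>r. A' 8 i = 0) \<and>
      links (pre rs r) A')) t' ?v ?A"
  proof (rule wp_parse_rule[OF rl])
    show "parsed rs r ?A" using r(9) unfolding parsed_def by auto
    show "links (pre rs r) ?A" using r(11) by (rule links_cong) simp_all
    fix v2 :: mem and A2 :: arrs
    assume q: "v2 16 = off rs (Suc r)" "v2 7 = r" "v2 6 = pre rs (Suc r)" "v2 15 = off rs (length rs)"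
      "v2 0 = ?v 0" "A2 1 = ?A 1" "parsed rs (Suc r) A2" "\<forall>i\<ge>Suc r. A2 8 i = 0" "links (pre rs (Suc r)) A2"
    show "wp (Assign 7 (Plus (V 7) (N 1))) (\<lambda>t' v' A'.
     \<exists>r\<le>length rs. v' 16 = off rs r \<and> v' 7 = r \<and> v' 6 = pre rs r \<and> v' 15 = off rs (length rs) \<and>
      v' 0 = v 0 \<and> A' 1 = A 1 \<and> Suc t' = t + r + (pre rs r - 1) \<and> parsed rs r A' \<and> (\<forall>i\<ge>r. A' 8 i = 0) \<and>
      links (pre rs r) A') (t' + len rs r) v2 A2"
      unfolding wp_Assign
      using q r rl pre_pos[of rs r] by (intro exI[of _ "Suc r"]) auto
  qed (use w r in auto)
  then show "wp (Seq (Write 2 (V 7) (Rd 1 (V 16))) (Seq (Write 3 (V 7) (V 6))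
       (Seq (Assign 17 (Plus (Plus (V 16) (N 2)) (Rd 1 (Plus (V 16) (N 1)))))
       (Seq (Assign 16 (Plus (V 16) (N 2))) (Seq (For 16 (V 17) parse_elem)
       (Assign 7 (Plus (V 7) (N 1)))))))) (\<lambda>t' v' A'.
     \<exists>r\<le>length rs. v' 16 = off rs r \<and> v' 7 = r \<and> v' 6 = pre rs r \<and> v' 15 = off rs (length rs) \<and>
      v' 0 = v 0 \<and> A' 1 = A 1 \<and> Suc t' = t + r + (pre rs r - 1) \<and> parsed rs r A' \<and> (\<forall>i\<ge>r. A' 8 i = 0) \<and>
      links (pre rs r) A') t' v' A'"
    using r w1 by (simp only: wp_Seq wp_Write wp_Assign ev.simps) (simp add: eval_nat_numeral)
next
  fix t' :: nat and v' :: mem and A' :: arrs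
  assume I: "\<exists>r\<le>length rs. v' 16 = off rs r \<and> v' 7 = r \<and> v' 6 = pre rs r \<and> v' 15 = off rs (length rs) \<and>
      v' 0 = v 0 \<and> A' 1 = A 1 \<and> t' = t + r + (pre rs r - 1) \<and> parsed rs r A' \<and> (\<forall>i\<ge>r. A' 8 i = 0) \<and>
      links (pre rs r) A'" and z: "ev (Minus (V 15) (V 16)) v' A' = 0"
  then obtain r where r: "r \<le> length rs" "v' 16 = off rs r" "v' 7 = r" "v' 6 = pre rs r"
      "v' 15 = off rs (length rs)" "v' 0 = v 0" "A' 1 = A 1" "t' = t + r + (pre rs r - 1)" "parsed rs r A'"
      "\<forall>i\<ge>r. A' 8 i = 0" "links (pre rs r) A'" by blast
  have "off rs (length rs) \<le> off rs r" using z r by simp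
  moreover have "off rs r < off rs (length rs)" if "r < length rs"
    using off_mono[of "Suc r" "length rs" rs] that by simp
  ultimately have rl: "r = length rs" using r(1) by (meson leD le_neq_implies_less)
  \<comment> \<open>A sentinel: \<open>B (Suc r)\<close> must also be defined for the last
    rule.\<close>
  let ?A = "A'(3 := (A' 3)(r := pre rs r))"
  have "Q t' (v'(1 := r, 2 := pre rs r)) ?A"
    unfolding r(8) rl
  proof (rule Q)
    show "parsed rs (length rs) (A'(3 := (A' 3)(length rs := pre rs (length rs))))"
      using r(9) unfolding rl parsed_def by auto
    show "links (pre rs (length rs)) (A'(3 := (A' 3)(length rs := pre rs (length rs))))"
      using r(11) unfolding rl by (rule links_cong) simp_all
  qed (use r rl in auto)
  then show "wp (Write 3 (V 7) (V 6)) (\<lambda>t v A. Q t (v(1 := ev (V 7) v A,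
      2 := ev (V 6) (v(1 := ev (V 7) v A)) A)) A) t' v' A'"
    using r by simp
qed (use v A in \<open>auto intro!: exI[of _ 0] simp: parsed_def links_def\<close>)

lemma parsed_inst:
  assumes "valid_input n rs" "parsed rs (length rs) A" "A 3 (length rs) = pre rs (length rs)"
    "links (pre rs (length rs)) A"
  defines "M \<equiv> pre rs (length rs) - 1"
  shows "inst (length rs) M {0..<n} (A 2) (A 3) (A 4) (A 5) (A 6) (A 7) (A 8)"
    and "(\<lambda>r. (A 4 ` {A 3 r..<A 3 (Suc r)}, A 2 r)) ` {..<length rs} = rules_of rs"
proof -
  let ?K = "length rs"
  have M: "Suc M = pre rs ?K" using pre_pos[of rs ?K] unfolding M_def by simp
  have r: "A 2 i = snd (rs ! i)" "A 8 i = of_bool (snd (rs ! i) \<in> set (fst (rs ! i)))"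
    "j < len rs i \<Longrightarrow> A 4 (pre rs i + j) = fst (rs ! i) ! j" "j < len rs i \<Longrightarrow> A 5 (pre rs i + j) = i"
    if "i < ?K" for i j
    using assms(2) that unfolding parsed_def by auto
  have b: "A 3 i = pre rs i" if "i \<le> ?K" for i
    using assms(2,3) that unfolding parsed_def by (cases "i = ?K") auto
  have ivl: "{A 3 i..<A 3 (Suc i)} = (\<lambda>j. pre rs i + j) ` {..<len rs i}" if "i < ?K" for i
  proof -
    have "{A 3 i..<A 3 (Suc i)} = {pre rs i..<pre rs i + len rs i}" using b[of i] b[of "Suc i"] that by simp
    also have "\<dots> = (\<lambda>j. pre rs i + j) ` {..<len rs i}"
      by (simp add: lessThan_atLeast0 add.commute)
    finally show ?thesis .
  qed
  have ES: "A 4 ` {A 3 i..<A 3 (Suc i)} = set (fst (rs ! i))" if "i < ?K" for i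
  proof -
    have "A 4 ` {A 3 i..<A 3 (Suc i)} = (\<lambda>j. fst (rs ! i) ! j) ` {..<len rs i}"
      unfolding ivl[OF that] image_image using r(3)[OF that] by (intro image_cong) auto
    then show ?thesis by (auto simp: len_def in_set_conv_nth image_iff)
  qed
  have v: "distinct (fst (rs ! i))" "set (fst (rs ! i)) \<subseteq> {0..<n}" "snd (rs ! i) < n" if "i < ?K" for i
    using assms(1) that unfolding valid_input_def by (auto simp: case_prod_unfold dest: nth_mem)
  have find: "\<exists>i<?K. \<exists>j<len rs i. k = pre rs i + j" if "k \<in> {1..M}" for k
    using pre_find[of k rs ?K] that M by auto
  have bnd: "pre rs i + j \<in> {1..M}" if "i < ?K" "j < len rs i" for i j
    using pre_Suc_le[OF that(1), of rs] that(2) M pre_pos[of rs i] by auto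
  show "inst ?K M {0..<n} (A 2) (A 3) (A 4) (A 5) (A 6) (A 7) (A 8)"
  proof
    fix k assume "k \<in> {1..M}"
    then show "A 5 k < ?K" using find r(4) by metis
  next
    fix i assume i: "i < ?K"
    show "{k \<in> {1..M}. A 5 k = i} = {A 3 i..<A 3 (Suc i)}"
    proof (intro equalityI subsetI)
      fix k assume k: "k \<in> {k \<in> {1..M}. A 5 k = i}"
      then obtain i' j where "i' < ?K" "j < len rs i'" "k = pre rs i' + j" using find by blast
      then show "k \<in> {A 3 i..<A 3 (Suc i)}" using k r(4)[of i' j] ivl[OF i] by auto
    next
      fix k assume "k \<in> {A 3 i..<A 3 (Suc i)}"
      then show "k \<in> {k \<in> {1..M}. A 5 k = i}" using ivl[OF i] bnd[OF i] r(4)[OF i] by auto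
    qed
    show "A 3 i \<le> A 3 (Suc i)" using b[of i] b[of "Suc i"] i by simp
    show "inj_on (A 4) {A 3 i..<A 3 (Suc i)}"
    proof (rule inj_onI)
      fix x y assume "x \<in> {A 3 i..<A 3 (Suc i)}" "y \<in> {A 3 i..<A 3 (Suc i)}" "A 4 x = A 4 y"
      then obtain a c where "x = pre rs i + a" "y = pre rs i + c" "a < len rs i" "c < len rs i"
        "fst (rs ! i) ! a = fst (rs ! i) ! c"
        unfolding ivl[OF i] using r(3)[OF i] by auto
      then show "x = y" using v(1)[OF i] by (simp add: nth_eq_iff_index_eq len_def)
    qed
    show "A 8 i = of_bool (A 2 i \<in> A 4 ` {A 3 i..<A 3 (Suc i)})"
      unfolding ES[OF i] using r(1,2)[OF i] by simp
  next
    show "A 4 ` {1..M} \<subseteq> {0..<n}"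
    proof
      fix x assume "x \<in> A 4 ` {1..M}"
      then obtain k where "k \<in> {1..M}" "x = A 4 k" by blast
      moreover obtain i j where "i < ?K" "j < len rs i" "k = pre rs i + j" using find calculation(1) by blast
      ultimately show "x \<in> {0..<n}" using r(3)[of i j] v(2)[of i] by (metis len_def nth_mem subsetD)
    qed
    show "A 2 ` {..<?K} \<subseteq> {0..<n}" using r(1) v(3) by auto
  next
    fix k assume k: "k \<in> {1..M}"
    then have "1 \<le> k \<and> k < pre rs ?K" using M by auto
    then have "(A 6 k = 0 \<or> 1 \<le> A 6 k \<and> A 4 (A 6 k) = A 4 k) \<and> A 6 k < k \<and>
       (\<forall>j. A 6 k < j \<and> j < k \<longrightarrow> A 4 j \<noteq> A 4 k)" using assms(4) unfolding links_def by blast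
    then show "(A 6 k = 0 \<or> A 6 k \<in> {1..M} \<and> A 4 (A 6 k) = A 4 k) \<and> A 6 k < k \<and>
       (\<forall>i. A 6 k < i \<and> i < k \<longrightarrow> A 4 i \<noteq> A 4 k)" using k by auto
  next
    fix x
    have "(A 7 x = 0 \<or> 1 \<le> A 7 x \<and> A 7 x < pre rs ?K \<and> A 4 (A 7 x) = x) \<and> A 7 x < pre rs ?K \<and>
       (\<forall>i. A 7 x < i \<and> i < pre rs ?K \<longrightarrow> A 4 i \<noteq> x)" using assms(4) unfolding links_def by blast
    then show "(A 7 x = 0 \<or> A 7 x \<in> {1..M} \<and> A 4 (A 7 x) = x) \<and>
       (\<forall>i. A 7 x < i \<and> i \<le> M \<longrightarrow> A 4 i \<noteq> x)" using M by auto
  qed simp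
  have "(\<lambda>r. (A 4 ` {A 3 r..<A 3 (Suc r)}, A 2 r)) ` {..<?K} =
      (\<lambda>r. (set (fst (rs ! r)), snd (rs ! r))) ` {..<?K}"
    using ES r(1) by (intro image_cong) auto
  also have "\<dots> = (\<lambda>(xs, q). (set xs, q)) ` (\<lambda>r. rs ! r) ` {..<?K}"
    unfolding image_image by (simp add: case_prod_unfold)
  also have "(\<lambda>r. rs ! r) ` {..<?K} = set rs" by (auto simp: set_conv_nth)
  finally show "(\<lambda>r. (A 4 ` {A 3 r..<A 3 (Suc r)}, A 2 r)) ` {..<?K} = rules_of rs"
    by (simp add: rules_of_def)
qed

definition main :: com where
  "main = Seq decode (Seq parse (Seq rounds (Write 0 (N 0) (V 5))))"

lemma ok_main: "ok main"
  by (simp add: main_def decode_def parse_def parse_elem_def rounds_def round_def reset_elems_def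
      reset_rules_def count_rules_def forbid_def fill_stack_def push_def propagate_def visit_def
      count_enabled_def test_good_def emit_def For_def neq_def)

text \<open>Decoding costs \<open>len rs 0\<close>, at most \<open>M\<close>, and parsing
  \<open>K + M\<close>; the product is the cost of the rounds.\<close>

lemma wp_main:
  assumes "valid_input n rs" "rs \<noteq> []" "d \<le> 1" "A 1 3 = 2 * len rs 0 + d" "v 0 = off rs (length rs) - 2 * d + 36"
    "\<forall>i. A 8 i = 0" "\<forall>x. A 7 x = 0" "words rs ((A 1)(3 := len rs 0))" "2 * d + 2 \<le> off rs (length rs)"
  defines "K \<equiv> length rs" and "M \<equiv> pre rs (length rs) - 1"
  assumes Q: "\<And>v' A' ys t'. v' 0 = v 0 \<Longrightarrow>
      (\<lambda>(xs, q). (set xs, q)) ` set ys = critical_rules {0..<n} (AR {0..<n} (rules_of rs)) \<Longrightarrow>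
      length (enc_out ys) \<le> M + 2 * K \<Longrightarrow> v' 4 = Suc (length (enc_out ys)) \<Longrightarrow>
      \<forall>i < length (enc_out ys). A' 0 (Suc i) = enc_out ys ! i \<Longrightarrow> A' 0 0 = length ys \<Longrightarrow>
      t' \<le> t + (2 * M + K + K * (7 * M + 4 * K + 1)) \<Longrightarrow> Q' t' v' A'"
  shows "wp main Q' t v A"
  unfolding main_def wp_Seq
proof (rule wp_decode[where s = "len rs 0" and d = d])
  fix t1 and v1 :: mem
  assume v1: "v1 15 = v 0 - 36 + 2 * d" "v1 0 = v 0" and t1: "t1 \<le> t + len rs 0"
  show "wp parse (wp rounds (wp (Write 0 (N 0) (V 5)) Q')) t1 v1 (A(1 := (A 1)(3 := len rs 0)))"
  proof (rule wp_parse)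
    fix v2 :: mem and A2 :: arrs
    assume v2: "v2 1 = length rs" "v2 2 = pre rs (length rs)" "v2 0 = v1 0"
      and A2: "parsed rs (length rs) A2" "A2 3 (length rs) = pre rs (length rs)"
        "links (pre rs (length rs)) A2"
    note pi = parsed_inst[OF assms(1) A2]
    interpret inst "length rs" "pre rs (length rs) - 1" "{0..<n}" "A2 2" "A2 3" "A2 4" "A2 5" "A2 6" "A2 7" "A2 8"
      by (rule pi(1))
    have R: "R = rules_of rs" unfolding R_def ES_def by (rule pi(2))
    show "wp rounds (wp (Write 0 (N 0) (V 5)) Q') (t1 + length rs + (pre rs (length rs) - 1)) v2 A2"
    proof (rule wp_rounds)
      show "static v2 A2" unfolding static_def using v2 pre_pos[of rs "length rs"] by simp
      fix v3 :: mem and A3 :: arrs and ys t3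
      assume o: "outrel ys v3 A3" "v3 0 = v2 0"
        "(\<lambda>(xs, q). (set xs, q)) ` set ys = critical_rules {0..<n} (AR {0..<n} R)"
        "length (enc_out ys) \<le> pre rs (length rs) - 1 + 2 * length rs"
        "t3 \<le> t1 + length rs + (pre rs (length rs) - 1) +
          length rs * (7 * (pre rs (length rs) - 1) + 4 * length rs + 1)"
      have "len rs 0 \<le> M"
        using pre_Suc_le[of 0 "length rs" rs] assms(2) unfolding M_def by simp
      then have t3: "t3 \<le> t + (2 * M + K + K * (7 * M + 4 * K + 1))"
        using o(5) t1 unfolding M_def K_def by linarith
      have "Q' t3 v3 (A3(0 := (A3 0)(0 := v3 5)))"
        by (rule Q[OF _ o(3)[unfolded R]]) (use o v1 v2 t3 in \<open>auto simp: outrel_def K_def M_def\<close>)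
      then show "wp (Write 0 (N 0) (V 5)) Q' t3 v3 A3" by simp
    qed
  qed (use assms v1 in auto)
qed (use assms(3,4) in auto)

section \<open>Freeing memory and writing the output\<close>

text \<open>The input occupies all low memory cells, so at the start the only free register is cell 0
  (the size of the ground set, which is not needed).  The number of rules is packed together with
  the length \<open>s\<close> of the first rule into cell 3 as \<open>2 s + k\<close>, which frees cell 1.  These two
  registers suffice to walk over the rules, decrementing the packed counter for each of them, until
  two consecutive pairs of zeros are met.  As the rules are distinct, this happens at the end of the
  input or at a final rule \<open>([], 0)\<close>, and the parity of cell 3 tells these cases apart.  Everything
  beyond the reached address is free memory.\<close>

definition test_zeros :: com0 where
  "test_zeros = Seq0 (Block [LoadI 0 1]) (If0 0 (Block [])
    (Seq0 (Block [Const 0 1, Add 1 1 0, LoadI 0 1]) (If0 0 (Block [Const 0 1, Sub 1 1 0])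
    (Seq0 (Block [Const 0 1, Add 1 1 0, LoadI 0 1]) (If0 0 (Block [Const 0 2, Sub 1 1 0])
    (Seq0 (Block [Const 0 1, Add 1 1 0, LoadI 0 1]) (If0 0 (Block [Const 0 3, Sub 1 1 0])
      (Block [Const 0 3, Sub 1 1 0, Const 0 0]))))))))"

text \<open>The walk starts at rule 1, whose address is \<open>4 + s\<close>, with the packed
  counter already lowered once for rule 0. At rule \<open>i\<close> the counter is
  \<open>2 * s + (K - i)\<close>, so on stopping its parity is the number of rules left, 0 or
  1.\<close>

definition scan :: com0 where
  "scan = Seq0 (Block [Const 0 4, Add 0 0 3, Add 3 3 3, Add 3 3 1, Const 1 0, Add 1 1 0, Const 0 1, Sub 3 3 0])
    (Seq0 test_zeros (While0 0 (Seq0 (Block [Const 0 1, Add 1 1 0, LoadI 0 1, Add 1 1 0, Const 0 1,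
       Add 1 1 0, Sub 3 3 0])
     test_zeros)))"

definition save_code :: "nat \<Rightarrow> instr list" where
  "save_code k = concat (map (\<lambda>c. [Const 0 16, Add 1 1 0, StoreI 1 c]) [3..<3 + k])"

text \<open>The stop address is at least 4, so adding 36 puts the base \<open>b\<close> above the
  registers, and also beyond the last rule if the scan stopped before it. Cells 2 to 31 are saved
  using only registers 0 and 1; afterwards they are free for the copying loop. Input cell
  \<open>c\<close> goes to \<open>b + 16 * c + 1\<close>, which gives 33 for cell 2, 513 for cell
  32, and 497 as the offset of the last saved cell 31.\<close>

definition relocate :: com0 where
  "relocate = Seq0 (Block ([Const 0 36, Add 1 1 0, Const 0 33, Add 1 1 0, StoreI 1 2] @ save_code 29 @
     [Const 0 497, Sub 0 1 0, Const 2 32, Const 3 513, Add 3 3 0, Sub 4 0 2]))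
    (While0 4 (Block [LoadI 5 2, StoreI 3 5, Const 5 16, Add 3 3 5, Const 5 1, Add 2 2 5, Sub 4 0 2]))"

text \<open>The output must overwrite all 32 registers, so the last copy can use no scratch. Each
  register receives the address of its own output cell (register 0 holds it already), and
  \<open>load_regs\<close> loads each register through itself.\<close>

definition addr_regs :: "nat \<Rightarrow> instr list" where
  "addr_regs k = concat (map (\<lambda>c. [Const c (16 * c), Add c c 0]) [1..<1 + k])"

definition load_regs :: "nat \<Rightarrow> instr list" where
  "load_regs k = map (\<lambda>c. LoadI c c) [0..<k]"

text \<open>Cells from 32 on are copied while registers are still available, the low cells last.
  Register 4 is the end of the output left by \<open>emit\<close>, and 512 is the offset of output
  cell 32.\<close>

definition write_output :: com0 where
  "write_output = Seq0 (Block [Const 1 32, Const 2 512, Add 2 2 0, Sub 3 4 1])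
    (Seq0 (While0 3 (Block [LoadI 5 2, StoreI 1 5, Const 5 16, Add 2 2 5, Const 5 1, Add 1 1 5, Sub 3 4 1]))
      (Block (addr_regs 31 @ load_regs 32)))"

text \<open>An empty list is treated separately because \<open>scan\<close> reads cell 3 as the
  length of a first rule.\<close>

definition program :: com0 where
  "program = If0 1 (Seq0 scan (Seq0 relocate (Seq0 (tr main) write_output))) (Block [Const 0 0])"

lemma ok0_program: "ok0 program"
  by (auto simp: program_def scan_def test_zeros_def relocate_def save_code_def write_output_def
      addr_regs_def load_regs_def ok0_tr list_all_iff)

lemma wp0_test_zeros:
  assumes "m 1 = a" "2 \<le> a"
    and "\<And>z. z = 0 \<longleftrightarrow> m a = 0 \<and> m (a + 1) = 0 \<and> m (a + 2) = 0 \<and> m (a + 3) = 0 \<Longrightarrow> Q t (m(0 := z))"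
  shows "wp0 test_zeros Q t m"
proof -
  have e: "m(0 := z, Suc 0 := a) = m(0 := z)" "m(Suc 0 := a, 0 := z) = m(0 := z)" for z
    using assms(1) by (auto simp: fun_eq_iff)
  consider (1) "m a \<noteq> 0" | (2) "m a = 0" "m (a + 1) \<noteq> 0" | (3) "m a = 0" "m (a + 1) = 0" "m (a + 2) \<noteq> 0"
    | (4) "m a = 0" "m (a + 1) = 0" "m (a + 2) = 0" "m (a + 3) \<noteq> 0"
    | (5) "m a = 0" "m (a + 1) = 0" "m (a + 2) = 0" "m (a + 3) = 0" by blast
  then show ?thesis
  proof cases
    case 1
    have "fold ins [LoadI 0 1] m = m(0 := m a)" using assms(1) by simp
    then show ?thesis unfolding test_zeros_def
      using 1 assms(3)[of "m a"] by (intro wp0_Seq wp0_Block wp0_If) auto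
  next
    case 2
    have "Q t (m(0 := 1))" by (rule assms(3)) (use 2 in auto)
    then show ?thesis unfolding test_zeros_def
      using 2 assms(1,2) by (intro wp0_Seq wp0_Block wp0_If) (simp_all add: e)
  next
    case 3
    have "Q t (m(0 := 2))" by (rule assms(3)) (use 3 in auto)
    then show ?thesis unfolding test_zeros_def
      using 3 assms(1,2) by (intro wp0_Seq wp0_Block wp0_If) (simp_all add: e numeral_2_eq_2)
  next
    case 4
    have "Q t (m(0 := 3))" by (rule assms(3)) (use 4 in auto)
    then show ?thesis unfolding test_zeros_def
      using 4 assms(1,2) by (intro wp0_Seq wp0_Block wp0_If) (simp_all add: e eval_nat_numeral)
  next
    case 5
    have "Q t (m(0 := 0))" by (rule assms(3)) (use 5 in auto)
    then show ?thesis unfolding test_zeros_def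
      using 5 assms(1,2) by (intro wp0_Seq wp0_Block wp0_If) (simp_all add: e eval_nat_numeral)
  qed
qed

lemma wp0_scan:
  assumes vi: "valid_input n rs" and ne: "rs \<noteq> []"
    and m1: "m 1 = length rs" and w: "words rs m" and z: "\<forall>x\<ge>off rs (length rs). m x = 0"
    and Q: "\<And>t' m' d. d \<le> 1 \<Longrightarrow> 2 * d + 2 \<le> off rs (length rs) \<Longrightarrow> m' 1 = off rs (length rs) - 2 * d \<Longrightarrow>
      m' 3 = 2 * len rs 0 + d \<Longrightarrow> \<forall>x. x \<notin> {0, 1, 3} \<longrightarrow> m' x = m x \<Longrightarrow>
      \<forall>x\<ge>off rs (length rs) - 2 * d. 4 \<le> x \<longrightarrow> m x = 0 \<Longrightarrow> 4 \<le> off rs (length rs) - 2 * d \<Longrightarrow>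
      t' \<le> t + length rs \<Longrightarrow> Q t' m'"
  shows "wp0 scan Q t m"
proof -
  let ?K = "length rs"
  have K: "0 < ?K" using ne by simp
  have m3: "m 3 = len rs 0" using w K unfolding words_def by (auto simp: eval_nat_numeral)
  have ge: "4 \<le> off rs i" if "1 \<le> i" for i using off_mono[OF that, of rs] by simp
  \<comment> \<open>Four zeros at a rule mean that it is \<open>([], 0)\<close>; a rule behind it
    would be read from the last two zeros and coincide with it.\<close>
  have zK: "m (off rs i) = 0 \<and> m (off rs i + 1) = 0 \<and> m (off rs i + 2) = 0 \<and> m (off rs i + 3) = 0 \<Longrightarrow>
      1 \<le> i \<Longrightarrow> i \<le> ?K \<Longrightarrow> (i = ?K \<or> i + 1 = ?K \<and> off rs ?K = off rs i + 2)" for i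
  proof (rule ccontr)
    assume a: "m (off rs i) = 0 \<and> m (off rs i + 1) = 0 \<and> m (off rs i + 2) = 0 \<and> m (off rs i + 3) = 0"
      "1 \<le> i" "i \<le> ?K" and n: "\<not> (i = ?K \<or> i + 1 = ?K \<and> off rs ?K = off rs i + 2)"
    have i: "i < ?K" using a n by auto
    have r0: "snd (rs ! i) = 0" "len rs i = 0" using w i a unfolding words_def by auto
    have i1: "i + 1 < ?K"
    proof (rule ccontr)
      assume "\<not> i + 1 < ?K"
      then have "?K = Suc i" using i by simp
      then show False using n r0 by simp
    qed
    then have "snd (rs ! Suc i) = 0" "len rs (Suc i) = 0"
      using w a r0 unfolding words_def by (auto simp: eval_nat_numeral)
    then have "rs ! i = rs ! Suc i" using r0 by (simp add: len_def prod_eq_iff)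
    moreover have "distinct rs" using vi unfolding valid_input_def by (simp add: distinct_map)
    ultimately show False using i i1 by (simp add: nth_eq_iff_index_eq)
  qed
  define I where "I t' m' \<longleftrightarrow> (\<exists>i. 1 \<le> i \<and> i \<le> ?K \<and> m' 1 = off rs i \<and> m' 3 = 2 * len rs 0 + (?K - i) \<and>
     (\<forall>x. x \<notin> {0, 1, 3} \<longrightarrow> m' x = m x) \<and> t' + 1 = t + i \<and>
     (m' 0 = 0 \<longleftrightarrow> m (off rs i) = 0 \<and> m (off rs i + 1) = 0 \<and> m (off rs i + 2) = 0 \<and> m (off rs i + 3) = 0))"
    for t' :: nat and m' :: mem
  have tz: "wp0 test_zeros (\<lambda>t'' m''. I (t'' + k) m'' \<and> m'' 3 = m' 3) t' m'"
    if "1 \<le> i" "i \<le> ?K" "m' 1 = off rs i" "m' 3 = 2 * len rs 0 + (?K - i)"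
     "\<forall>x. x \<notin> {0, 1, 3} \<longrightarrow> m' x = m x" "t' + k + 1 = t + i" for i k t' m'
  proof (rule wp0_test_zeros)
    show "m' 1 = off rs i" by fact
    show "2 \<le> off rs i" using ge[OF that(1)] by simp
    fix y :: nat
    have eq: "m' (off rs i) = m (off rs i)" "m' (off rs i + 1) = m (off rs i + 1)"
      "m' (off rs i + 2) = m (off rs i + 2)" "m' (off rs i + 3) = m (off rs i + 3)"
      using that(5) ge[OF that(1)] by auto
    assume "y = 0 \<longleftrightarrow> m' (off rs i) = 0 \<and> m' (off rs i + 1) = 0 \<and> m' (off rs i + 2) = 0 \<and> m' (off rs i + 3) = 0"
    then show "I (t' + k) (m'(0 := y)) \<and> (m'(0 := y)) 3 = m' 3"
      unfolding I_def using that eq by (intro conjI exI[of _ i]) auto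
  qed
  show ?thesis unfolding scan_def
  proof (intro wp0_Seq wp0_Block)
    let ?m = "fold ins [Const 0 4, Add 0 0 3, Add 3 3 3, Add 3 3 1, Const 1 0, Add 1 1 0, Const 0 1, Sub 3 3 0] m"
    have f: "?m 1 = off rs 1" "?m 3 = 2 * len rs 0 + (?K - 1)" "\<forall>x. x \<notin> {0, 1, 3} \<longrightarrow> ?m x = m x"
    proof -
      obtain k where k: "?K = Suc k" using K by (cases ?K) auto
      then show "?m 1 = off rs 1" "?m 3 = 2 * len rs 0 + (?K - 1)" "\<forall>x. x \<notin> {0, 1, 3} \<longrightarrow> ?m x = m x"
        using m3 m1[unfolded k] by (auto simp: k)
    qed
    have "wp0 test_zeros (\<lambda>t' m'. I (t' + 0) m' \<and> m' 3 = ?m 3) t ?m" 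
      by (rule tz[where i = 1, OF _ _ f]) (use K in linarith)+
    then show "wp0 test_zeros (wp0 (While0 0 (Seq0 (Block [Const 0 1, Add 1 1 0, LoadI 0 1, Add 1 1 0, Const 0 1,
       Add 1 1 0, Sub 3 3 0]) test_zeros)) Q) t ?m"
    proof (rule wp0_mono)
      fix t1 m1 assume "I (t1 + 0) m1 \<and> m1 3 = ?m 3"
      then show "wp0 (While0 0 (Seq0 (Block [Const 0 1, Add 1 1 0, LoadI 0 1, Add 1 1 0, Const 0 1,
       Add 1 1 0, Sub 3 3 0]) test_zeros)) Q t1 m1"
      proof (intro wp0_While[where I = I and f = "\<lambda>m. m 3"])
        fix t2 m2 assume I: "I t2 m2" and nz: "m2 0 \<noteq> 0"
        then obtain i where i: "1 \<le> i" "i \<le> ?K" "m2 1 = off rs i" "m2 3 = 2 * len rs 0 + (?K - i)"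
          "\<forall>x. x \<notin> {0, 1, 3} \<longrightarrow> m2 x = m x" "t2 + 1 = t + i"
          "\<not> (m (off rs i) = 0 \<and> m (off rs i + 1) = 0 \<and> m (off rs i + 2) = 0 \<and> m (off rs i + 3) = 0)"
          unfolding I_def by auto
        \<comment> \<open>At the end of the input all cells are 0, and the test would have stopped
          the loop.\<close>
        have iK: "i < ?K" using i(2,7) z by (cases "i = ?K") auto
        have o: "4 \<le> off rs i" using ge i(1) .
        have s: "m (Suc (off rs i)) = len rs i" using w iK unfolding words_def by auto
        let ?m = "fold ins [Const 0 1, Add 1 1 0, LoadI 0 1, Add 1 1 0, Const 0 1, Add 1 1 0, Sub 3 3 0] m2"
        have "m2 (Suc (off rs i)) = len rs i" using i(5) o s by auto
        then have a: "?m 1 = off rs (Suc i)" "?m 3 = 2 * len rs 0 + (?K - Suc i)"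
          "\<forall>x. x \<notin> {0, 1, 3} \<longrightarrow> ?m x = m x"
          using i iK o by auto
        have "wp0 test_zeros (\<lambda>t' m'. I (t' + 1) m' \<and> m' 3 = ?m 3) t2 ?m"
          by (rule tz[where i = "Suc i", OF _ _ a]) (use i(6) iK in linarith)+
        moreover have "?m 3 < m2 3" using a(2) i(4) iK by simp
        ultimately have "wp0 test_zeros (\<lambda>t' m'. I (Suc t') m' \<and> m' 3 < m2 3) t2 ?m"
          by (elim wp0_mono) auto
        then show "wp0 (Seq0 (Block [Const 0 1, Add 1 1 0, LoadI 0 1, Add 1 1 0, Const 0 1,
           Add 1 1 0, Sub 3 3 0]) test_zeros) (\<lambda>t' m'. I (Suc t') m' \<and> m' 3 < m2 3) t2 m2"
          by (intro wp0_Seq wp0_Block)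
      next
        fix t2 m2 assume I: "I t2 m2" and zz: "m2 0 = 0"
        then obtain i where i: "1 \<le> i" "i \<le> ?K" "m2 1 = off rs i" "m2 3 = 2 * len rs 0 + (?K - i)"
          "\<forall>x. x \<notin> {0, 1, 3} \<longrightarrow> m2 x = m x" "t2 + 1 = t + i"
          "m (off rs i) = 0 \<and> m (off rs i + 1) = 0 \<and> m (off rs i + 2) = 0 \<and> m (off rs i + 3) = 0"
          unfolding I_def by auto
        have c: "i = ?K \<or> i + 1 = ?K \<and> off rs ?K = off rs i + 2" using zK[OF i(7,1,2)] .
        have o: "4 \<le> off rs i" using ge i(1) .
        show "Q t2 m2"
        proof (rule Q[where d = "?K - i"])
          \<comment> \<open>If one rule is left, it is \<open>([], 0)\<close>; its two cells hold
            zeros and count as free memory.\<close>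
          show "\<forall>x\<ge>off rs ?K - 2 * (?K - i). 4 \<le> x \<longrightarrow> m x = 0"
          proof (intro allI impI)
            fix x assume x: "off rs ?K - 2 * (?K - i) \<le> x"
            then have "off rs i \<le> x" using c by auto
            moreover have "off rs ?K \<le> off rs i + 2" using c by auto
            ultimately consider "x = off rs i" | "x = off rs i + 1" | "off rs ?K \<le> x" by linarith
            then show "m x = 0" using i(7) z by cases auto
          qed
        qed (use c i o in auto)
      qed simp
    qed
  qed
qed


section \<open>Moving input and output between low memory and the arrays\<close>

lemma addr_inj:
  fixes b i c j k :: nat
  assumes "j < 16" "k < 16"
  shows "b + 16 * i + j = b + 16 * c + k \<longleftrightarrow> i = c \<and> j = k"
proof
  assume "b + 16 * i + j = b + 16 * c + k"
  then have e: "16 * i + j = 16 * c + k" by linarith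
  have "j = (16 * i + j) mod 16" "k = (16 * c + k) mod 16" using assms by simp_all
  then have "j = k" using e by metis
  then show "i = c \<and> j = k" using e by simp
qed simp

lemma save_code_Suc: "save_code (Suc k) = save_code k @ [Const 0 16, Add 1 1 0, StoreI 1 (3 + k)]"
proof -
  have "[3..<3 + Suc k] = [3..<3 + k] @ [3 + k]"
    unfolding add_Suc_right by (rule upt_Suc_append) simp
  then show ?thesis unfolding save_code_def by simp
qed

lemma fold_save_code:
  assumes "m 1 = b + 33" "32 \<le> b" "k \<le> 29"
  shows "fold ins (save_code k) m 1 = b + 33 + 16 * k \<and>
    (\<forall>c. 3 \<le> c \<and> c < 3 + k \<longrightarrow> fold ins (save_code k) m (b + 16 * c + 1) = m c) \<and>
    (\<forall>x. x \<notin> {0, 1} \<and> (\<forall>c. 3 \<le> c \<and> c < 3 + k \<longrightarrow> x \<noteq> b + 16 * c + 1) \<longrightarrow> fold ins (save_code k) m x = m x)"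
  using assms(3)
proof (induction k)
  case 0
  then show ?case using assms by (simp add: save_code_def)
next
  case (Suc k)
  define m' where "m' = fold ins (save_code k) m"
  have IH: "m' 1 = b + 33 + 16 * k" "\<And>c. 3 \<le> c \<Longrightarrow> c < 3 + k \<Longrightarrow> m' (b + 16 * c + 1) = m c"
    "\<And>x. x \<notin> {0, 1} \<Longrightarrow> (\<And>c. 3 \<le> c \<Longrightarrow> c < 3 + k \<Longrightarrow> x \<noteq> b + 16 * c + 1) \<Longrightarrow> m' x = m x"
    using Suc unfolding m'_def by auto
  have src: "m' (3 + k) = m (3 + k)" by (rule IH(3)) (use Suc.prems assms(2) in auto)
  have "fold ins (save_code (Suc k)) m =
      m'(0 := 16, 1 := b + 16 * (3 + k) + 1, b + 16 * (3 + k) + 1 := m (3 + k))" (is "_ = ?m")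
    using IH(1) src assms(2) by (intro ext) (simp add: save_code_Suc m'_def[symmetric])
  moreover have "?m 1 = b + 33 + 16 * Suc k" using assms(2) by simp
  moreover have "?m (b + 16 * c + 1) = m c" if "3 \<le> c" "c < 3 + Suc k" for c
    using IH(2)[of c] that assms(2) by (cases "c = 3 + k") auto
  moreover have "?m x = m x" if "x \<notin> {0, 1}" "\<forall>c. 3 \<le> c \<and> c < 3 + Suc k \<longrightarrow> x \<noteq> b + 16 * c + 1" for x
  proof -
    have "x \<noteq> b + 16 * (3 + k) + 1" using that(2) by (metis add_Suc_right le_add1 lessI)
    moreover have "m' x = m x" by (rule IH(3)) (use that in auto)
    ultimately show ?thesis using that(1) by simp
  qed
  ultimately show ?case by simp
qed

lemma wp0_relocate:
  assumes m: "m 1 + 36 = b" "4 \<le> m 1" "\<forall>x\<ge>b. m x = 0"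
    and Q: "\<And>t' m'. rel b m' (\<lambda>j i. if j = 1 \<and> 2 \<le> i \<and> i < b then m i else 0) m' \<Longrightarrow>
      t' \<le> t + b \<Longrightarrow> Q t' m'"
  shows "wp0 relocate Q t m"
proof -
  have b: "40 \<le> b" using m by simp
  define ma where "ma = m(0 := 33, 1 := b + 33, b + 33 := m 2)"
  define mb where "mb = fold ins (save_code 29) ma"
  have "ma 1 = b + 33" using b by (simp add: ma_def)
  then have mb: "mb 1 = b + 497" "\<And>c. 3 \<le> c \<Longrightarrow> c < 32 \<Longrightarrow> mb (b + 16 * c + 1) = ma c"
    "\<And>x. x \<notin> {0, 1} \<Longrightarrow> (\<And>c. 3 \<le> c \<Longrightarrow> c < 32 \<Longrightarrow> x \<noteq> b + 16 * c + 1) \<Longrightarrow> mb x = ma x"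
    using fold_save_code[of ma b 29] b unfolding mb_def by auto
  define mc where "mc = mb(0 := b, 2 := 32, 3 := b + 513, 4 := b - 32)"
  have code: "fold ins ([Const 0 36, Add 1 1 0, Const 0 33, Add 1 1 0, StoreI 1 2] @ save_code 29 @
     [Const 0 497, Sub 0 1 0, Const 2 32, Const 3 513, Add 3 3 0, Sub 4 0 2]) m = mc"
  proof -
    have "fold ins [Const 0 36, Add 1 1 0, Const 0 33, Add 1 1 0, StoreI 1 2] m = ma"
      using m b by (intro ext) (auto simp: ma_def)
    then have "fold ins ([Const 0 36, Add 1 1 0, Const 0 33, Add 1 1 0, StoreI 1 2] @ save_code 29 @
        [Const 0 497, Sub 0 1 0, Const 2 32, Const 3 513, Add 3 3 0, Sub 4 0 2]) m =
        fold ins [Const 0 497, Sub 0 1 0, Const 2 32, Const 3 513, Add 3 3 0, Sub 4 0 2] mb"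
      unfolding fold_append mb_def by simp
    also have "\<dots> = mc" using mb(1) by (intro ext) (simp add: mc_def)
    finally show ?thesis .
  qed
  have arr: "mc (b + 16 * i + j) = (if j = 1 \<and> 2 \<le> i \<and> i < 32 then m i else 0)" if j: "j < 16" for i j
  proof -
    have "mc (b + 16 * i + j) = mb (b + 16 * i + j)" using b by (simp add: mc_def)
    also have "\<dots> = (if j = 1 \<and> 2 \<le> i \<and> i < 32 then m i else 0)"
    proof (cases "j = 1 \<and> 3 \<le> i \<and> i < 32")
      case True
      then have "mb (b + 16 * i + j) = ma i" using mb(2) by simp
      then show ?thesis using True b by (simp add: ma_def)
    next
      case False
      have "mb (b + 16 * i + j) = ma (b + 16 * i + j)"
      proof (rule mb(3))
        show "b + 16 * i + j \<notin> {0, 1}" using b by simp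
        show "b + 16 * i + j \<noteq> b + 16 * c + 1" if "3 \<le> c" "c < 32" for c
          using addr_inj[OF j, of 1 b i c] False that by auto
      qed
      also have "\<dots> = (if j = 1 \<and> i = 2 then m 2 else 0)"
        using addr_inj[OF j, of 1 b i 2] b m(3) by (auto simp: ma_def)
      finally show ?thesis using False by (auto simp: le_Suc_eq numeral_3_eq_3 numeral_2_eq_2)
    qed
    finally show ?thesis .
  qed
  have raw: "mc x = m x" if "32 \<le> x" "x < b" for x
  proof -
    have "mb x = ma x" by (rule mb(3)) (use that in auto)
    then show ?thesis using that by (simp add: mc_def ma_def)
  qed
  define I where "I t' m' \<longleftrightarrow> (\<exists>i. 32 \<le> i \<and> i \<le> b \<and> m' 0 = b \<and> m' 2 = i \<and> m' 3 = b + 16 * i + 1 \<and>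
     m' 4 = b - i \<and> t' + 32 = t + i \<and> (\<forall>x. 32 \<le> x \<and> x < b \<longrightarrow> m' x = m x) \<and>
     (\<forall>j<16. \<forall>c. m' (b + 16 * c + j) = (if j = 1 \<and> 2 \<le> c \<and> c < i then m c else 0)))"
    for t' :: nat and m' :: mem
  have "I t mc"
    unfolding I_def using arr raw b by (intro exI[of _ 32]) (auto simp: mc_def)
  then have "wp0 (While0 4 (Block [LoadI 5 2, StoreI 3 5, Const 5 16, Add 3 3 5, Const 5 1, Add 2 2 5,
      Sub 4 0 2])) Q t mc"
  proof (rule wp0_While[where I = I and f = "\<lambda>m. m 4"])
    fix t' m' assume "I t' m'" and nz: "m' 4 \<noteq> 0"
    then obtain i where i: "32 \<le> i" "i \<le> b" "m' 0 = b" "m' 2 = i" "m' 3 = b + 16 * i + 1"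
      "m' 4 = b - i" "t' + 32 = t + i" "\<forall>x. 32 \<le> x \<and> x < b \<longrightarrow> m' x = m x"
      "\<forall>j<16. \<forall>c. m' (b + 16 * c + j) = (if j = 1 \<and> 2 \<le> c \<and> c < i then m c else 0)"
      unfolding I_def by blast
    have lt: "i < b" using nz i by simp
    define mm where "mm = fold ins [LoadI 5 2, StoreI 3 5, Const 5 16, Add 3 3 5, Const 5 1, Add 2 2 5, Sub 4 0 2] m'"
    have eq: "mm = m'(5 := 1, b + 16 * i + 1 := m i, 3 := b + 16 * Suc i + 1, 2 := Suc i, 4 := b - Suc i)"
      unfolding mm_def using i lt b by (intro ext) simp
    have "mm (b + 16 * c + j) = (if j = 1 \<and> 2 \<le> c \<and> c < Suc i then m c else 0)" if j: "j < 16" for c j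
    proof -
      have "b + 16 * c + j \<noteq> 5" "b + 16 * c + j \<noteq> 3" "b + 16 * c + j \<noteq> 2" "b + 16 * c + j \<noteq> 4"
        using b by auto
      then have "mm (b + 16 * c + j) = (if b + 16 * c + j = b + 16 * i + 1 then m i else m' (b + 16 * c + j))"
        unfolding eq by simp
      also have "\<dots> = (if c = i \<and> j = 1 then m i else m' (b + 16 * c + j))"
        using addr_inj[OF j, of 1 b c i] by simp
      finally show ?thesis using i(1,9) j by auto
    qed
    moreover have "mm x = m x" if "32 \<le> x" "x < b" for x
      unfolding eq using i(8) that by simp
    moreover have "mm 0 = b" "mm 2 = Suc i" "mm 3 = b + 16 * Suc i + 1" "mm 4 = b - Suc i"
      unfolding eq using b i(3) by simp_all
    ultimately have "I (Suc t') mm"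
      unfolding I_def using i(1,7) lt by (intro exI[of _ "Suc i"]) simp
    moreover have "mm 4 < m' 4" using \<open>mm 4 = b - Suc i\<close> i(6) lt by simp
    ultimately show "wp0 (Block [LoadI 5 2, StoreI 3 5, Const 5 16, Add 3 3 5, Const 5 1, Add 2 2 5, Sub 4 0 2])
      (\<lambda>t' m'a. I (Suc t') m'a \<and> m'a 4 < m' 4) t' m'"
      by (intro wp0_Block) (simp only: mm_def[symmetric] simp_thms)
  next
    fix t' m' assume "I t' m'" and z: "m' 4 = 0"
    then obtain i where i: "32 \<le> i" "i \<le> b" "m' 0 = b" "m' 4 = b - i" "t' + 32 = t + i"
      "\<forall>j<16. \<forall>c. m' (b + 16 * c + j) = (if j = 1 \<and> 2 \<le> c \<and> c < i then m c else 0)"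
      unfolding I_def by blast
    then have "i = b" using z by simp
    then show "Q t' m'" using i b by (intro Q) (auto simp: rel_def)
  qed
  then show ?thesis unfolding relocate_def by (intro wp0_Seq wp0_Block) (simp only: code)
qed

lemma fold_addr_regs:
  assumes "m 0 = b"
  shows "(\<forall>c. 1 \<le> c \<and> c < 1 + k \<longrightarrow> fold ins (addr_regs k) m c = b + 16 * c) \<and>
    (\<forall>x. x = 0 \<or> 1 + k \<le> x \<longrightarrow> fold ins (addr_regs k) m x = m x)"
proof (induction k)
  case 0
  then show ?case by (simp add: addr_regs_def)
next
  case (Suc k)
  define m' where "m' = fold ins (addr_regs k) m"
  have "fold ins (addr_regs (Suc k)) m = m'(Suc k := b + 16 * Suc k)"
    using Suc assms by (intro ext) (simp add: addr_regs_def m'_def)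
  then show ?case using Suc unfolding m'_def[symmetric] by (auto simp: less_Suc_eq)
qed

text \<open>All sources lie beyond the registers, so a register loaded earlier is never read as a
  source.\<close>

lemma fold_load_regs:
  assumes "\<forall>c<32. 32 \<le> m c" "k \<le> 32"
  shows "(\<forall>c<k. fold ins (load_regs k) m c = m (m c)) \<and> (\<forall>x\<ge>k. fold ins (load_regs k) m x = m x)"
  using assms(2)
proof (induction k)
  case 0
  then show ?case by (simp add: load_regs_def)
next
  case (Suc k)
  define m' where "m' = fold ins (load_regs k) m"
  have IH: "\<forall>c<k. m' c = m (m c)" "\<forall>x\<ge>k. m' x = m x" using Suc unfolding m'_def by auto
  have "k \<le> m k" using assms(1) Suc.prems by (meson Suc_le_lessD le_trans less_imp_le_nat)
  then have "fold ins (load_regs (Suc k)) m = m'(k := m (m k))"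
    using IH(2) by (simp add: load_regs_def m'_def)
  then show ?case using IH by (auto simp: less_Suc_eq)
qed

lemma wp0_write_output:
  assumes m: "m 0 = b" "32 \<le> b" "m 4 = k" "k \<le> b" "\<forall>i. m (b + 16 * i) = w i"
    and Q: "\<And>t' m'. \<forall>x. x < 32 \<or> x < k \<longrightarrow> m' x = w x \<Longrightarrow> t' \<le> t + k \<Longrightarrow> Q t' m'"
  shows "wp0 write_output Q t m"
proof -
  define ma where "ma = m(1 := 32, 2 := b + 512, 3 := k - 32)"
  have code: "fold ins [Const 1 32, Const 2 512, Add 2 2 0, Sub 3 4 1] m = ma"
    using m by (intro ext) (simp add: ma_def)
  \<comment> \<open>The alternative \<open>i = 32\<close> covers outputs of fewer than 32 cells, for
    which the loop is not entered.\<close>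
  define I where "I t' m' \<longleftrightarrow> (\<exists>i. 32 \<le> i \<and> (i \<le> k \<or> i = 32) \<and> m' 0 = b \<and> m' 1 = i \<and> m' 2 = b + 16 * i \<and>
     m' 3 = k - i \<and> m' 4 = k \<and> t' + 32 = t + i \<and> (\<forall>x. 32 \<le> x \<and> x < i \<longrightarrow> m' x = w x) \<and>
     (\<forall>c. m' (b + 16 * c) = w c))" for t' :: nat and m' :: mem
  have "I t ma"
    unfolding I_def using m by (intro exI[of _ 32]) (auto simp: ma_def)
  then have "wp0 (While0 3 (Block [LoadI 5 2, StoreI 1 5, Const 5 16, Add 2 2 5, Const 5 1, Add 1 1 5,
      Sub 3 4 1])) (wp0 (Block (addr_regs 31 @ load_regs 32)) Q) t ma"
  proof (rule wp0_While[where I = I and f = "\<lambda>m. m 3"])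
    fix t' m' assume "I t' m'" and nz: "m' 3 \<noteq> 0"
    then obtain i where i: "32 \<le> i" "m' 0 = b" "m' 1 = i" "m' 2 = b + 16 * i" "m' 3 = k - i"
      "m' 4 = k" "t' + 32 = t + i" "\<forall>x. 32 \<le> x \<and> x < i \<longrightarrow> m' x = w x" "\<forall>c. m' (b + 16 * c) = w c"
      unfolding I_def by blast
    have lt: "i < k" using nz i by simp
    define mm where "mm = fold ins [LoadI 5 2, StoreI 1 5, Const 5 16, Add 2 2 5, Const 5 1, Add 1 1 5, Sub 3 4 1] m'"
    have eq: "mm = m'(5 := 1, i := w i, 2 := b + 16 * Suc i, 1 := Suc i, 3 := k - Suc i)"
      unfolding mm_def using i lt by (intro ext) simp
    have "mm (b + 16 * c) = w c" for c
    proof -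
      have "b + 16 * c \<noteq> 1" "b + 16 * c \<noteq> 2" "b + 16 * c \<noteq> 3" "b + 16 * c \<noteq> 5" "b + 16 * c \<noteq> i"
        using lt m(2,4) by linarith+
      then show ?thesis unfolding eq using i(9) by simp
    qed
    moreover have "mm x = w x" if "32 \<le> x" "x < Suc i" for x
      unfolding eq using i(8) that by (auto simp: less_Suc_eq)
    moreover have "mm 0 = b" "mm 1 = Suc i" "mm 2 = b + 16 * Suc i" "mm 3 = k - Suc i" "mm 4 = k"
      unfolding eq using i(1,2,6) by simp_all
    ultimately have "I (Suc t') mm"
      unfolding I_def using i(1,7) lt by (intro exI[of _ "Suc i"]) simp
    moreover have "mm 3 < m' 3" using \<open>mm 3 = k - Suc i\<close> i(5) lt by simp
    ultimately show "wp0 (Block [LoadI 5 2, StoreI 1 5, Const 5 16, Add 2 2 5, Const 5 1, Add 1 1 5, Sub 3 4 1])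
      (\<lambda>t' m'a. I (Suc t') m'a \<and> m'a 3 < m' 3) t' m'"
      by (intro wp0_Block) (simp only: mm_def[symmetric] simp_thms)
  next
    fix t' m' assume "I t' m'" and z: "m' 3 = 0"
    then obtain i where i: "32 \<le> i" "i \<le> k \<or> i = 32" "m' 0 = b" "m' 3 = k - i" "t' + 32 = t + i"
      "\<forall>x. 32 \<le> x \<and> x < i \<longrightarrow> m' x = w x" "\<forall>c. m' (b + 16 * c) = w c"
      unfolding I_def by blast
    define mb where "mb = fold ins (addr_regs 31) m'"
    have mb: "mb c = b + 16 * c" if "c < 32" for c
      using fold_addr_regs[where m = m' and b = b and k = 31, OF i(3)] that i(3) unfolding mb_def by (cases "c = 0") auto
    have mb': "mb x = m' x" if "32 \<le> x" for x
      using fold_addr_regs[where m = m' and b = b and k = 31, OF i(3)] that unfolding mb_def by auto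
    have "\<forall>c<32. 32 \<le> mb c" using mb m(2) by simp
    note ld = fold_load_regs[OF this order_refl]
    have out: "fold ins (load_regs 32) mb x = w x" if "x < 32 \<or> x < k" for x
    proof (cases "x < 32")
      case True
      then have "fold ins (load_regs 32) mb x = mb (b + 16 * x)" using ld mb by simp
      also have "\<dots> = w x" using mb'[of "b + 16 * x"] m(2) i(7) by simp
      finally show ?thesis .
    next
      case False
      then have "x < i" using that i(4) z by simp
      then show ?thesis using False ld mb' i(6) by simp
    qed
    have "t' \<le> t + k" using i by auto
    then have "Q t' (fold ins (addr_regs 31 @ load_regs 32) m')"
      using out by (intro Q) (simp_all add: mb_def)
    then show "wp0 (Block (addr_regs 31 @ load_regs 32)) Q t' m'" by (rule wp0_Block)
  qed
  then show ?thesis unfolding write_output_def by (intro wp0_Seq wp0_Block) (simp only: code)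
qed

section \<open>From memory contents back to sets of rules, and the total cost\<close>

lemma dec_rules_enc_out:
  assumes "\<forall>i<length (enc_out ys). m (a + i) = enc_out ys ! i"
  shows "dec_rules m a (length ys) = map (\<lambda>(xs, q). (set xs, q)) ys"
  using assms
proof (induction ys arbitrary: a)
  case (Cons y ys)
  obtain xs q where y: "y = (xs, q)" by (cases y)
  have e: "enc_out (y # ys) = q # length xs # xs @ enc_out ys" by (simp add: enc_out_def y)
  have w: "m (a + i) = (q # length xs # xs @ enc_out ys) ! i" if "i < 2 + length xs + length (enc_out ys)" for i
    using Cons.prems that unfolding e by simp
  have 0: "m a = q" "m (a + 1) = length xs" using w[of 0] w[of 1] by simp_all
  have 1: "m (a + 2 + i) = xs ! i" if "i < length xs" for i
    using w[of "2 + i"] that by (simp add: nth_append add.assoc)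
  have 2: "m (a + 2 + length xs + i) = enc_out ys ! i" if "i < length (enc_out ys)" for i
    using w[of "2 + length xs + i"] that by (simp add: nth_append add.assoc)
  define s where "s = a + 2"
  have "map m [s..<s + length xs] = xs"
  proof (rule nth_equalityI)
    fix i assume "i < length (map m [s..<s + length xs])"
    then have "i < length xs" by simp
    moreover from this have "map m [s..<s + length xs] ! i = m (s + i)" by simp
    ultimately show "map m [s..<s + length xs] ! i = xs ! i" using 1[of i] by (simp only: s_def)
  qed simp
  then have "set (map m [a + 2..<a + 2 + m (a + 1)]) = set xs" using 0 unfolding s_def by simp
  then show ?case using Cons.IH[of "a + 2 + length xs"] 2 0 by (simp add: y)
qed simp

lemma words_input: "words rs (init_mem (enc_input n rs))"
proof -
  have e: "enc_input n rs = n # length rs # enc_out rs" by (simp add: enc_input_def enc_out_def)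
  have m: "init_mem (enc_input n rs) x = enc_out rs ! (x - 2)" if "2 \<le> x" "x < length (enc_out rs) + 2" for x
    using that unfolding e init_mem_def by (auto simp: nth_Cons' numeral_2_eq_2)
  note E = enc_out_words[of rs]
  show ?thesis unfolding words_def
  proof (intro allI impI conjI)
    fix r assume r: "r < length rs"
    then have b: "2 \<le> off rs r" "off rs r + 2 + len rs r \<le> length (enc_out rs) + 2" using E by auto
    then show "init_mem (enc_input n rs) (off rs r) = snd (rs ! r)"
      using m[of "off rs r"] E r by simp
    show "init_mem (enc_input n rs) (off rs r + 1) = len rs r"
      using m[of "off rs r + 1"] b E r by simp
    fix j assume j: "j < len rs r"
    then show "init_mem (enc_input n rs) (off rs r + 2 + j) = fst (rs ! r) ! j"
      using m[of "off rs r + 2 + j"] b E r by simp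
  qed
qed

lemma words_cong:
  assumes "words rs w" "\<And>x. 2 \<le> x \<Longrightarrow> x < off rs (length rs) \<Longrightarrow> w' x = w x"
  shows "words rs w'"
  unfolding words_def
proof (intro allI impI)
  fix r assume r: "r < length rs"
  then have b: "2 \<le> off rs r" "off rs r + 2 + len rs r \<le> off rs (length rs)"
    using enc_out_words[of rs] by auto
  have "w' (off rs r) = w (off rs r)" "w' (off rs r + 1) = w (off rs r + 1)"
    "\<And>j. j < len rs r \<Longrightarrow> w' (off rs r + 2 + j) = w (off rs r + 2 + j)"
    using b by (auto intro!: assms(2))
  then show "w' (off rs r) = snd (rs ! r) \<and> w' (off rs r + 1) = len rs r \<and>
     (\<forall>j<len rs r. w' (off rs r + 2 + j) = fst (rs ! r) ! j)"
    using assms(1) r unfolding words_def by metis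
qed

lemma input_beyond: "off rs (length rs) \<le> x \<Longrightarrow> init_mem (enc_input n rs) x = 0"
  using enc_out_words[of rs] by (auto simp: init_mem_def enc_input_def enc_out_def)

text \<open>Validity demands distinct rules and distinct entries in each body, so sums over sets and
  over lists agree.\<close>

lemma input_size_eq:
  assumes "valid_input n rs"
  shows "input_size (rules_of rs) = length rs + (pre rs (length rs) - 1)"
proof -
  let ?f = "\<lambda>(xs, q). (set xs, q) :: nat rule"
  have d: "inj_on ?f (set rs)" "distinct rs" using assms by (auto simp: valid_input_def distinct_map)
  have "input_size (rules_of rs) = (\<Sum>r\<in>set rs. card (fst (?f r)) + 1)"
    unfolding input_size_def rules_of_def using sum.reindex[OF d(1)] by simp
  also have "\<dots> = (\<Sum>r\<in>set rs. length (fst r) + 1)"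
    using assms by (intro sum.cong) (auto simp: valid_input_def distinct_card case_prod_unfold)
  also have "\<dots> = sum_list (map (\<lambda>r. length (fst r) + 1) rs)"
    using d(2) by (simp add: sum_list_distinct_conv_sum_set)
  also have "\<dots> = (\<Sum>i<length rs. len rs i + 1)"
    by (simp add: sum_list_sum_nth lessThan_atLeast0 len_def)
  also have "\<dots> = length rs + (pre rs (length rs) - 1)"
    unfolding pre_def sum.distrib by simp
  finally show ?thesis .
qed

lemma wp0_program:
  assumes vi: "valid_input n rs"
  shows "wp0 program (\<lambda>t m. t \<le> 40 * (input_size (rules_of rs) + 1) ^ 2 \<and>
     output_rules m = critical_rules {0..<n} (AR {0..<n} (rules_of rs))) 0 (init_mem (enc_input n rs))"
    (is "wp0 program ?Q 0 ?m")
proof -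
  have m1: "?m 1 = length rs" by (simp add: init_mem_def enc_input_def)
  show ?thesis unfolding program_def
  proof (rule wp0_If)
    assume "?m 1 = 0"
    then have rs: "rs = []" using m1 by simp
    have "critical_rules {0..<n} (AR {0..<n} (rules_of rs)) = {}"
      using critical_rules_AR[of "{0..<n}" "rules_of rs"] by (simp add: rs rules_of_def)
    then have "?Q 0 (fold ins [Const 0 0] ?m)" by (simp add: output_rules_def)
    then show "wp0 (Block [Const 0 0]) ?Q 0 ?m" by (rule wp0_Block)
  next
    assume "?m 1 \<noteq> 0"
    then have ne: "rs \<noteq> []" using m1 by auto
    show "wp0 (Seq0 scan (Seq0 relocate (Seq0 (tr main) write_output))) ?Q 0 ?m"
    proof (rule wp0_Seq, rule wp0_scan[OF vi ne m1 words_input])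
      show "\<forall>x\<ge>off rs (length rs). ?m x = 0" using input_beyond by blast
      fix t1 m1 d
      assume d: "d \<le> 1" "2 * d + 2 \<le> off rs (length rs)" and m1: "m1 1 = off rs (length rs) - 2 * d"
        "m1 3 = 2 * len rs 0 + d" "\<forall>x. x \<notin> {0, 1, 3} \<longrightarrow> m1 x = ?m x"
        and z: "\<forall>x\<ge>off rs (length rs) - 2 * d. 4 \<le> x \<longrightarrow> ?m x = 0" "4 \<le> off rs (length rs) - 2 * d"
        and t1: "t1 \<le> 0 + length rs"
      define b where "b = off rs (length rs) - 2 * d + 36"
      show "wp0 (Seq0 relocate (Seq0 (tr main) write_output)) ?Q t1 m1"
      proof (rule wp0_Seq, rule wp0_relocate[where b = b])
        show "m1 1 + 36 = b" "4 \<le> m1 1" using m1(1) z(2) by (simp_all add: b_def)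
        show "\<forall>x\<ge>b. m1 x = 0"
        proof (intro allI impI)
          fix x assume "b \<le> x"
          then have "off rs (length rs) - 2 * d \<le> x" "40 \<le> x" using z(2) by (simp_all add: b_def)
          then show "m1 x = 0" using m1(3) z(1) by auto
        qed
        fix t2 m2
        assume rel: "rel b m2 (\<lambda>j i. if j = 1 \<and> 2 \<le> i \<and> i < b then m1 i else 0) m2" and t2: "t2 \<le> t1 + b"
        let ?A = "\<lambda>j i. if j = 1 \<and> 2 \<le> i \<and> i < b then m1 i else 0 :: nat"
        have b4: "40 \<le> b" using z(2) by (simp add: b_def)
        have "wp main (\<lambda>t' v' A'. \<exists>ys. v' 0 = b \<and>
          (\<lambda>(xs, q). (set xs, q)) ` set ys = critical_rules {0..<n} (AR {0..<n} (rules_of rs)) \<and>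
          length (enc_out ys) \<le> (pre rs (length rs) - 1) + 2 * length rs \<and> v' 4 = Suc (length (enc_out ys)) \<and>
          (\<forall>i < length (enc_out ys). A' 0 (Suc i) = enc_out ys ! i) \<and> A' 0 0 = length ys \<and>
          t' \<le> t2 + (2 * (pre rs (length rs) - 1) + length rs + length rs * (7 * (pre rs (length rs) - 1) +
            4 * length rs + 1))) t2 m2 ?A"
        proof (rule wp_main[OF vi ne d(1)])
          show "m2 0 = off rs (length rs) - 2 * d + 36" using rel by (auto simp: rel_def b_def)
          show "?A 1 3 = 2 * len rs 0 + d" using m1(2) b4 by simp
          show "words rs ((?A 1)(3 := len rs 0))"
          proof (rule words_cong[OF words_input[of rs n]])
            fix x assume x: "2 \<le> x" "x < off rs (length rs)"
            show "((?A 1)(3 := len rs 0)) x = ?m x"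
            proof (cases "x = 3")
              case True
              have "?m 3 = len rs 0" using words_input[of rs n] ne unfolding words_def
                by (auto simp: eval_nat_numeral)
              then show ?thesis using True by simp
            next
              case False
              have "x < b" using x(2) d by (simp add: b_def)
              then show ?thesis using x(1) False m1(3) by simp
            qed
          qed
        qed (use d(2) rel in \<open>auto simp: rel_def b_def\<close>)
        then obtain t3 v3 A3 ys where e: "ex main t2 m2 ?A t3 v3 A3" and p: "v3 0 = b"
          "(\<lambda>(xs, q). (set xs, q)) ` set ys = critical_rules {0..<n} (AR {0..<n} (rules_of rs))"
          "length (enc_out ys) \<le> (pre rs (length rs) - 1) + 2 * length rs" "v3 4 = Suc (length (enc_out ys))"
          "\<forall>i < length (enc_out ys). A3 0 (Suc i) = enc_out ys ! i" "A3 0 0 = length ys"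
          "t3 \<le> t2 + (2 * (pre rs (length rs) - 1) + length rs + length rs * (7 * (pre rs (length rs) - 1) +
            4 * length rs + 1))" unfolding wp_def by blast
        obtain m3 where m3: "ex0 (tr main) t2 m2 t3 m3" "rel b v3 A3 m3"
          using ex_tr[OF e ok_main rel] by blast
        have o: "off rs (length rs) = 2 * length rs + 2 + (pre rs (length rs) - 1)"
          using off_pre[of rs "length rs"] pre_pos[of rs "length rs"] by simp
        have "wp0 write_output ?Q t3 m3"
        proof (rule wp0_write_output[where w = "A3 0" and k = "Suc (length (enc_out ys))"])
          show "m3 0 = b" "32 \<le> b" using m3(2) by (auto simp: rel_def)
          show "m3 4 = Suc (length (enc_out ys))" using m3(2) p(4) by (auto simp: rel_def)
          show "Suc (length (enc_out ys)) \<le> b" using p(3) o d(1) by (simp add: b_def)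
          show "\<forall>i. m3 (b + 16 * i) = A3 0 i"
          proof
            fix i
            have "m3 (b + 16 * i + 0) = A3 0 i" using m3(2) unfolding rel_def by (meson zero_less_numeral)
            then show "m3 (b + 16 * i) = A3 0 i" by simp
          qed
          fix t4 m4
          assume m4: "\<forall>x. x < 32 \<or> x < Suc (length (enc_out ys)) \<longrightarrow> m4 x = A3 0 x"
            and t4: "t4 \<le> t3 + Suc (length (enc_out ys))"
          have "output_rules m4 = set (map (\<lambda>(xs, q). (set xs, q)) ys)"
          proof -
            have "m4 0 = length ys" using m4 p(6) by simp
            moreover have "\<forall>i<length (enc_out ys). m4 (1 + i) = enc_out ys ! i" using m4 p(5) by simp
            ultimately show ?thesis unfolding output_rules_def using dec_rules_enc_out by metis
          qed
          then have out: "output_rules m4 = critical_rules {0..<n} (AR {0..<n} (rules_of rs))"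
            using p(2) by simp
          define K where "K = length rs"
          define M where "M = pre rs K - 1"
          have "t4 \<le> 6 * K + 4 * M + 39 + K * (7 * M + 4 * K + 1)"
            using t4 t2 t1 p(3,7) o unfolding b_def K_def[symmetric] M_def[symmetric] by linarith
          also have "\<dots> \<le> 40 * (K + M + 1) ^ 2" by (simp add: power2_eq_square algebra_simps)
          finally show "?Q t4 m4" using out input_size_eq[OF vi] unfolding K_def M_def by simp
        qed
        then show "wp0 (Seq0 (tr main) write_output) ?Q t2 m2"
          using m3(1) unfolding wp0_def by (blast intro: ex0.Seq0)
      qed
    qed
  qed
qed

theorem theorem1p4:
  shows "\<exists>(P :: instr list) (c :: nat). \<forall>n rs. valid_input n rs \<longrightarrow>
     (\<exists>t. t \<le> c * (input_size (rules_of rs) + 1) ^ 2 \<and>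
          halted P (run P t (0, init_mem (enc_input n rs))) \<and>
          output_rules (snd (run P t (0, init_mem (enc_input n rs))))
            = critical_rules {0..<n} (AR {0..<n} (rules_of rs)))"
proof (rule exI[of _ "comp0 0 program"], rule exI[of _ "size0 program * 41"], intro allI impI)
  fix n rs assume vi: "valid_input n rs"
  let ?l = "input_size (rules_of rs)" and ?P = "comp0 0 program"
  obtain t m where e: "ex0 program 0 (init_mem (enc_input n rs)) t m" and t: "t \<le> 40 * (?l + 1) ^ 2"
    and out: "output_rules m = critical_rules {0..<n} (AR {0..<n} (rules_of rs))"
    using wp0_program[OF vi] unfolding wp0_def by blast
  obtain k where k: "k \<le> size0 program * (t - 0 + 1)"
    "run ([] @ comp0 (length ([] :: instr list)) program @ []) k (length ([] :: instr list), init_mem (enc_input n rs))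
      = (length ([] :: instr list) + size0 program, m)"
    using run_comp0[OF e ok0_program, of "[]" "[]"] by blast
  have r: "run ?P k (0, init_mem (enc_input n rs)) = (size0 program, m)" using k(2) by simp
  \<comment> \<open>The compiler bound has a factor \<open>t + 1\<close>; the extra 1 raises the
    constant 40 to 41.\<close>
  have "t + 1 \<le> 41 * (?l + 1) ^ 2" using t by (simp add: power2_eq_square)
  then have "k \<le> size0 program * (41 * (?l + 1) ^ 2)"
    using k(1) by (metis diff_zero le_trans mult_le_mono2)
  then have "k \<le> (size0 program * 41) * (?l + 1) ^ 2" by (simp only: mult.assoc)
  then show "\<exists>t. t \<le> (size0 program * 41) * (?l + 1) ^ 2 \<and>
      halted ?P (run ?P t (0, init_mem (enc_input n rs))) \<and>
      output_rules (snd (run ?P t (0, init_mem (enc_input n rs)))) =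
        critical_rules {0..<n} (AR {0..<n} (rules_of rs))"
    using r out by (intro exI[of _ k]) (simp add: halted_def)
qed

end
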